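(* (Soundness) If there is a cyclic proof of a sequent $\Gamma\vdash\Delta$ in the cyclic proof system for $\mathrm{HFL}_{\mathbb{N}}$ described in the context, then $\Gamma\vdash\Delta$ is valid, i.e. for every valuation $\rho$ of its free variables, $[\![\varphi]\!]_\rho=\bot$ for some $\varphi\in\Gamma$ or $[\![\psi]\!]_\rho=\top$ for some $\psi\in\Delta$.
   Context: $\mathrm{HFL}_{\mathbb{N}}$. Types: $A ::= \mathbf{N} \mid T$, $T ::= \mathbf{\Omega} \mid A \to T$. Terms: $s,t ::= x \mid \mathbf{Z} \mid \mathbf{S}t$. Formulas: $\varphi,\psi ::= s=t \mid \varphi\lor\psi \mid \varphi\land\psi \mid x \mid \lambda x^A.\varphi \mid \varphi\,\psi \mid \varphi\,t \mid \mu x^T.\varphi \mid \nu x^T.\varphi$, simply typed in the usual way ($s=t$, $\lor$, $\land$ of type $\mathbf{\Omega}$; $\mu x^T.\varphi,\nu x^T.\varphi$ require $\varphi:T$ under $x:T$). Semantics: $[\![\mathbf{N}]\!]=\mathbb{N}$ discretely ordered, $[\![\mathbf{\Omega}]\!]=\{\bot\le\top\}$, $[\![A\to T]\!]$ = monotone functions ordered pointwise; connectives, $\lambda$ and application standard; $\mu,\nu$ are least/greatest fixed points. A valuation maps each variable to an element of the interpretation of its type. A sequent $\Gamma\vdash\Delta$ is a pair of finite sequences of formulas of type $\mathbf{\Omega}$. Write $\exists x'.\theta$ for $(\mu Y^{\mathbf{N}\to\mathbf{\Omega}}.\lambda x'.\theta\lor Y(\mathbf{S}x'))\,\mathbf{Z}$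 and $N \equiv \mu X.\lambda x.(x=\mathbf{Z})\lor(\exists x'.x=\mathbf{S}x'\land X\,x')$. Rules ($\sigma\in\{\mu,\nu\}$, $\vec\psi$ a possibly empty argument list): (Axiom) $\varphi\vdash\varphi$; (Cut) from $\Gamma\vdash\varphi,\Delta$ and $\Gamma,\varphi\vdash\Delta$ infer $\Gamma\vdash\Delta$; weakening, contraction, exchange on both sides; (Subst) from $\Gamma\vdash\Delta$ infer $\Gamma[\varphi/x]\vdash\Delta[\varphi/x]$; (Mono) from $k$ copies of $\Gamma,\psi\,\vec y\vdash\chi\,\vec y,\Delta$ ($k$ = number of occurrences of $x$ in $\varphi$, $\vec y$ fresh) infer $\Gamma,\varphi[\psi/x^T]\vdash\varphi[\chi/x^T],\Delta$; ($=L$) from $\Gamma[t/x,s/y]\vdash\Delta[t/x,s/y]$ infer $\Gamma[s/x,t/y],s=t\vdash\Delta[s/x,t/y]$; ($=R$) $\Gamma\vdash t=t,\Delta$; ($\lor L$), ($\lor R$) (from $\Gamma\vdash\varphi,\psi,\Delta$), ($\land L$) (from $\Gamma,\varphi,\psi\vdash\Delta$), ($\land R$) standard; ($\lambda L/R$) replace $(\lambda x.\varphi)\psi\vec\psi$ on the left/right by $\varphi[\psi/x]\vec\psi$; ($\sigma L/R$) replace $(\sigma x.\varphi)\vec\psi$ on the left/right by $\varphi[\sigma x.\varphi/x]\vec\psi$; (Nat) from $\Gamma,N\,x^{\mathbf{N}}\vdash\Delta$ infer $\Gamma\vdash\Delta$; (P1) $\mathbf{S}s=\mathbf{Z}\vdash$;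 (P2) from $\Gamma,s=t\vdash\Delta$ infer $\Gamma,\mathbf{S}s=\mathbf{S}t\vdash\Delta$. The rules ($=$), ($\lor$), ($\land$), ($\lambda$), ($\sigma$) (left and right) are logical rules; an occurrence in a conclusion is principal if it is not in $\Gamma$ or $\Delta$. A pre-proof $(\mathcal{D},\mathcal{R})$ is a finite derivation tree $\mathcal{D}$ (leaves need not be axioms; non-axiom leaves are open) with a map $\mathcal{R}$ sending each open leaf to a non-leaf node with the same sequent. A path is a sequence of nodes $(n_i)$ with $n_{i+1}=\mathcal{R}(n_i)$ if $n_i$ is an open leaf and $n_{i+1}$ a premise of $n_i$ otherwise. Relevant occurrences: side formulas of a premise are relevant to the corresponding ones of the conclusion (via the substitutions of (Subst),($=L$)); both copies in contraction correspond; in ($\land L$),($\lor R$) both components are relevant to the principal formula, in ($\lor L$),($\land R$) the component in the premise; in ($\lambda$),($\sigma$) the reduct/unfolding; in (Mono) $\psi\vec y$, $\chi\vec y$ are relevant to $\varphi[\psi/x]$, $\varphi[\chi/x]$; in (P2) $s=t$ to $\mathbf{S}s=\mathbf{S}t$; the cut formula and $N\,x$ in (Nat) are relevant to nothing. A trace along a path is a sequence of occurrences $(\tau_i)$, $\tau_i$ in $n_i$, $\tau_{i+1}$ relevant to $\tau_i$, with $\tau_i$ principal in a logical rule for infinitely many $i$. Annotation: every fixed-point operator in $\tau_0$ gets $\epsilon$; if $\tau_i=(\sigma_p x.\varphi)\vec\psi$ is principal in ($\sigma L/R$), then $\tau_{i+1}=\varphi[\sigma_{p.k}x.\varphi/x]\vec\psi$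 with $k$ a natural number not used before; if $\tau_i=\varphi[\psi_1/x_1,\dots,\psi_k/x_k]$ is principal in (Mono) and $\tau_{i+1}$ is in the $j$-th premise, then $\tau_{i+1}=\psi_j\vec y$ keeps the annotations of $\psi_j$; otherwise annotations are inherited. The trace is a $\mu$-trace (resp. $\nu$-trace) if there is an infinite sequence $p$ such that for every $n$ its length-$n$ prefix is assigned to some $\mu$ (resp. $\nu$) in some $\tau_i$; it is left/right according to the side of $\tau_0$. A cyclic proof is a pre-proof in which every infinite path has a tail carrying a left $\mu$-trace or a right $\nu$-trace. *)

theory Defs
  imports Main
begin

section \<open>Types and expressions\<close>

datatype aty = TyN | TyF fty
and fty = Omega | Arr aty fty

text \<open>
  The syntax is locally nameless. Bound variables (\<open>TBd\<close>, \<open>Bd\<close>) are de Bruijn indices, counted over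
  all enclosing binders regardless of their type; free variables (\<open>TFr\<close>, \<open>Fr\<close>) are names decorated
  with their type, so a variable is a pair of a name and a type. Formulas are thereby identified up to
  renaming of bound variables, and substituting an expression without dangling indices for a free
  variable cannot capture.
\<close>

datatype tm = TBd nat | TFr nat | Zero | Succ tm

datatype fp = Mu | Nu

text \<open>
  The parameter \<open>'a\<close> is the type of the annotations of fixed-point operators: \<open>unit\<close> for ordinary
  formulas, \<open>nat list\<close> for the annotated formulas of traces.
\<close>

datatype 'a fm =
    Eq tm tm
  | Or "'a fm" "'a fm"
  | And "'a fm" "'a fm"
  | Bd nat
  | Fr nat fty
  | Lam aty "'a fm"
  | App "'a fm" "'a fm"
  | AppT "'a fm" tm
  | Fix fp 'a fty "'a fm"

type_synonym form = "unit fm"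

datatype 'a arg = ArgF "'a fm" | ArgT tm

fun app1 :: "'a fm \<Rightarrow> 'a arg \<Rightarrow> 'a fm" where
  "app1 \<phi> (ArgF \<psi>) = App \<phi> \<psi>"
| "app1 \<phi> (ArgT t) = AppT \<phi> t"

definition apps :: "'a fm \<Rightarrow> 'a arg list \<Rightarrow> 'a fm" where
  "apps \<phi> es = foldl app1 \<phi> es"

fun var_arg :: "nat \<times> aty \<Rightarrow> 'a arg" where
  "var_arg (x, TyN) = ArgT (TFr x)"
| "var_arg (x, TyF T) = ArgF (Fr x T)"

definition erase :: "'a fm \<Rightarrow> form" where
  "erase \<phi> = map_fm (\<lambda>_. ()) \<phi>"

primrec anns :: "fp \<Rightarrow> 'a fm \<Rightarrow> 'a set" where
  "anns \<sigma> (Eq s t) = {}"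
| "anns \<sigma> (Or \<phi> \<psi>) = anns \<sigma> \<phi> \<union> anns \<sigma> \<psi>"
| "anns \<sigma> (And \<phi> \<psi>) = anns \<sigma> \<phi> \<union> anns \<sigma> \<psi>"
| "anns \<sigma> (Bd i) = {}"
| "anns \<sigma> (Fr x T) = {}"
| "anns \<sigma> (Lam A \<phi>) = anns \<sigma> \<phi>"
| "anns \<sigma> (App \<phi> \<psi>) = anns \<sigma> \<phi> \<union> anns \<sigma> \<psi>"
| "anns \<sigma> (AppT \<phi> t) = anns \<sigma> \<phi>"
| "anns \<sigma> (Fix \<tau> p T \<phi>) = (if \<tau> = \<sigma> then {p} else {}) \<union> anns \<sigma> \<phi>"

subsection \<open>Free variables and substitution\<close>

primrec fv_tm :: "tm \<Rightarrow> (nat \<times> aty) set" where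
  "fv_tm (TBd i) = {}"
| "fv_tm (TFr x) = {(x, TyN)}"
| "fv_tm Zero = {}"
| "fv_tm (Succ t) = fv_tm t"

primrec fv :: "'a fm \<Rightarrow> (nat \<times> aty) set" where
  "fv (Eq s t) = fv_tm s \<union> fv_tm t"
| "fv (Or \<phi> \<psi>) = fv \<phi> \<union> fv \<psi>"
| "fv (And \<phi> \<psi>) = fv \<phi> \<union> fv \<psi>"
| "fv (Bd i) = {}"
| "fv (Fr x T) = {(x, TyF T)}"
| "fv (Lam A \<phi>) = fv \<phi>"
| "fv (App \<phi> \<psi>) = fv \<phi> \<union> fv \<psi>"
| "fv (AppT \<phi> t) = fv \<phi> \<union> fv_tm t"
| "fv (Fix \<sigma> p T \<phi>) = fv \<phi>"

primrec open_tm :: "nat \<Rightarrow> tm \<Rightarrow> tm \<Rightarrow> tm" where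
  "open_tm n u (TBd i) = (if i = n then u else TBd i)"
| "open_tm n u (TFr x) = TFr x"
| "open_tm n u Zero = Zero"
| "open_tm n u (Succ t) = Succ (open_tm n u t)"

primrec openT :: "nat \<Rightarrow> tm \<Rightarrow> 'a fm \<Rightarrow> 'a fm" where
  "openT n u (Eq s t) = Eq (open_tm n u s) (open_tm n u t)"
| "openT n u (Or \<phi> \<psi>) = Or (openT n u \<phi>) (openT n u \<psi>)"
| "openT n u (And \<phi> \<psi>) = And (openT n u \<phi>) (openT n u \<psi>)"
| "openT n u (Bd i) = Bd i"
| "openT n u (Fr x T) = Fr x T"
| "openT n u (Lam A \<phi>) = Lam A (openT (Suc n) u \<phi>)"
| "openT n u (App \<phi> \<psi>) = App (openT n u \<phi>) (openT n u \<psi>)"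
| "openT n u (AppT \<phi> t) = AppT (openT n u \<phi>) (open_tm n u t)"
| "openT n u (Fix \<sigma> p T \<phi>) = Fix \<sigma> p T (openT (Suc n) u \<phi>)"

primrec openF :: "nat \<Rightarrow> 'a fm \<Rightarrow> 'a fm \<Rightarrow> 'a fm" where
  "openF n \<chi> (Eq s t) = Eq s t"
| "openF n \<chi> (Or \<phi> \<psi>) = Or (openF n \<chi> \<phi>) (openF n \<chi> \<psi>)"
| "openF n \<chi> (And \<phi> \<psi>) = And (openF n \<chi> \<phi>) (openF n \<chi> \<psi>)"
| "openF n \<chi> (Bd i) = (if i = n then \<chi> else Bd i)"
| "openF n \<chi> (Fr x T) = Fr x T"
| "openF n \<chi> (Lam A \<phi>) = Lam A (openF (Suc n) \<chi> \<phi>)"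
| "openF n \<chi> (App \<phi> \<psi>) = App (openF n \<chi> \<phi>) (openF n \<chi> \<psi>)"
| "openF n \<chi> (AppT \<phi> t) = AppT (openF n \<chi> \<phi>) t"
| "openF n \<chi> (Fix \<sigma> p T \<phi>) = Fix \<sigma> p T (openF (Suc n) \<chi> \<phi>)"

text \<open>If \<open>\<phi>\<close> is the body of a binder, \<open>opn \<phi> e\<close> is the body with \<open>e\<close> for the bound variable.\<close>

fun opn :: "'a fm \<Rightarrow> 'a arg \<Rightarrow> 'a fm" where
  "opn \<phi> (ArgF \<psi>) = openF 0 \<psi> \<phi>"
| "opn \<phi> (ArgT t) = openT 0 t \<phi>"

primrec subst_tm :: "(nat \<Rightarrow> tm) \<Rightarrow> tm \<Rightarrow> tm" where
  "subst_tm \<theta> (TBd i) = TBd i"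
| "subst_tm \<theta> (TFr x) = \<theta> x"
| "subst_tm \<theta> Zero = Zero"
| "subst_tm \<theta> (Succ t) = Succ (subst_tm \<theta> t)"

text \<open>Simultaneous substitution of terms for the free variables of type \<open>TyN\<close>.\<close>

primrec substT :: "(nat \<Rightarrow> tm) \<Rightarrow> 'a fm \<Rightarrow> 'a fm" where
  "substT \<theta> (Eq s t) = Eq (subst_tm \<theta> s) (subst_tm \<theta> t)"
| "substT \<theta> (Or \<phi> \<psi>) = Or (substT \<theta> \<phi>) (substT \<theta> \<psi>)"
| "substT \<theta> (And \<phi> \<psi>) = And (substT \<theta> \<phi>) (substT \<theta> \<psi>)"
| "substT \<theta> (Bd i) = Bd i"
| "substT \<theta> (Fr x T) = Fr x T"
| "substT \<theta> (Lam A \<phi>) = Lam A (substT \<theta> \<phi>)"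
| "substT \<theta> (App \<phi> \<psi>) = App (substT \<theta> \<phi>) (substT \<theta> \<psi>)"
| "substT \<theta> (AppT \<phi> t) = AppT (substT \<theta> \<phi>) (subst_tm \<theta> t)"
| "substT \<theta> (Fix \<sigma> p T \<phi>) = Fix \<sigma> p T (substT \<theta> \<phi>)"

primrec nocc :: "nat \<Rightarrow> fty \<Rightarrow> 'a fm \<Rightarrow> nat" where
  "nocc x T (Eq s t) = 0"
| "nocc x T (Or \<phi> \<psi>) = nocc x T \<phi> + nocc x T \<psi>"
| "nocc x T (And \<phi> \<psi>) = nocc x T \<phi> + nocc x T \<psi>"
| "nocc x T (Bd i) = 0"
| "nocc x T (Fr y U) = (if y = x \<and> U = T then 1 else 0)"
| "nocc x T (Lam A \<phi>) = nocc x T \<phi>"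
| "nocc x T (App \<phi> \<psi>) = nocc x T \<phi> + nocc x T \<psi>"
| "nocc x T (AppT \<phi> t) = nocc x T \<phi>"
| "nocc x T (Fix \<sigma> p U \<phi>) = nocc x T \<phi>"

text \<open>
  \<open>msubst x T \<xi> \<phi>\<close> replaces the \<open>j\<close>-th occurrence (from the left, counted from 0) of the free
  variable \<open>x\<close> of type \<open>T\<close> by \<open>\<xi> j\<close>. Annotated formulas need this because the copies of a formula
  introduced by a substitution may carry different annotations.
\<close>

primrec msubst :: "nat \<Rightarrow> fty \<Rightarrow> (nat \<Rightarrow> 'a fm) \<Rightarrow> 'a fm \<Rightarrow> 'a fm" where
  "msubst x T \<xi> (Eq s t) = Eq s t"
| "msubst x T \<xi> (Or \<phi> \<psi>) = Or (msubst x T \<xi> \<phi>) (msubst x T (\<lambda>j. \<xi> (nocc x T \<phi> + j)) \<psi>)"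
| "msubst x T \<xi> (And \<phi> \<psi>) = And (msubst x T \<xi> \<phi>) (msubst x T (\<lambda>j. \<xi> (nocc x T \<phi> + j)) \<psi>)"
| "msubst x T \<xi> (Bd i) = Bd i"
| "msubst x T \<xi> (Fr y U) = (if y = x \<and> U = T then \<xi> 0 else Fr y U)"
| "msubst x T \<xi> (Lam A \<phi>) = Lam A (msubst x T \<xi> \<phi>)"
| "msubst x T \<xi> (App \<phi> \<psi>) = App (msubst x T \<xi> \<phi>) (msubst x T (\<lambda>j. \<xi> (nocc x T \<phi> + j)) \<psi>)"
| "msubst x T \<xi> (AppT \<phi> t) = AppT (msubst x T \<xi> \<phi>) t"
| "msubst x T \<xi> (Fix \<sigma> p U \<phi>) = Fix \<sigma> p U (msubst x T \<xi> \<phi>)"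

definition subst :: "nat \<Rightarrow> fty \<Rightarrow> 'a fm \<Rightarrow> 'a fm \<Rightarrow> 'a fm" where
  "subst x T \<psi> \<phi> = msubst x T (\<lambda>_. \<psi>) \<phi>"

subsection \<open>Typing\<close>

text \<open>The list \<open>\<Theta>\<close> gives the types of the de Bruijn indices, innermost binder first.\<close>

primrec wt_tm :: "aty list \<Rightarrow> tm \<Rightarrow> bool" where
  "wt_tm \<Theta> (TBd i) \<longleftrightarrow> i < length \<Theta> \<and> \<Theta> ! i = TyN"
| "wt_tm \<Theta> (TFr x) \<longleftrightarrow> True"
| "wt_tm \<Theta> Zero \<longleftrightarrow> True"
| "wt_tm \<Theta> (Succ t) \<longleftrightarrow> wt_tm \<Theta> t"

inductive wt :: "aty list \<Rightarrow> 'a fm \<Rightarrow> fty \<Rightarrow> bool" where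
  wt_Eq: "wt_tm \<Theta> s \<Longrightarrow> wt_tm \<Theta> t \<Longrightarrow> wt \<Theta> (Eq s t) Omega"
| wt_Or: "wt \<Theta> \<phi> Omega \<Longrightarrow> wt \<Theta> \<psi> Omega \<Longrightarrow> wt \<Theta> (Or \<phi> \<psi>) Omega"
| wt_And: "wt \<Theta> \<phi> Omega \<Longrightarrow> wt \<Theta> \<psi> Omega \<Longrightarrow> wt \<Theta> (And \<phi> \<psi>) Omega"
| wt_Bd: "i < length \<Theta> \<Longrightarrow> \<Theta> ! i = TyF T \<Longrightarrow> wt \<Theta> (Bd i) T"
| wt_Fr: "wt \<Theta> (Fr x T) T"
| wt_Lam: "wt (A # \<Theta>) \<phi> T \<Longrightarrow> wt \<Theta> (Lam A \<phi>) (Arr A T)"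
| wt_App: "wt \<Theta> \<phi> (Arr (TyF U) T) \<Longrightarrow> wt \<Theta> \<psi> U \<Longrightarrow> wt \<Theta> (App \<phi> \<psi>) T"
| wt_AppT: "wt \<Theta> \<phi> (Arr TyN T) \<Longrightarrow> wt_tm \<Theta> t \<Longrightarrow> wt \<Theta> (AppT \<phi> t) T"
| wt_Fix: "wt (TyF T # \<Theta>) \<phi> T \<Longrightarrow> wt \<Theta> (Fix \<sigma> p T \<phi>) T"

text \<open>All subformulas of a formula, each with the types of the binders above it.\<close>

primrec subforms :: "aty list \<Rightarrow> 'a fm \<Rightarrow> (aty list \<times> 'a fm) set" where
  "subforms \<Theta> (Eq s t) = {(\<Theta>, Eq s t)}"
| "subforms \<Theta> (Or \<phi> \<psi>) = {(\<Theta>, Or \<phi> \<psi>)} \<union> subforms \<Theta> \<phi> \<union> subforms \<Theta> \<psi>"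
| "subforms \<Theta> (And \<phi> \<psi>) = {(\<Theta>, And \<phi> \<psi>)} \<union> subforms \<Theta> \<phi> \<union> subforms \<Theta> \<psi>"
| "subforms \<Theta> (Bd i) = {(\<Theta>, Bd i)}"
| "subforms \<Theta> (Fr x T) = {(\<Theta>, Fr x T)}"
| "subforms \<Theta> (Lam A \<phi>) = {(\<Theta>, Lam A \<phi>)} \<union> subforms (A # \<Theta>) \<phi>"
| "subforms \<Theta> (App \<phi> \<psi>) = {(\<Theta>, App \<phi> \<psi>)} \<union> subforms \<Theta> \<phi> \<union> subforms \<Theta> \<psi>"
| "subforms \<Theta> (AppT \<phi> t) = {(\<Theta>, AppT \<phi> t)} \<union> subforms \<Theta> \<phi>"
| "subforms \<Theta> (Fix \<sigma> p T \<phi>) = {(\<Theta>, Fix \<sigma> p T \<phi>)} \<union> subforms (TyF T # \<Theta>) \<phi>"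

definition fm_types :: "'a fm \<Rightarrow> fty set" where
  "fm_types \<phi> = {T. \<exists>(\<Theta>, \<psi>) \<in> subforms [] \<phi>. wt \<Theta> \<psi> T}"

subsection \<open>The predicate N\<close>

text \<open>In \<open>exN \<theta>\<close>, index 0 of \<open>\<theta>\<close> is the quantified variable and index 1 (the \<open>\<mu>\<close>-bound one) must not occur.\<close>

definition exN :: "form \<Rightarrow> form" where
  "exN \<theta> = AppT (Fix Mu () (Arr TyN Omega)
                (Lam TyN (Or \<theta> (AppT (Bd 1) (Succ (TBd 0)))))) Zero"

definition natP :: form where
  "natP = Fix Mu () (Arr TyN Omega)
            (Lam TyN (Or (Eq (TBd 0) Zero)
                         (exN (And (Eq (TBd 2) (Succ (TBd 0))) (AppT (Bd 3) (TBd 0))))))"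

section \<open>Semantics\<close>

text \<open>
  The interpretation of a type is a set of values. A monotone function is represented as \<open>VF\<close> of a
  code in a type \<open>'v\<close>, with \<open>enc\<close> and \<open>dec\<close> passing between functions and codes.
  The interpretations of all types together do not fit into one HOL type (their
  cardinalities are unbounded among the finite iterates of the power set operation), so
  \<open>dec (enc f) = f\<close> cannot be had for every type at once. \<open>adequate C T\<close> says
  that it holds for all function types within \<open>T\<close>; then \<open>domF C T\<close> is, up to the bijection \<open>enc\<close>, the
  full interpretation of \<open>T\<close>. The lemmas \<open>adequate_rank_0\<close> and \<open>adequate_rank_Suc\<close> below
  provide adequate codings for types of any given rank, hence for all types occurring in any given
  derivation.
\<close>

datatype 'v val = VN (the_nat: nat) | VB (truth: bool) | VF (the_code: 'v)

record 'v coding =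
  enc :: "('v val \<Rightarrow> 'v val) \<Rightarrow> 'v"
  dec :: "'v \<Rightarrow> 'v val \<Rightarrow> 'v val"

definition app :: "'v coding \<Rightarrow> 'v val \<Rightarrow> 'v val \<Rightarrow> 'v val" where
  "app C f x = dec C (the_code f) x"

text \<open>
  The functions in \<open>mono_funs D le E le'\<close> take the arbitrary value \<open>VB False\<close> outside \<open>D\<close>, so that they
  are determined by their values on \<open>D\<close>.
\<close>

definition restr :: "'v val set \<Rightarrow> ('v val \<Rightarrow> 'v val) \<Rightarrow> 'v val \<Rightarrow> 'v val" where
  "restr D f = (\<lambda>x. if x \<in> D then f x else VB False)"

definition mono_funs ::
  "'v val set \<Rightarrow> ('v val \<Rightarrow> 'v val \<Rightarrow> bool) \<Rightarrow> 'v val set \<Rightarrow> ('v val \<Rightarrow> 'v val \<Rightarrow> bool)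
    \<Rightarrow> ('v val \<Rightarrow> 'v val) set" where
  "mono_funs D le E le' =
     {f. restr D f = f \<and> (\<forall>x\<in>D. f x \<in> E) \<and> (\<forall>x\<in>D. \<forall>y\<in>D. le x y \<longrightarrow> le' (f x) (f y))}"

fun domA :: "'v coding \<Rightarrow> aty \<Rightarrow> 'v val set"
and domF :: "'v coding \<Rightarrow> fty \<Rightarrow> 'v val set"
and leA :: "'v coding \<Rightarrow> aty \<Rightarrow> 'v val \<Rightarrow> 'v val \<Rightarrow> bool"
and leF :: "'v coding \<Rightarrow> fty \<Rightarrow> 'v val \<Rightarrow> 'v val \<Rightarrow> bool" where
  "domA C TyN = range VN"
| "domA C (TyF T) = domF C T"
| "domF C Omega = range VB"
| "domF C (Arr A T) = (\<lambda>f. VF (enc C f)) ` mono_funs (domA C A) (leA C A) (domF C T) (leF C T)"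
| "leA C TyN = (=)"
| "leA C (TyF T) = leF C T"
| "leF C Omega = (\<lambda>x y. truth x \<le> truth y)"
| "leF C (Arr A T) = (\<lambda>f g. \<forall>x\<in>domA C A. leF C T (app C f x) (app C g x))"

primrec adequateA :: "'v coding \<Rightarrow> aty \<Rightarrow> bool"
and adequate :: "'v coding \<Rightarrow> fty \<Rightarrow> bool" where
  "adequateA C TyN \<longleftrightarrow> True"
| "adequateA C (TyF T) \<longleftrightarrow> adequate C T"
| "adequate C Omega \<longleftrightarrow> True"
| "adequate C (Arr A T) \<longleftrightarrow> adequateA C A \<and> adequate C T \<and>
     (\<forall>f \<in> mono_funs (domA C A) (leA C A) (domF C T) (leF C T). dec C (enc C f) = f)"

definition fixpoint :: "'v coding \<Rightarrow> fp \<Rightarrow> fty \<Rightarrow> ('v val \<Rightarrow> 'v val) \<Rightarrow> 'v val" where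
  "fixpoint C \<sigma> T f = (THE d. d \<in> domF C T \<and> f d = d \<and>
     (\<forall>e \<in> domF C T. f e = e \<longrightarrow> (case \<sigma> of Mu \<Rightarrow> leF C T d e | Nu \<Rightarrow> leF C T e d)))"

primrec eval_tm :: "(nat \<Rightarrow> aty \<Rightarrow> 'v val) \<Rightarrow> 'v val list \<Rightarrow> tm \<Rightarrow> 'v val" where
  "eval_tm \<rho> ds (TBd i) = ds ! i"
| "eval_tm \<rho> ds (TFr x) = \<rho> x TyN"
| "eval_tm \<rho> ds Zero = VN 0"
| "eval_tm \<rho> ds (Succ t) = VN (Suc (the_nat (eval_tm \<rho> ds t)))"

primrec eval :: "'v coding \<Rightarrow> (nat \<Rightarrow> aty \<Rightarrow> 'v val) \<Rightarrow> 'v val list \<Rightarrow> 'a fm \<Rightarrow> 'v val" where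
  "eval C \<rho> ds (Eq s t) = VB (eval_tm \<rho> ds s = eval_tm \<rho> ds t)"
| "eval C \<rho> ds (Or \<phi> \<psi>) = VB (truth (eval C \<rho> ds \<phi>) \<or> truth (eval C \<rho> ds \<psi>))"
| "eval C \<rho> ds (And \<phi> \<psi>) = VB (truth (eval C \<rho> ds \<phi>) \<and> truth (eval C \<rho> ds \<psi>))"
| "eval C \<rho> ds (Bd i) = ds ! i"
| "eval C \<rho> ds (Fr x T) = \<rho> x (TyF T)"
| "eval C \<rho> ds (Lam A \<phi>) = VF (enc C (restr (domA C A) (\<lambda>d. eval C \<rho> (d # ds) \<phi>)))"
| "eval C \<rho> ds (App \<phi> \<psi>) = app C (eval C \<rho> ds \<phi>) (eval C \<rho> ds \<psi>)"
| "eval C \<rho> ds (AppT \<phi> t) = app C (eval C \<rho> ds \<phi>) (eval_tm \<rho> ds t)"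
| "eval C \<rho> ds (Fix \<sigma> p T \<phi>) = fixpoint C \<sigma> T (\<lambda>d. eval C \<rho> (d # ds) \<phi>)"

subsection \<open>Existence of adequate codings\<close>

primrec rankA :: "aty \<Rightarrow> nat" and rank :: "fty \<Rightarrow> nat" where
  "rankA TyN = 0"
| "rankA (TyF T) = rank T"
| "rank Omega = 0"
| "rank (Arr A T) = Suc (max (rankA A) (rank T))"

lemma adequate_rank_0: "rank T = 0 \<Longrightarrow> adequate C T"
  by (cases T) auto

lemma mono_funsI:
  assumes "\<And>x. x \<notin> D \<Longrightarrow> f x = VB False" "\<And>x. x \<in> D \<Longrightarrow> f x \<in> E"
    and "\<And>x y. x \<in> D \<Longrightarrow> y \<in> D \<Longrightarrow> le x y \<Longrightarrow> le' (f x) (f y)"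
  shows "f \<in> mono_funs D le E le'"
  using assms by (auto simp: mono_funs_def restr_def fun_eq_iff)

lemma mono_funsD:
  assumes "f \<in> mono_funs D le E le'"
  shows "x \<notin> D \<Longrightarrow> f x = VB False" "x \<in> D \<Longrightarrow> f x \<in> E"
    "x \<in> D \<Longrightarrow> y \<in> D \<Longrightarrow> le x y \<Longrightarrow> le' (f x) (f y)"
proof -
  have r: "restr D f = f" using assms by (simp add: mono_funs_def)
  show "x \<notin> D \<Longrightarrow> f x = VB False" using fun_cong[OF r, of x] by (simp add: restr_def)
qed (use assms in \<open>auto simp: mono_funs_def\<close>)

lemma adequate_rank_Suc:
  fixes C :: "'v coding"
  assumes ad: "\<And>T. rank T \<le> n \<Longrightarrow> adequate C T"
  shows "\<exists>C' :: ('v val \<Rightarrow> 'v val) coding. \<forall>T. rank T \<le> Suc n \<longrightarrow> adequate C' T"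
proof -
  define S where "S = (\<Union>A \<in> {A. rankA A \<le> n}. domA C A)"
  define h :: "'v val \<Rightarrow> ('v val \<Rightarrow> 'v val) val" where
    "h = (\<lambda>x. case x of VN k \<Rightarrow> VN k | VB b \<Rightarrow> VB b | VF v \<Rightarrow> VF (dec C v))"
  define g :: "('v val \<Rightarrow> 'v val) val \<Rightarrow> 'v val" where
    "g = (\<lambda>x. case x of VN k \<Rightarrow> VN k | VB b \<Rightarrow> VB b | VF w \<Rightarrow> VF (enc C w))"
  define C' where "C' = \<lparr>enc = (\<lambda>f. restr S (\<lambda>x. g (f (h x)))),
                         dec = (\<lambda>w. restr (h ` S) (\<lambda>y. h (w (g y))))\<rparr>"
  have S: "x \<in> S" if "x \<in> domA C A" "rankA A \<le> n" for x A
    using that by (auto simp: S_def)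
  have SF: "x \<in> S" if "x \<in> domF C T" "rank T \<le> n" for x T
    using S[of x "TyF T"] that by simp
  have gh: "g (h x) = x" if xS: "x \<in> S" for x
  proof -
    obtain A where A: "rankA A \<le> n" "x \<in> domA C A" using xS unfolding S_def by blast
    show ?thesis
    proof (cases A)
      case TyN then show ?thesis using A by (auto simp: g_def h_def)
    next
      case T: (TyF T)
      show ?thesis
      proof (cases T)
        case Omega then show ?thesis using A T by (auto simp: g_def h_def)
      next
        case (Arr B U)
        then show ?thesis using A T ad[of T] by (auto simp: g_def h_def)
      qed
    qed
  qed
  have hB: "h (VB b) = VB b" and gB: "g (VB b) = VB b" for b by (auto simp: h_def g_def)
  define ok where "ok D le D' le' \<longleftrightarrow> D \<subseteq> S \<and> D' = h ` D \<and>
    (\<forall>x\<in>D. \<forall>y\<in>D. le' (h x) (h y) \<longleftrightarrow> le x y)" for D le D' le'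
  have enc': "enc C' f \<in> mono_funs D le E lE" "dec C' (enc C' f) = f"
    if D: "ok D le D' le'" and E: "ok E lE E' lE'" and f: "f \<in> mono_funs D' le' E' lE'"
    for D le D' le' E lE E' lE' f
  proof -
    note fD = mono_funsD[OF f]
    have D': "D' = h ` D" "D \<subseteq> S" and E': "E' = h ` E" "E \<subseteq> S"
      using D E by (auto simp: ok_def)
    have out: "h x \<notin> D'" if "x \<in> S" "x \<notin> D" for x
      using that D' gh by (metis imageE subsetD)
    have v: "\<exists>z\<in>E. f (h x) = h z" if "x \<in> D" for x
      using fD(2)[of "h x"] that D' E' by auto
    show "enc C' f \<in> mono_funs D le E lE"
    proof (rule mono_funsI)
      show "enc C' f x = VB False" if "x \<notin> D" for x
        using that out fD(1) by (auto simp: C'_def restr_def gB)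
      show "enc C' f x \<in> E" if "x \<in> D" for x
        using v[OF that] that D' E' gh by (auto simp: C'_def restr_def)
      show "lE (enc C' f x) (enc C' f y)" if x: "x \<in> D" and y: "y \<in> D" and l: "le x y" for x y
      proof -
        obtain z w where z: "z \<in> E" "f (h x) = h z" and w: "w \<in> E" "f (h y) = h w"
          using v[OF x] v[OF y] by blast
        have "le' (h x) (h y)" using D x y l by (auto simp: ok_def)
        then have "lE' (h z) (h w)" using fD(3)[of "h x" "h y"] x y D' z w by auto
        then have "lE z w" using E z w by (auto simp: ok_def)
        moreover have "enc C' f x = z" "enc C' f y = w"
          using x y z w D' E' gh by (auto simp: C'_def restr_def)
        ultimately show ?thesis by simp
      qed
    qed
    show "dec C' (enc C' f) = f"
    proof
      fix y
      show "dec C' (enc C' f) y = f y"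
      proof (cases "y \<in> h ` S")
        case True
        then obtain x where x: "x \<in> S" "y = h x" by auto
        have e: "dec C' (enc C' f) y = h (g (f y))"
          using x gh by (auto simp: C'_def restr_def)
        show ?thesis
        proof (cases "x \<in> D")
          case True
          then obtain z where "z \<in> E" "f y = h z" using v x by blast
          then show ?thesis using e E' gh by auto
        next
          case False
          then show ?thesis using e x out fD(1) by (simp add: hB gB)
        qed
      next
        case False
        then have "y \<notin> D'" using D' by auto
        then show ?thesis using False fD(1) by (simp add: C'_def restr_def)
      qed
    qed
  qed
  have up: "f \<in> enc C' ` mono_funs D' le' E' lE'"
    if D: "ok D le D' le'" and E: "ok E lE E' lE'" and f: "f \<in> mono_funs D le E lE"
    for D le D' le' E lE E' lE' f
  proof -
    note fD = mono_funsD[OF f]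
    have D': "D' = h ` D" "D \<subseteq> S" and E': "E' = h ` E" "E \<subseteq> S"
      using D E by (auto simp: ok_def)
    define F where "F = restr D' (\<lambda>y. h (f (g y)))"
    have Fh: "F (h x) = h (f x)" if "x \<in> D" for x
      using that D' gh by (auto simp: F_def restr_def)
    have "F \<in> mono_funs D' le' E' lE'"
    proof (rule mono_funsI)
      show "F y = VB False" if "y \<notin> D'" for y using that by (simp add: F_def restr_def)
      show "F y \<in> E'" if "y \<in> D'" for y
        using that D' E' fD(2) Fh by auto
      show "lE' (F y) (F y')" if y: "y \<in> D'" "y' \<in> D'" "le' y y'" for y y'
      proof -
        obtain x x' where x: "x \<in> D" "y = h x" and x': "x' \<in> D" "y' = h x'" using y D' by auto
        have "le x x'" using D x x' y by (auto simp: ok_def)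
        then have "lE (f x) (f x')" using fD(3) x x' by auto
        then show ?thesis using E x x' fD(2) Fh by (auto simp: ok_def)
      qed
    qed
    moreover have "enc C' F = f"
    proof
      fix x
      show "enc C' F x = f x"
      proof (cases "x \<in> D")
        case True
        then have "f x \<in> S" "x \<in> S" using fD(2) D'(2) E'(2) by auto
        then show ?thesis using True Fh gh by (simp add: C'_def restr_def)
      next
        case False
        have "h x \<notin> D'" if "x \<in> S" using that False D' gh by (metis imageE subsetD)
        then show ?thesis using False fD(1) by (auto simp: C'_def restr_def F_def gB)
      qed
    qed
    ultimately show ?thesis by blast
  qed
  have ok: "rankA A \<le> n \<Longrightarrow> ok (domA C A) (leA C A) (domA C' A) (leA C' A)"
    "rank T \<le> n \<Longrightarrow> ok (domF C T) (leF C T) (domF C' T) (leF C' T)" for A T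
  proof (induction A and T)
    case TyN
    have "h ` range VN = range VN" by (simp add: h_def image_image)
    then show ?case using S[of _ TyN] by (auto simp: ok_def h_def)
  next
    case (TyF T)
    then show ?case by simp
  next
    case Omega
    have "h ` range VB = range VB" by (simp add: h_def image_image)
    then show ?case using SF[of _ Omega] by (auto simp: ok_def hB)
  next
    case (Arr A T)
    let ?M = "mono_funs (domA C A) (leA C A) (domF C T) (leF C T)"
    let ?M' = "mono_funs (domA C' A) (leA C' A) (domF C' T) (leF C' T)"
    have r: "rankA A \<le> n" "rank T \<le> n" using Arr.prems by auto
    have okA: "ok (domA C A) (leA C A) (domA C' A) (leA C' A)"
      and okT: "ok (domF C T) (leF C T) (domF C' T) (leF C' T)" using Arr.IH r by auto
    have de: "dec C (enc C f) = f" if "f \<in> ?M" for f using ad[OF Arr.prems] that by auto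
    have M: "enc C' ` ?M' = ?M" using enc'(1)[OF okA okT] up[OF okA okT] by blast
    have hV: "h (VF (enc C f)) = VF f" if "f \<in> ?M" for f using de[OF that] by (simp add: h_def)
    have "domF C (Arr A T) \<subseteq> S" using SF[OF _ Arr.prems] by blast
    moreover have "domF C' (Arr A T) = h ` domF C (Arr A T)"
    proof -
      have "domF C' (Arr A T) = VF ` (enc C' ` ?M')" by (simp add: image_image)
      also have "\<dots> = (\<lambda>f. h (VF (enc C f))) ` ?M" unfolding M using hV by auto
      finally show ?thesis by (simp add: image_image)
    qed
    moreover have "leF C' (Arr A T) (h x) (h y) = leF C (Arr A T) x y"
      if xy: "x \<in> domF C (Arr A T)" "y \<in> domF C (Arr A T)" for x y
    proof -
      obtain f f' where f: "f \<in> ?M" "x = VF (enc C f)" and f': "f' \<in> ?M" "y = VF (enc C f')"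
        using xy by auto
      have a: "app C' (h (VF (enc C k))) (h d) = h (app C (VF (enc C k)) d)"
        "app C (VF (enc C k)) d \<in> domF C T"
        if "k \<in> ?M" "d \<in> domA C A" for k d
        using that hV[of k] de[of k] S[OF _ r(1), of d] gh[of d] mono_funsD(2)[of k]
        by (auto simp: app_def C'_def restr_def)
      have "leF C' T (app C' (h x) (h d)) (app C' (h y) (h d)) = leF C T (app C x d) (app C y d)"
        if "d \<in> domA C A" for d
        using a[OF f(1) that] a[OF f'(1) that] okT f f' by (auto simp: ok_def)
      moreover have "domA C' A = h ` domA C A" using okA by (simp add: ok_def)
      ultimately show ?thesis by auto
    qed
    ultimately show ?case by (simp only: ok_def) blast
  qed
  have "rankA A \<le> Suc n \<Longrightarrow> adequateA C' A" "rank T \<le> Suc n \<Longrightarrow> adequate C' T" for A T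
  proof (induction A and T)
    case (Arr A T)
    then show ?case using enc'(2)[OF ok(1)[of A] ok(2)[of T]] by auto
  qed auto
  then show ?thesis by blast
qed

section \<open>Sequents and rules\<close>

type_synonym sequent = "form list \<times> form list"

definition seq_forms :: "sequent \<Rightarrow> form set" where
  "seq_forms S = set (fst S) \<union> set (snd S)"

definition wf_sequent :: "sequent \<Rightarrow> bool" where
  "wf_sequent S \<longleftrightarrow> (\<forall>\<phi> \<in> seq_forms S. wt [] \<phi> Omega)"

definition fv_sequent :: "sequent \<Rightarrow> (nat \<times> aty) set" where
  "fv_sequent S = (\<Union>\<phi> \<in> seq_forms S. fv \<phi>)"

definition valid :: "'v coding \<Rightarrow> sequent \<Rightarrow> bool" where
  "valid C S \<longleftrightarrow> (\<forall>\<rho>. (\<forall>(x, A) \<in> fv_sequent S. \<rho> x A \<in> domA C A) \<longrightarrow>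
     (\<exists>\<phi> \<in> set (fst S). eval C \<rho> [] \<phi> = VB False) \<or>
     (\<exists>\<psi> \<in> set (snd S). eval C \<rho> [] \<psi> = VB True))"

datatype side = Lft | Rgt

fun on :: "side \<Rightarrow> form list \<Rightarrow> sequent" where
  "on Lft \<Phi> = (\<Phi>, [])"
| "on Rgt \<Phi> = ([], \<Phi>)"

text \<open>
  A rule instance \<open>(\<Gamma>, \<Delta>, c)\<close> has contexts \<open>\<Gamma>\<close>, \<open>\<Delta>\<close> and a core \<open>c\<close> holding the remaining data. For
  the substitution rules \<open>SubstN\<close>, \<open>SubstF\<close> (term and formula case of Subst) and \<open>EqL\<close>, the lists
  \<open>\<Gamma>\<close>, \<open>\<Delta>\<close> are the contexts before substitution. In \<open>ExL \<phi> \<psi> \<Gamma>'\<close> and \<open>ExR \<Delta>' \<phi> \<psi>\<close>, the list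
  \<open>\<Gamma>'\<close> (\<open>\<Delta>'\<close>) holds the formulas to the right (left) of the exchanged pair. \<open>Mono x T \<phi> \<psi> \<chi> ys\<close> concludes
  \<open>\<Gamma>, \<phi>[\<psi>/x] \<turnstile> \<phi>[\<chi>/x], \<Delta>\<close>. In \<open>Beta\<close> and \<open>FixR\<close>, the formula is the body of the binder.
\<close>

datatype core =
    Axiom form
  | Cut form
  | Wk side form
  | Ctr side form
  | ExL form form "form list"
  | ExR "form list" form form
  | SubstN nat tm
  | SubstF nat fty form
  | Mono nat fty form form form "(nat \<times> aty) list"
  | EqL nat nat tm tm
  | EqR tm
  | OrL form form
  | OrR form form
  | AndL form form
  | AndR form form
  | Beta side aty form "unit arg" "unit arg list"
  | FixR side fp fty form "unit arg list"
  | Nat nat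
  | P1 tm
  | P2 tm tm

type_synonym rule = "form list \<times> form list \<times> core"

text \<open>The formulas of the conclusion outside the contexts.\<close>

primrec principals :: "core \<Rightarrow> sequent" where
  "principals (Axiom \<phi>) = ([\<phi>], [\<phi>])"
| "principals (Cut \<phi>) = ([], [])"
| "principals (Wk s \<phi>) = on s [\<phi>]"
| "principals (Ctr s \<phi>) = on s [\<phi>]"
| "principals (ExL \<phi> \<psi> \<Gamma>') = (\<psi> # \<phi> # \<Gamma>', [])"
| "principals (ExR \<Delta>' \<phi> \<psi>) = ([], \<Delta>' @ [\<psi>, \<phi>])"
| "principals (SubstN x t) = ([], [])"
| "principals (SubstF x T \<psi>) = ([], [])"
| "principals (Mono x T \<phi> \<psi> \<chi> ys) = ([subst x T \<psi> \<phi>], [subst x T \<chi> \<phi>])"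
| "principals (EqL x y s t) = ([Eq s t], [])"
| "principals (EqR t) = ([], [Eq t t])"
| "principals (OrL \<phi> \<psi>) = ([Or \<phi> \<psi>], [])"
| "principals (OrR \<phi> \<psi>) = ([], [Or \<phi> \<psi>])"
| "principals (AndL \<phi> \<psi>) = ([And \<phi> \<psi>], [])"
| "principals (AndR \<phi> \<psi>) = ([], [And \<phi> \<psi>])"
| "principals (Beta s A \<phi> e es) = on s [apps (Lam A \<phi>) (e # es)]"
| "principals (FixR s \<sigma> T \<phi> es) = on s [apps (Fix \<sigma> () T \<phi>) es]"
| "principals (Nat x) = ([], [])"
| "principals (P1 s) = ([Eq (Succ s) Zero], [])"
| "principals (P2 s t) = ([Eq (Succ s) (Succ t)], [])"

text \<open>For each premise, its formulas outside the contexts.\<close>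

primrec actives :: "core \<Rightarrow> sequent list" where
  "actives (Axiom \<phi>) = []"
| "actives (Cut \<phi>) = [([], [\<phi>]), ([\<phi>], [])]"
| "actives (Wk s \<phi>) = [([], [])]"
| "actives (Ctr s \<phi>) = [on s [\<phi>, \<phi>]]"
| "actives (ExL \<phi> \<psi> \<Gamma>') = [(\<phi> # \<psi> # \<Gamma>', [])]"
| "actives (ExR \<Delta>' \<phi> \<psi>) = [([], \<Delta>' @ [\<phi>, \<psi>])]"
| "actives (SubstN x t) = [([], [])]"
| "actives (SubstF x T \<psi>) = [([], [])]"
| "actives (Mono x T \<phi> \<psi> \<chi> ys) =
     replicate (nocc x T \<phi>) ([apps \<psi> (map var_arg ys)], [apps \<chi> (map var_arg ys)])"
| "actives (EqL x y s t) = [([], [])]"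
| "actives (EqR t) = []"
| "actives (OrL \<phi> \<psi>) = [([\<phi>], []), ([\<psi>], [])]"
| "actives (OrR \<phi> \<psi>) = [([], [\<phi>, \<psi>])]"
| "actives (AndL \<phi> \<psi>) = [([\<phi>, \<psi>], [])]"
| "actives (AndR \<phi> \<psi>) = [([], [\<phi>]), ([], [\<psi>])]"
| "actives (Beta s A \<phi> e es) = [on s [apps (opn \<phi> e) es]]"
| "actives (FixR s \<sigma> T \<phi> es) = [on s [apps (opn \<phi> (ArgF (Fix \<sigma> () T \<phi>))) es]]"
| "actives (Nat x) = [([AppT natP (TFr x)], [])]"
| "actives (P1 s) = []"
| "actives (P2 s t) = [([Eq s t], [])]"

text \<open>What happens to a context formula in the conclusion and in the premises.\<close>

fun ctx_concl :: "core \<Rightarrow> form \<Rightarrow> form" where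
  "ctx_concl (SubstN x t) \<phi> = substT (TFr(x := t)) \<phi>"
| "ctx_concl (SubstF x T \<psi>) \<phi> = subst x T \<psi> \<phi>"
| "ctx_concl (EqL x y s t) \<phi> = substT (TFr(x := s, y := t)) \<phi>"
| "ctx_concl c \<phi> = \<phi>"

fun ctx_prem :: "core \<Rightarrow> form \<Rightarrow> form" where
  "ctx_prem (EqL x y s t) \<phi> = substT (TFr(x := t, y := s)) \<phi>"
| "ctx_prem c \<phi> = \<phi>"

fun concl :: "rule \<Rightarrow> sequent" where
  "concl (\<Gamma>, \<Delta>, c) =
     (map (ctx_concl c) \<Gamma> @ fst (principals c), snd (principals c) @ map (ctx_concl c) \<Delta>)"

fun prems :: "rule \<Rightarrow> sequent list" where
  "prems (\<Gamma>, \<Delta>, c) =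
     map (\<lambda>(\<Phi>, \<Psi>). (map (ctx_prem c) \<Gamma> @ \<Phi>, \<Psi> @ map (ctx_prem c) \<Delta>)) (actives c)"

fun side_condition :: "rule \<Rightarrow> bool" where
  "side_condition (\<Gamma>, \<Delta>, Axiom \<phi>) \<longleftrightarrow> \<Gamma> = [] \<and> \<Delta> = []"
| "side_condition (\<Gamma>, \<Delta>, P1 s) \<longleftrightarrow> \<Gamma> = [] \<and> \<Delta> = []"
| "side_condition (\<Gamma>, \<Delta>, SubstN x t) \<longleftrightarrow> wt_tm [] t"
| "side_condition (\<Gamma>, \<Delta>, SubstF x T \<psi>) \<longleftrightarrow> wt [] \<psi> T"
| "side_condition (\<Gamma>, \<Delta>, Mono x T \<phi> \<psi> \<chi> ys) \<longleftrightarrow>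
     wt [] \<phi> Omega \<and> wt [] \<psi> T \<and> wt [] \<chi> T \<and> distinct ys \<and>
     set ys \<inter> fv_sequent (concl (\<Gamma>, \<Delta>, Mono x T \<phi> \<psi> \<chi> ys)) = {}"
| "side_condition (\<Gamma>, \<Delta>, EqL x y s t) \<longleftrightarrow> x \<noteq> y"
| "side_condition (\<Gamma>, \<Delta>, c) \<longleftrightarrow> True"

fun logical :: "core \<Rightarrow> bool" where
  "logical (EqL x y s t) = True"
| "logical (EqR t) = True"
| "logical (OrL \<phi> \<psi>) = True"
| "logical (OrR \<phi> \<psi>) = True"
| "logical (AndL \<phi> \<psi>) = True"
| "logical (AndR \<phi> \<psi>) = True"
| "logical (Beta s A \<phi> e es) = True"
| "logical (FixR s \<sigma> T \<phi> es) = True"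
| "logical c = False"

section \<open>Occurrences\<close>

text \<open>An occurrence in a sequent is a side and a position in the list on that side.\<close>

type_synonym occ = "side \<times> nat"

fun on_side :: "side \<Rightarrow> sequent \<Rightarrow> form list" where
  "on_side Lft S = fst S"
| "on_side Rgt S = snd S"

fun is_occ :: "sequent \<Rightarrow> occ \<Rightarrow> bool" where
  "is_occ S (s, i) \<longleftrightarrow> i < length (on_side s S)"

fun form_at :: "sequent \<Rightarrow> occ \<Rightarrow> form" where
  "form_at S (s, i) = on_side s S ! i"

fun principal :: "rule \<Rightarrow> occ \<Rightarrow> bool" where
  "principal (\<Gamma>, \<Delta>, c) (Lft, i) \<longleftrightarrow> length \<Gamma> \<le> i \<and> i < length \<Gamma> + length (fst (principals c))"
| "principal (\<Gamma>, \<Delta>, c) (Rgt, i) \<longleftrightarrow> i < length (snd (principals c))"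

definition swap_at :: "nat \<Rightarrow> nat \<Rightarrow> nat" where
  "swap_at n i = (if i = n then Suc n else if i = Suc n then n else i)"

text \<open>
  Every active formula is relevant to every principal formula on the same side; there
  is at most one of the latter except in the exchange rules, and none where the active formula is
  relevant to nothing (Cut, Nat). Positions are relative to the lists \<open>principals\<close> and \<open>actives\<close>.
\<close>

fun core_relevant :: "core \<Rightarrow> nat \<Rightarrow> nat \<Rightarrow> bool" where
  "core_relevant (ExL \<phi> \<psi> \<Gamma>') a a' \<longleftrightarrow> a' = swap_at 0 a"
| "core_relevant (ExR \<Delta>' \<phi> \<psi>) a a' \<longleftrightarrow> a' = swap_at (length \<Delta>') a"
| "core_relevant c a a' \<longleftrightarrow> True"

text \<open>
  \<open>relevant r j q q'\<close>: occurrence \<open>q'\<close> in the \<open>j\<close>-th premise (counted from 0) of \<open>r\<close> is relevant to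
  occurrence \<open>q\<close> in the conclusion.
\<close>

fun relevant :: "rule \<Rightarrow> nat \<Rightarrow> occ \<Rightarrow> occ \<Rightarrow> bool" where
  "relevant (\<Gamma>, \<Delta>, c) j (Lft, i) (Lft, i') \<longleftrightarrow>
     (if i < length \<Gamma> then i' = i
      else i < length \<Gamma> + length (fst (principals c)) \<and>
           length \<Gamma> \<le> i' \<and> i' < length \<Gamma> + length (fst (actives c ! j)) \<and>
           core_relevant c (i - length \<Gamma>) (i' - length \<Gamma>))"
| "relevant (\<Gamma>, \<Delta>, c) j (Rgt, i) (Rgt, i') \<longleftrightarrow>
     (if i < length (snd (principals c))
      then i' < length (snd (actives c ! j)) \<and> core_relevant c i i'
      else i - length (snd (principals c)) < length \<Delta> \<and>
           i' = i - length (snd (principals c)) + length (snd (actives c ! j)))"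
| "relevant r j (Lft, i) (Rgt, i') \<longleftrightarrow> False"
| "relevant r j (Rgt, i) (Lft, i') \<longleftrightarrow> False"


section \<open>Annotations\<close>

type_synonym aform = "nat list fm"

text \<open>
  Inheritance of annotations by side formulas, where \<open>\<gamma>\<close> is the formula before the substitution of
  the rule (if any), \<open>\<alpha>\<close> is the annotated formula in the conclusion and \<open>\<alpha>'\<close> that in the premise.
\<close>

fun ctx_inherit :: "core \<Rightarrow> form \<Rightarrow> aform \<Rightarrow> aform \<Rightarrow> bool" where
  "ctx_inherit (SubstN x t) \<gamma> \<alpha> \<alpha>' \<longleftrightarrow> erase \<alpha>' = \<gamma> \<and> \<alpha> = substT (TFr(x := t)) \<alpha>'"
| "ctx_inherit (SubstF x T \<psi>) \<gamma> \<alpha> \<alpha>' \<longleftrightarrow>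
     erase \<alpha>' = \<gamma> \<and> (\<exists>\<xi>. (\<forall>n. erase (\<xi> n) = \<psi>) \<and> \<alpha> = msubst x T \<xi> \<alpha>')"
| "ctx_inherit (EqL x y s t) \<gamma> \<alpha> \<alpha>' \<longleftrightarrow>
     (\<exists>\<beta>. erase \<beta> = \<gamma> \<and> \<alpha> = substT (TFr(x := s, y := t)) \<beta> \<and> \<alpha>' = substT (TFr(x := t, y := s)) \<beta>)"
| "ctx_inherit c \<gamma> \<alpha> \<alpha>' \<longleftrightarrow> \<alpha>' = \<alpha>"

text \<open>
  Inheritance by active formulas: \<open>s\<close> is the side, \<open>j\<close> the premise, \<open>a'\<close> the position
  among the active formulas of that premise, and \<open>k\<close> the number to be appended when a fixed point is
  unfolded. The last equation covers rules without a principal or without an active formula.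
\<close>

fun core_inherit :: "core \<Rightarrow> side \<Rightarrow> nat \<Rightarrow> nat \<Rightarrow> nat \<Rightarrow> aform \<Rightarrow> aform \<Rightarrow> bool" where
  "core_inherit (Ctr s' \<phi>) s j a' k \<alpha> \<alpha>' \<longleftrightarrow> \<alpha>' = \<alpha>"
| "core_inherit (ExL \<phi> \<psi> \<Gamma>') s j a' k \<alpha> \<alpha>' \<longleftrightarrow> \<alpha>' = \<alpha>"
| "core_inherit (ExR \<Delta>' \<phi> \<psi>) s j a' k \<alpha> \<alpha>' \<longleftrightarrow> \<alpha>' = \<alpha>"
| "core_inherit (Mono x T \<phi> \<psi> \<chi> ys) s j a' k \<alpha> \<alpha>' \<longleftrightarrow>
     (\<exists>\<beta> \<xi>. erase \<beta> = \<phi> \<and> (\<forall>n. erase (\<xi> n) = (case s of Lft \<Rightarrow> \<psi> | Rgt \<Rightarrow> \<chi>)) \<and>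
        \<alpha> = msubst x T \<xi> \<beta> \<and> \<alpha>' = apps (\<xi> j) (map var_arg ys))"
| "core_inherit (OrL \<phi> \<psi>) s j a' k \<alpha> \<alpha>' \<longleftrightarrow>
     (\<exists>\<beta> \<gamma>. \<alpha> = Or \<beta> \<gamma> \<and> \<alpha>' = (if j = 0 then \<beta> else \<gamma>))"
| "core_inherit (OrR \<phi> \<psi>) s j a' k \<alpha> \<alpha>' \<longleftrightarrow>
     (\<exists>\<beta> \<gamma>. \<alpha> = Or \<beta> \<gamma> \<and> \<alpha>' = (if a' = 0 then \<beta> else \<gamma>))"
| "core_inherit (AndL \<phi> \<psi>) s j a' k \<alpha> \<alpha>' \<longleftrightarrow>
     (\<exists>\<beta> \<gamma>. \<alpha> = And \<beta> \<gamma> \<and> \<alpha>' = (if a' = 0 then \<beta> else \<gamma>))"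
| "core_inherit (AndR \<phi> \<psi>) s j a' k \<alpha> \<alpha>' \<longleftrightarrow>
     (\<exists>\<beta> \<gamma>. \<alpha> = And \<beta> \<gamma> \<and> \<alpha>' = (if j = 0 then \<beta> else \<gamma>))"
| "core_inherit (Beta s' A \<phi> e es) s j a' k \<alpha> \<alpha>' \<longleftrightarrow>
     (\<exists>\<beta> d ds. \<alpha> = apps (Lam A \<beta>) (d # ds) \<and> \<alpha>' = apps (opn \<beta> d) ds)"
| "core_inherit (FixR s' \<sigma> T \<phi> es) s j a' k \<alpha> \<alpha>' \<longleftrightarrow>
     (\<exists>p \<beta> ds. \<alpha> = apps (Fix \<sigma> p T \<beta>) ds \<and>
        \<alpha>' = apps (opn \<beta> (ArgF (Fix \<sigma> (p @ [k]) T \<beta>))) ds)"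
| "core_inherit (P2 t u) s j a' k \<alpha> \<alpha>' \<longleftrightarrow> \<alpha>' = Eq t u"
| "core_inherit c s j a' k \<alpha> \<alpha>' \<longleftrightarrow> False"

fun inherit :: "rule \<Rightarrow> nat \<Rightarrow> occ \<Rightarrow> occ \<Rightarrow> nat \<Rightarrow> aform \<Rightarrow> aform \<Rightarrow> bool" where
  "inherit (\<Gamma>, \<Delta>, c) j (Lft, i) (s', i') k \<alpha> \<alpha>' \<longleftrightarrow>
     (if i < length \<Gamma> then ctx_inherit c (\<Gamma> ! i) \<alpha> \<alpha>'
      else core_inherit c Lft j (i' - length \<Gamma>) k \<alpha> \<alpha>')"
| "inherit (\<Gamma>, \<Delta>, c) j (Rgt, i) (s', i') k \<alpha> \<alpha>' \<longleftrightarrow>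
     (if i < length (snd (principals c)) then core_inherit c Rgt j i' k \<alpha> \<alpha>'
      else ctx_inherit c (\<Delta> ! (i - length (snd (principals c)))) \<alpha> \<alpha>')"

section \<open>Cyclic proofs\<close>

text \<open>
  A node of a derivation tree is addressed by the list of premise numbers leading to it from the
  root. A leaf is \<open>Open\<close> or an instance of a rule without premises.
\<close>

datatype tree = Open sequent | Infer rule "tree list"

fun root :: "tree \<Rightarrow> sequent" where
  "root (Open S) = S"
| "root (Infer r ts) = concl r"

fun wf_tree :: "tree \<Rightarrow> bool" where
  "wf_tree (Open S) \<longleftrightarrow> wf_sequent S"
| "wf_tree (Infer r ts) \<longleftrightarrow> wf_sequent (concl r) \<and> side_condition r \<and> map root ts = prems r \<and>
     (\<forall>t \<in> set ts. wf_tree t)"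

fun subtree :: "tree \<Rightarrow> nat list \<Rightarrow> tree option" where
  "subtree t [] = Some t"
| "subtree (Open S) (j # p) = None"
| "subtree (Infer r ts) (j # p) = (if j < length ts then subtree (ts ! j) p else None)"

definition node_seq :: "tree \<Rightarrow> nat list \<Rightarrow> sequent" where
  "node_seq D p = root (the (subtree D p))"

definition pre_proof :: "tree \<Rightarrow> (nat list \<Rightarrow> nat list) \<Rightarrow> bool" where
  "pre_proof D R \<longleftrightarrow> wf_tree D \<and>
     (\<forall>p S. subtree D p = Some (Open S) \<longrightarrow>
        (\<exists>r ts. subtree D (R p) = Some (Infer r ts) \<and> ts \<noteq> [] \<and> concl r = S))"

definition inf_path :: "tree \<Rightarrow> (nat list \<Rightarrow> nat list) \<Rightarrow> (nat \<Rightarrow> nat list) \<Rightarrow> bool" where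
  "inf_path D R \<pi> \<longleftrightarrow> (\<forall>i. case subtree D (\<pi> i) of
       None \<Rightarrow> False
     | Some (Open S) \<Rightarrow> \<pi> (Suc i) = R (\<pi> i)
     | Some (Infer r ts) \<Rightarrow> (\<exists>j < length ts. \<pi> (Suc i) = \<pi> i @ [j]))"

text \<open>Below, the premise taken at step \<open>i\<close> of a path is the last entry of the address \<open>\<pi> (Suc i)\<close>.\<close>

definition trace :: "tree \<Rightarrow> (nat \<Rightarrow> nat list) \<Rightarrow> (nat \<Rightarrow> occ) \<Rightarrow> bool" where
  "trace D \<pi> \<tau> \<longleftrightarrow>
     (\<forall>i. is_occ (node_seq D (\<pi> i)) (\<tau> i)) \<and>
     (\<forall>i. case the (subtree D (\<pi> i)) of
         Open S \<Rightarrow> \<tau> (Suc i) = \<tau> i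
       | Infer r ts \<Rightarrow> relevant r (last (\<pi> (Suc i))) (\<tau> i) (\<tau> (Suc i))) \<and>
     infinite {i. \<exists>\<Gamma> \<Delta> c ts. subtree D (\<pi> i) = Some (Infer (\<Gamma>, \<Delta>, c) ts) \<and>
                     logical c \<and> principal (\<Gamma>, \<Delta>, c) (\<tau> i)}"

definition unfolds :: "tree \<Rightarrow> (nat \<Rightarrow> nat list) \<Rightarrow> (nat \<Rightarrow> occ) \<Rightarrow> nat \<Rightarrow> bool" where
  "unfolds D \<pi> \<tau> i \<longleftrightarrow> (\<exists>\<Gamma> \<Delta> s \<sigma> T \<phi> es ts.
     subtree D (\<pi> i) = Some (Infer (\<Gamma>, \<Delta>, FixR s \<sigma> T \<phi> es) ts) \<and>
     principal (\<Gamma>, \<Delta>, FixR s \<sigma> T \<phi> es) (\<tau> i))"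

text \<open>
  \<open>\<alpha> i\<close> is the occurrence \<open>\<tau> i\<close> with its annotations, and \<open>\<kappa> i\<close> the fresh number used at step \<open>i\<close>
  if that step unfolds a fixed point on the trace.
\<close>

definition annotation ::
  "tree \<Rightarrow> (nat \<Rightarrow> nat list) \<Rightarrow> (nat \<Rightarrow> occ) \<Rightarrow> (nat \<Rightarrow> nat) \<Rightarrow> (nat \<Rightarrow> aform) \<Rightarrow> bool" where
  "annotation D \<pi> \<tau> \<kappa> \<alpha> \<longleftrightarrow>
     inj_on \<kappa> {i. unfolds D \<pi> \<tau> i} \<and>
     \<alpha> 0 = map_fm (\<lambda>_. []) (form_at (node_seq D (\<pi> 0)) (\<tau> 0)) \<and>
     (\<forall>i. erase (\<alpha> i) = form_at (node_seq D (\<pi> i)) (\<tau> i)) \<and>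
     (\<forall>i. case the (subtree D (\<pi> i)) of
         Open S \<Rightarrow> \<alpha> (Suc i) = \<alpha> i
       | Infer r ts \<Rightarrow>
           inherit r (last (\<pi> (Suc i))) (\<tau> i) (\<tau> (Suc i)) (\<kappa> i) (\<alpha> i) (\<alpha> (Suc i)))"

definition fp_trace :: "fp \<Rightarrow> tree \<Rightarrow> (nat \<Rightarrow> nat list) \<Rightarrow> (nat \<Rightarrow> occ) \<Rightarrow> bool" where
  "fp_trace \<sigma> D \<pi> \<tau> \<longleftrightarrow> trace D \<pi> \<tau> \<and>
     (\<exists>\<kappa> \<alpha>. annotation D \<pi> \<tau> \<kappa> \<alpha> \<and>
        (\<exists>p :: nat \<Rightarrow> nat. \<forall>n. \<exists>i. map p [0..<n] \<in> anns \<sigma> (\<alpha> i)))"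

definition cyclic_proof :: "tree \<Rightarrow> (nat list \<Rightarrow> nat list) \<Rightarrow> bool" where
  "cyclic_proof D R \<longleftrightarrow> pre_proof D R \<and>
     (\<forall>\<pi>. inf_path D R \<pi> \<longrightarrow>
        (\<exists>m \<tau>. fp_trace Mu D (\<lambda>i. \<pi> (m + i)) \<tau> \<and> fst (\<tau> 0) = Lft \<or>
               fp_trace Nu D (\<lambda>i. \<pi> (m + i)) \<tau> \<and> fst (\<tau> 0) = Rgt))"

definition proof_types :: "tree \<Rightarrow> fty set" where
  "proof_types D = {T. \<exists>p t. subtree D p = Some t \<and> (\<exists>\<phi> \<in> seq_forms (root t). T \<in> fm_types \<phi>)}"

end

(*
  Suppose the root is falsified by a valuation. Approximate the least fixed points in formulas on the
  left and the greatest fixed points in formulas on the right by stages of their transfinite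
  iteration, so that formulas on the left stay true and formulas on the right stay false. Then some
  premise of each rule is falsified again, every unfolding of an approximated fixed point strictly
  lowers its stage, and the other rules only copy stages. In (Mono), if all copies of psi lay below
  the corresponding copies of chi, then the left formula would lie below the right one; so some copy
  fails, and it selects the premise. Following falsified sequents yields an infinite path. Along a
  left mu-trace or right nu-trace on this path the operators annotated by the prefixes of p have
  strictly decreasing stages, a contradiction.
*)
theory Submission
  imports Defs
begin

text \<open>The path is built before the trace on it is known, so no trace can guide the choice of
  stages. Each step assigns stages to all occurrences of the premise at once, and the lowering of
  stages is stated for every trace annotation of the same formula. The two annotations meet in
  \<open>zanns\<close>, the set of pairs of a trace label and a stage sitting on the same operator.
  A step brings in no new pair, or one whose stage lies below that of a pair with the label it
  extends. Fresh numbers make a nonempty label determine its stage, so no single operator has to be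
  followed. On each side, operators of the other kind stay exact. Hence left values are at most, and
  right values at least, the exact ones: (Axiom) cannot be falsified, and a substitution of
  formulas, whose copies carry different stages, can fall back on the exact value. Stages need a
  well-order that outruns every chain of values; sets of values suffice, by Cantor. A coding is
  adequate for some types only, so typing has to record adequacy, with care for substituted formulas
  that leave no copy in the conclusion.\<close>

section \<open>Syntax\<close>

lemma nocc_map_fm [simp]: "nocc x T (map_fm f \<phi>) = nocc x T \<phi>"
  by (induction \<phi>) auto

lemma fv_map_fm [simp]: "fv (map_fm f \<phi>) = fv \<phi>"
  by (induction \<phi>) auto

lemma anns_map_fm [simp]: "anns \<sigma> (map_fm f \<phi>) = f ` anns \<sigma> \<phi>"
  by (induction \<phi>) (auto simp: image_Un)

lemma map_fm_substT [simp]: "map_fm f (substT \<theta> \<phi>) = substT \<theta> (map_fm f \<phi>)"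
  by (induction \<phi>) auto

lemma map_fm_openT [simp]: "map_fm f (openT n t \<phi>) = openT n t (map_fm f \<phi>)"
  by (induction \<phi> arbitrary: n) auto

lemma map_fm_openF [simp]: "map_fm f (openF n \<chi> \<phi>) = openF n (map_fm f \<chi>) (map_fm f \<phi>)"
  by (induction \<phi> arbitrary: n) auto

lemma map_fm_opn [simp]: "map_fm f (opn \<phi> e) = opn (map_fm f \<phi>) (map_arg f e)"
  by (cases e) auto

lemma map_fm_msubst [simp]:
  "map_fm f (msubst x T \<xi> \<phi>) = msubst x T (\<lambda>j. map_fm f (\<xi> j)) (map_fm f \<phi>)"
  by (induction \<phi> arbitrary: \<xi>) auto

lemma map_fm_app1 [simp]: "map_fm f (app1 \<phi> e) = app1 (map_fm f \<phi>) (map_arg f e)"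
  by (cases e) auto

lemma apps_simps [simp]: "apps \<phi> [] = \<phi>" "apps \<phi> (e # es) = apps (app1 \<phi> e) es"
  "apps \<phi> (es @ [e]) = app1 (apps \<phi> es) e"
  by (auto simp: apps_def)

lemma map_fm_apps [simp]: "map_fm f (apps \<phi> es) = apps (map_fm f \<phi>) (map (map_arg f) es)"
  by (induction es arbitrary: \<phi>) auto

lemma map_var_arg [simp]: "map_arg f (var_arg v) = var_arg v"
  by (cases v rule: var_arg.cases) auto

lemma map_map_var_arg [simp]: "map (map_arg f \<circ> var_arg) ys = map var_arg ys"
  by auto

lemma anns_substT [simp]: "anns \<sigma> (substT \<theta> \<phi>) = anns \<sigma> \<phi>"
  by (induction \<phi>) auto

lemma anns_openT [simp]: "anns \<sigma> (openT n t \<phi>) = anns \<sigma> \<phi>"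
  by (induction \<phi> arbitrary: n) auto

text \<open>Only an inclusion, because \<open>\<chi>\<close> vanishes if index \<open>n\<close> does
  not occur.\<close>

lemma anns_openF: "anns \<sigma> (openF n \<chi> \<phi>) \<subseteq> anns \<sigma> \<phi> \<union> anns \<sigma> \<chi>"
  by (induction \<phi> arbitrary: n) auto

fun anns_arg :: "fp \<Rightarrow> 'a arg \<Rightarrow> 'a set" where
  "anns_arg \<sigma> (ArgF \<phi>) = anns \<sigma> \<phi>"
| "anns_arg \<sigma> (ArgT t) = {}"

lemma anns_opn: "anns \<sigma> (opn \<phi> e) \<subseteq> anns \<sigma> \<phi> \<union> anns_arg \<sigma> e"
  by (cases e) (auto dest: subsetD[OF anns_openF])

lemma anns_app1 [simp]: "anns \<sigma> (app1 \<phi> e) = anns \<sigma> \<phi> \<union> anns_arg \<sigma> e"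
  by (cases e) auto

lemma anns_apps [simp]: "anns \<sigma> (apps \<phi> es) = anns \<sigma> \<phi> \<union> (\<Union>e\<in>set es. anns_arg \<sigma> e)"
  by (induction es arbitrary: \<phi>) auto

lemma anns_var_arg [simp]: "anns_arg \<sigma> (var_arg v) = {}"
  by (cases v rule: var_arg.cases) auto

lemma UN_lessThan_add:
  "(\<Union>j<m + n :: nat. f j) = (\<Union>j<m. f j) \<union> (\<Union>j<n. f (m + j))"
proof -
  have "{..<m + n} = {..<m} \<union> (+) m ` {..<n}"
  proof (intro equalityI subsetI)
    fix j assume "j \<in> {..<m + n}"
    then show "j \<in> {..<m} \<union> (+) m ` {..<n}"
      by (cases "j < m") (auto intro!: image_eqI[of _ _ "j - m"])
  qed auto
  then show ?thesis by (simp add: image_Un)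
qed

lemma anns_msubst:
  "anns \<sigma> (msubst x T \<xi> \<phi>) = anns \<sigma> \<phi> \<union> (\<Union>j<nocc x T \<phi>. anns \<sigma> (\<xi> j))"
  by (induction \<phi> arbitrary: \<xi>) (simp_all add: UN_lessThan_add Un_ac lessThan_Suc)

text \<open>In (Mono) the variables \<open>ys\<close> are fresh for the conclusion; an occurrence of
  \<open>x\<close> carries this over to the substituted formula.\<close>

lemma fv_msubst: "0 < nocc x T \<phi> \<Longrightarrow> fv \<psi> \<subseteq> fv (msubst x T (\<lambda>_. \<psi>) \<phi>)"
  by (induction \<phi>) (auto split: if_splits)

lemma msubst_cong:
  "(\<And>j. j < nocc x T \<phi> \<Longrightarrow> \<xi> j = \<xi>' j) \<Longrightarrow> msubst x T \<xi> \<phi> = msubst x T \<xi>' \<phi>"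
proof (induction \<phi> arbitrary: \<xi> \<xi>')
  case (Or \<phi> \<psi>)
  show ?case using Or.IH(1)[of \<xi> \<xi>'] Or.IH(2)[of "\<lambda>j. \<xi> (nocc x T \<phi> + j)" "\<lambda>j. \<xi>' (nocc x T \<phi> + j)"]
    Or.prems by auto
next
  case (And \<phi> \<psi>)
  show ?case using And.IH(1)[of \<xi> \<xi>'] And.IH(2)[of "\<lambda>j. \<xi> (nocc x T \<phi> + j)" "\<lambda>j. \<xi>' (nocc x T \<phi> + j)"]
    And.prems by auto
next
  case (App \<phi> \<psi>)
  show ?case using App.IH(1)[of \<xi> \<xi>'] App.IH(2)[of "\<lambda>j. \<xi> (nocc x T \<phi> + j)" "\<lambda>j. \<xi>' (nocc x T \<phi> + j)"]
    App.prems by auto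
next
  case (Lam A \<phi>)
  show ?case using Lam.IH[of \<xi> \<xi>'] Lam.prems by simp
next
  case (AppT \<phi> t)
  show ?case using AppT.IH[of \<xi> \<xi>'] AppT.prems by simp
next
  case (Fix \<sigma> p U \<phi>)
  show ?case using Fix.IH[of \<xi> \<xi>'] Fix.prems by simp
qed (auto split: if_splits)

text \<open>The identity substitution lets \<open>aeval_msubst_le\<close> speak about formulas
  without any substitution.\<close>

lemma msubst_Fr [simp]: "msubst x T (\<lambda>_. Fr x T) \<phi> = \<phi>"
  by (induction \<phi>) auto

section \<open>Recovering an annotated instance of a substitution from its erasure\<close>

subsection \<open>Lifting decompositions along a change of annotations\<close>

text \<open>Terms carry no annotations, so all annotations of \<open>b\<close> lie on operators of
  \<open>\<gamma>\<close> and can be pulled back through the substitution.\<close>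

lemma map_fm_eq_substT:
  "map_fm f b = substT \<theta> \<gamma> \<Longrightarrow> \<exists>b'. b = substT \<theta> b' \<and> map_fm f b' = \<gamma>"
proof (induction \<gamma> arbitrary: b)
  case (Eq s t)
  show ?case using Eq by (intro exI[of _ "Eq s t"]) (cases b; simp)
next
  case (Or \<phi> \<psi>)
  from Or.prems obtain b1 b2 where b: "b = Or b1 b2" "map_fm f b1 = substT \<theta> \<phi>" "map_fm f b2 = substT \<theta> \<psi>"
    by (cases b) auto
  then show ?case using Or.IH by (metis fm.map(2) substT.simps(2))
next
  case (And \<phi> \<psi>)
  from And.prems obtain b1 b2 where b: "b = And b1 b2" "map_fm f b1 = substT \<theta> \<phi>" "map_fm f b2 = substT \<theta> \<psi>"
    by (cases b) auto
  then show ?case using And.IH by (metis fm.map(3) substT.simps(3))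
next
  case (Bd i)
  then show ?case by (intro exI[of _ "Bd i"]) (cases b; simp)
next
  case (Fr x T)
  then show ?case by (intro exI[of _ "Fr x T"]) (cases b; simp)
next
  case (Lam A \<phi>)
  from Lam.prems obtain b1 where b: "b = Lam A b1" "map_fm f b1 = substT \<theta> \<phi>"
    by (cases b) auto
  then show ?case using Lam.IH by (metis fm.map(6) substT.simps(6))
next
  case (App \<phi> \<psi>)
  from App.prems obtain b1 b2 where b: "b = App b1 b2" "map_fm f b1 = substT \<theta> \<phi>" "map_fm f b2 = substT \<theta> \<psi>"
    by (cases b) auto
  then show ?case using App.IH by (metis fm.map(7) substT.simps(7))
next
  case (AppT \<phi> t)
  from AppT.prems obtain b1 where b: "b = AppT b1 (subst_tm \<theta> t)" "map_fm f b1 = substT \<theta> \<phi>"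
    by (cases b) auto
  then show ?case using AppT.IH by (metis fm.map(8) substT.simps(8))
next
  case (Fix \<sigma> p T \<phi>)
  from Fix.prems obtain q b1 where b: "b = Fix \<sigma> q T b1" "f q = p" "map_fm f b1 = substT \<theta> \<phi>"
    by (cases b) auto
  then show ?case using Fix.IH by (metis fm.map(9) substT.simps(9))
qed

text \<open>The halves of a binary connective yield separate families of copies; the second is
  shifted past the occurrences in the first.\<close>

lemma msubst_combine:
  "\<exists>\<zeta>. msubst x T \<zeta> \<phi> = msubst x T \<xi>1 \<phi> \<and> (\<forall>j<nocc x T \<phi>. \<zeta> j = \<xi>1 j) \<and> (\<forall>j. \<zeta> (nocc x T \<phi> + j) = \<xi>2 j)"
  by (rule exI[of _ "\<lambda>j. if j < nocc x T \<phi> then \<xi>1 j else \<xi>2 (j - nocc x T \<phi>)"])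
    (auto intro: msubst_cong)

lemma all_less_add:
  "(\<forall>j<m + n. P j) \<longleftrightarrow> (\<forall>j<m. P j) \<and> (\<forall>j<n. P (m + j :: nat))"
  by (metis add_less_cancel_left le_add_diff_inverse not_less trans_less_add1)

text \<open>Copies of the substituted formula may be annotated differently in \<open>b\<close>,
  hence a family \<open>\<zeta>\<close>, unconstrained beyond the last occurrence.\<close>

lemma map_fm_eq_msubst:
  fixes b :: "'b fm"
  shows "map_fm f b = msubst x T \<xi> \<gamma> \<Longrightarrow>
   \<exists>\<beta> \<zeta>. b = msubst x T \<zeta> \<beta> \<and> map_fm f \<beta> = \<gamma> \<and> (\<forall>j<nocc x T \<gamma>. map_fm f (\<zeta> j) = \<xi> j)"
proof (induction \<gamma> arbitrary: b \<xi>)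
  case (Eq s t)
  show ?case using Eq by (intro exI[of _ "Eq s t"]) (cases b; simp)
next
  case (Or \<phi> \<psi>)
  from Or.prems obtain b1 b2 where b: "b = Or b1 b2" "map_fm f b1 = msubst x T \<xi> \<phi>"
    "map_fm f b2 = msubst x T (\<lambda>j. \<xi> (nocc x T \<phi> + j)) \<psi>"
    by (cases b) auto
  obtain \<beta>1 \<xi>1 where 1: "b1 = msubst x T \<xi>1 \<beta>1" "map_fm f \<beta>1 = \<phi>" "\<forall>j<nocc x T \<phi>. map_fm f (\<xi>1 j) = \<xi> j"
    using Or.IH(1)[OF b(2)] by blast
  obtain \<beta>2 \<xi>2 where 2: "b2 = msubst x T \<xi>2 \<beta>2" "map_fm f \<beta>2 = \<psi>" "\<forall>j<nocc x T \<psi>. map_fm f (\<xi>2 j) = \<xi> (nocc x T \<phi> + j)"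
    using Or.IH(2)[OF b(3)] by blast
  have n: "nocc x T \<beta>1 = nocc x T \<phi>" using 1(2) nocc_map_fm by metis
  show ?case
  proof -
    obtain \<zeta> where \<zeta>: "msubst x T \<zeta> \<beta>1 = msubst x T \<xi>1 \<beta>1" "\<forall>j<nocc x T \<phi>. \<zeta> j = \<xi>1 j"
      "\<And>j. \<zeta> (nocc x T \<phi> + j) = \<xi>2 j"
      using msubst_combine[of x T \<beta>1 \<xi>1 \<xi>2] n by auto
    have "b = msubst x T \<zeta> (Or \<beta>1 \<beta>2)" using b(1) 1(1) 2(1) \<zeta> n by simp
    moreover have "\<forall>j<nocc x T (Or \<phi> \<psi>). map_fm f (\<zeta> j) = \<xi> j"
      using 1(3) 2(3) \<zeta> by (simp add: all_less_add)
    moreover have "map_fm f (Or \<beta>1 \<beta>2) = Or \<phi> \<psi>" using 1(2) 2(2) by simp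
    ultimately show ?thesis by blast
  qed
next
  case (And \<phi> \<psi>)
  from And.prems obtain b1 b2 where b: "b = And b1 b2" "map_fm f b1 = msubst x T \<xi> \<phi>"
    "map_fm f b2 = msubst x T (\<lambda>j. \<xi> (nocc x T \<phi> + j)) \<psi>"
    by (cases b) auto
  obtain \<beta>1 \<xi>1 where 1: "b1 = msubst x T \<xi>1 \<beta>1" "map_fm f \<beta>1 = \<phi>" "\<forall>j<nocc x T \<phi>. map_fm f (\<xi>1 j) = \<xi> j"
    using And.IH(1)[OF b(2)] by blast
  obtain \<beta>2 \<xi>2 where 2: "b2 = msubst x T \<xi>2 \<beta>2" "map_fm f \<beta>2 = \<psi>" "\<forall>j<nocc x T \<psi>. map_fm f (\<xi>2 j) = \<xi> (nocc x T \<phi> + j)"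
    using And.IH(2)[OF b(3)] by blast
  have n: "nocc x T \<beta>1 = nocc x T \<phi>" using 1(2) nocc_map_fm by metis
  show ?case
  proof -
    obtain \<zeta> where \<zeta>: "msubst x T \<zeta> \<beta>1 = msubst x T \<xi>1 \<beta>1" "\<forall>j<nocc x T \<phi>. \<zeta> j = \<xi>1 j"
      "\<And>j. \<zeta> (nocc x T \<phi> + j) = \<xi>2 j"
      using msubst_combine[of x T \<beta>1 \<xi>1 \<xi>2] n by auto
    have "b = msubst x T \<zeta> (And \<beta>1 \<beta>2)" using b(1) 1(1) 2(1) \<zeta> n by simp
    moreover have "\<forall>j<nocc x T (And \<phi> \<psi>). map_fm f (\<zeta> j) = \<xi> j"
      using 1(3) 2(3) \<zeta> by (simp add: all_less_add)
    moreover have "map_fm f (And \<beta>1 \<beta>2) = And \<phi> \<psi>" using 1(2) 2(2) by simp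
    ultimately show ?thesis by blast
  qed
next
  case (App \<phi> \<psi>)
  from App.prems obtain b1 b2 where b: "b = App b1 b2" "map_fm f b1 = msubst x T \<xi> \<phi>"
    "map_fm f b2 = msubst x T (\<lambda>j. \<xi> (nocc x T \<phi> + j)) \<psi>"
    by (cases b) auto
  obtain \<beta>1 \<xi>1 where 1: "b1 = msubst x T \<xi>1 \<beta>1" "map_fm f \<beta>1 = \<phi>" "\<forall>j<nocc x T \<phi>. map_fm f (\<xi>1 j) = \<xi> j"
    using App.IH(1)[OF b(2)] by blast
  obtain \<beta>2 \<xi>2 where 2: "b2 = msubst x T \<xi>2 \<beta>2" "map_fm f \<beta>2 = \<psi>" "\<forall>j<nocc x T \<psi>. map_fm f (\<xi>2 j) = \<xi> (nocc x T \<phi> + j)"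
    using App.IH(2)[OF b(3)] by blast
  have n: "nocc x T \<beta>1 = nocc x T \<phi>" using 1(2) nocc_map_fm by metis
  show ?case
  proof -
    obtain \<zeta> where \<zeta>: "msubst x T \<zeta> \<beta>1 = msubst x T \<xi>1 \<beta>1" "\<forall>j<nocc x T \<phi>. \<zeta> j = \<xi>1 j"
      "\<And>j. \<zeta> (nocc x T \<phi> + j) = \<xi>2 j"
      using msubst_combine[of x T \<beta>1 \<xi>1 \<xi>2] n by auto
    have "b = msubst x T \<zeta> (App \<beta>1 \<beta>2)" using b(1) 1(1) 2(1) \<zeta> n by simp
    moreover have "\<forall>j<nocc x T (App \<phi> \<psi>). map_fm f (\<zeta> j) = \<xi> j"
      using 1(3) 2(3) \<zeta> by (simp add: all_less_add)
    moreover have "map_fm f (App \<beta>1 \<beta>2) = App \<phi> \<psi>" using 1(2) 2(2) by simp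
    ultimately show ?thesis by blast
  qed
next
  case (Bd i)
  then show ?case by (intro exI[of _ "Bd i"]) (cases b; simp)
next
  case (Fr y U)
  show ?case
  proof (cases "y = x \<and> U = T")
    case True
    \<comment> \<open>At an occurrence of \<open>x\<close>, the whole of \<open>b\<close> is the
      copy.\<close>
    show ?thesis by (rule exI[of _ "Fr y U"], rule exI[of _ "\<lambda>_. b"]) (use True Fr in auto)
  next
    case False
    show ?thesis by (rule exI[of _ "Fr y U"], rule exI[of _ "\<lambda>_. b"]) (use False Fr in \<open>cases b; auto\<close>)
  qed
next
  case (Lam A \<phi>)
  from Lam.prems obtain b1 where b: "b = Lam A b1" "map_fm f b1 = msubst x T \<xi> \<phi>"
    by (cases b) auto
  then show ?case using Lam.IH[OF b(2)] by (metis fm.map(6) msubst.simps(6) nocc.simps(6))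
next
  case (AppT \<phi> t)
  from AppT.prems obtain b1 where b: "b = AppT b1 t" "map_fm f b1 = msubst x T \<xi> \<phi>"
    by (cases b) auto
  then show ?case using AppT.IH[OF b(2)] by (metis fm.map(8) msubst.simps(8) nocc.simps(8))
next
  case (Fix \<sigma> p U \<phi>)
  from Fix.prems obtain q b1 where b: "b = Fix \<sigma> q U b1" "f q = p" "map_fm f b1 = msubst x T \<xi> \<phi>"
    by (cases b) auto
  then show ?case using Fix.IH[OF b(3)] by (metis fm.map(9) msubst.simps(9) nocc.simps(9))
qed

lemma map_fm_eq_app1:
  "map_fm f z = app1 \<phi> e \<Longrightarrow> \<exists>z' e'. z = app1 z' e' \<and> map_fm f z' = \<phi> \<and> map_arg f e' = e"
  apply (cases e)
  subgoal for \<psi> apply (cases z; simp) by (metis app1.simps(1) arg.simps(9))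
  subgoal for t apply (cases z; simp) by (metis app1.simps(2) arg.simps(10))
  done

lemma map_fm_eq_apps:
  "map_fm f z = apps \<phi> es \<Longrightarrow> \<exists>z' es'. z = apps z' es' \<and> map_fm f z' = \<phi> \<and> map (map_arg f) es' = es"
proof (induction es arbitrary: z rule: rev_induct)
  case Nil
  then show ?case by (intro exI[of _ z] exI[of _ "[]"]) auto
next
  case (snoc e es)
  from snoc.prems obtain z1 e1 where 1: "z = app1 z1 e1" "map_fm f z1 = apps \<phi> es" "map_arg f e1 = e"
    using map_fm_eq_app1[of f z "apps \<phi> es" e] by auto
  from snoc.IH[OF this(2)] obtain z' es' where "z1 = apps z' es'" "map_fm f z' = \<phi>" "map (map_arg f) es' = es"
    by blast
  then show ?case using 1 by (intro exI[of _ z'] exI[of _ "es' @ [e1]"]) auto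
qed

fun is_app :: "'a fm \<Rightarrow> bool" where
  "is_app (App \<phi> \<psi>) = True"
| "is_app (AppT \<phi> t) = True"
| "is_app _ = False"

lemma app1_inject: "app1 \<phi> e = app1 \<phi>' e' \<longleftrightarrow> \<phi> = \<phi>' \<and> e = e'"
  by (cases e; cases e') auto

lemma is_app_app1 [simp]: "is_app (app1 \<phi> e)"
  by (cases e) auto

text \<open>A head that is itself an application would blur the boundary between head and arguments.
  The heads met below are \<open>Lam\<close> and \<open>Fix\<close>.\<close>

lemma apps_inject:
  "\<lbrakk>apps \<phi> es = apps \<phi>' es'; \<not> is_app \<phi>; \<not> is_app \<phi>'\<rbrakk> \<Longrightarrow> \<phi> = \<phi>' \<and> es = es'"
proof (induction es arbitrary: es' rule: rev_induct)
  case Nil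
  then show ?case by (cases es' rule: rev_cases) auto
next
  case (snoc e es)
  then show ?case by (cases es' rule: rev_cases) (auto simp: app1_inject)
qed

lemma is_app_map_fm [simp]: "is_app (map_fm f \<phi>) = is_app \<phi>"
  by (cases \<phi>) auto

subsection \<open>Pairs of annotations\<close>

text \<open>Equal erasures mean equal shapes, that is, the relator of \<open>fm\<close> holds for
  the full relation; such a relator is witnessed by a formula of pairs.\<close>

lemma ex_zip_fm:
  assumes "erase \<alpha> = erase b"
  shows "\<exists>z. map_fm fst z = \<alpha> \<and> map_fm snd z = b"
proof -
  have "rel_fm (=) (erase \<alpha>) (erase b)" using assms by (simp add: fm.rel_eq)
  then have "rel_fm (\<lambda>_ _. True) \<alpha> b" by (simp add: erase_def fm.rel_map)
  then show ?thesis by (auto simp: fm.in_rel)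
qed

lemma zip_fm_unique:
  "\<lbrakk>map_fm fst z = map_fm fst z'; map_fm snd z = map_fm snd z'\<rbrakk> \<Longrightarrow> z = z'"
  by (induction z arbitrary: z'; case_tac z') (auto simp: prod_eq_iff)

text \<open>In the application, \<open>\<alpha>\<close> carries the annotations of a trace and \<open>b\<close> the stages of approximants.\<close>

definition zanns :: "fp \<Rightarrow> 'a fm \<Rightarrow> 'b fm \<Rightarrow> ('a \<times> 'b) set" where
  "zanns \<sigma> \<alpha> b = {pq. \<exists>z. map_fm fst z = \<alpha> \<and> map_fm snd z = b \<and> pq \<in> anns \<sigma> z}"

text \<open>Uniqueness of the formula of pairs removes the existential quantifier: later
  computations of \<open>zanns\<close> exhibit that formula and compute \<open>anns\<close>.\<close>

lemma zanns_map [simp]: "zanns \<sigma> (map_fm fst z) (map_fm snd z) = anns \<sigma> z"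
  using zip_fm_unique by (fastforce simp: zanns_def)

lemma erase_zip [simp]: "erase (map_fm fst z) = erase z" "erase (map_fm snd z) = erase z"
  by (auto simp: erase_def fm.map_comp comp_def)

lemma fst_zanns: "erase \<alpha> = erase b \<Longrightarrow> fst ` zanns \<sigma> \<alpha> b = anns \<sigma> \<alpha>"
  using ex_zip_fm[of \<alpha> b] by force

lemma zanns_substT:
  assumes "erase \<alpha> = erase b"
  shows "zanns \<sigma> (substT \<theta> \<alpha>) (substT \<theta> b) = zanns \<sigma> \<alpha> b"
proof -
  obtain z where z: "map_fm fst z = \<alpha>" "map_fm snd z = b" using ex_zip_fm[OF assms] by blast
  show ?thesis using zanns_map[of \<sigma> "substT \<theta> z"] by (simp add: z[symmetric])
qed

lemma zanns_msubst:
  fixes \<beta> :: "'a fm" and \<beta>' :: "'b fm"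
  assumes "erase \<beta> = erase \<beta>'" "\<And>j. j < nocc x T \<beta> \<Longrightarrow> erase (\<xi> j) = erase (\<xi>' j)"
  shows "zanns \<sigma> (msubst x T \<xi> \<beta>) (msubst x T \<xi>' \<beta>') =
    zanns \<sigma> \<beta> \<beta>' \<union> (\<Union>j<nocc x T \<beta>. zanns \<sigma> (\<xi> j) (\<xi>' j))"
proof -
  obtain z where z: "\<beta> = map_fm fst z" "\<beta>' = map_fm snd z" using ex_zip_fm[OF assms(1)] by blast
  have "\<exists>u. map_fm fst u = \<xi> j \<and> map_fm snd u = \<xi>' j" if "j < nocc x T \<beta>" for j
    using ex_zip_fm[OF assms(2)[OF that]] .
  \<comment> \<open>A pairing is chosen for each actual occurrence only, which is all that
    \<open>msubst_cong\<close> asks for.\<close>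
  then obtain u where u: "\<And>j. j < nocc x T \<beta> \<Longrightarrow> \<xi> j = map_fm fst (u j) \<and> \<xi>' j = map_fm snd (u j)"
    by metis
  have "msubst x T \<xi> \<beta> = msubst x T (\<lambda>j. map_fm fst (u j)) \<beta>"
    using u by (intro msubst_cong) blast
  then have 1: "msubst x T \<xi> \<beta> = map_fm fst (msubst x T u z)"
    by (simp only: z map_fm_msubst)
  have "nocc x T \<beta>' = nocc x T \<beta>" by (simp add: z)
  then have "msubst x T \<xi>' \<beta>' = msubst x T (\<lambda>j. map_fm snd (u j)) \<beta>'"
    using u by (intro msubst_cong) simp
  then have 2: "msubst x T \<xi>' \<beta>' = map_fm snd (msubst x T u z)"
    by (simp only: z map_fm_msubst)
  have "zanns \<sigma> (msubst x T \<xi> \<beta>) (msubst x T \<xi>' \<beta>') = anns \<sigma> (msubst x T u z)"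
    unfolding 1 2 by (rule zanns_map)
  also have "\<dots> = anns \<sigma> z \<union> (\<Union>j<nocc x T z. anns \<sigma> (u j))" by (rule anns_msubst)
  also have "anns \<sigma> z = zanns \<sigma> \<beta> \<beta>'" unfolding z by (rule zanns_map[symmetric])
  also have "(\<Union>j<nocc x T z. anns \<sigma> (u j)) = (\<Union>j<nocc x T \<beta>. zanns \<sigma> (\<xi> j) (\<xi>' j))"
    by (intro SUP_cong) (auto simp: z u)
  finally show ?thesis .
qed

section \<open>Every adequate type is a complete lattice, in both directions of the order\<close>

section \<open>Interpretations of types as complete lattices\<close>

text \<open>Orders and bounds at \<open>Arr A T\<close> are pointwise in \<open>T\<close>, so the
  induction runs along result types.\<close>

lemma fty_induct [case_names Omega Arr]:
  "\<lbrakk>P Omega; \<And>A T. P T \<Longrightarrow> P (Arr A T)\<rbrakk> \<Longrightarrow> P T"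
  by (rule fty.induct[of "\<lambda>_. True" P]) auto

lemma leF_refl [simp]: "leF C T x x"
  by (induction T arbitrary: x rule: fty_induct) auto

lemma leA_refl [simp]: "leA C A x x"
  by (cases A) auto

abbreviation mfuns :: "'v coding \<Rightarrow> aty \<Rightarrow> fty \<Rightarrow> ('v val \<Rightarrow> 'v val) set" where
  "mfuns C A T \<equiv> mono_funs (domA C A) (leA C A) (domF C T) (leF C T)"

lemma domF_ArrE:
  assumes "adequate C (Arr A T)" "v \<in> domF C (Arr A T)"
  obtains f where "f \<in> mfuns C A T" "v = VF (enc C f)" "app C v = f"
  using assms by (auto simp: app_def fun_eq_iff)

lemma app_VF: "\<lbrakk>adequate C (Arr A T); f \<in> mfuns C A T\<rbrakk> \<Longrightarrow> app C (VF (enc C f)) = f"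
  by (auto simp: app_def fun_eq_iff)

lemma app_in:
  "\<lbrakk>adequate C (Arr A T); v \<in> domF C (Arr A T); d \<in> domA C A\<rbrakk> \<Longrightarrow> app C v d \<in> domF C T"
  by (metis domF_ArrE mono_funsD(2))

lemma app_mono:
  "\<lbrakk>adequate C (Arr A T); v \<in> domF C (Arr A T); d \<in> domA C A; d' \<in> domA C A; leA C A d d'\<rbrakk>
    \<Longrightarrow> leF C T (app C v d) (app C v d')"
  by (metis domF_ArrE mono_funsD(3))

lemma leF_trans:
  "\<lbrakk>adequate C T; x \<in> domF C T; y \<in> domF C T; z \<in> domF C T; leF C T x y; leF C T y z\<rbrakk>
    \<Longrightarrow> leF C T x z"
proof (induction T arbitrary: x y z rule: fty_induct)
  case (Arr A T)
  have "leF C T (app C x d) (app C z d)" if "d \<in> domA C A" for d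
    using Arr.IH[of "app C x d" "app C y d" "app C z d"] Arr.prems app_in[OF Arr.prems(1) _ that] that
    by simp
  then show ?case by simp
qed auto

lemma leF_antisym:
  "\<lbrakk>adequate C T; x \<in> domF C T; y \<in> domF C T; leF C T x y; leF C T y x\<rbrakk> \<Longrightarrow> x = y"
proof (induction T arbitrary: x y rule: fty_induct)
  case (Arr A T)
  obtain f where f: "f \<in> mfuns C A T" "x = VF (enc C f)" "app C x = f"
    using domF_ArrE Arr.prems(1,2) by blast
  obtain g where g: "g \<in> mfuns C A T" "y = VF (enc C g)" "app C y = g"
    using domF_ArrE Arr.prems(1,3) by blast
  have "f = g"
  proof
    fix d
    show "f d = g d"
    proof (cases "d \<in> domA C A")
      case True
      then show ?thesis
        using Arr.IH[of "f d" "g d"] Arr.prems f g mono_funsD(2)[of _ _ _ _ _ d] by auto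
    next
      \<comment> \<open>Outside the domain \<open>mono_funs\<close> prescribes the value
        \<open>VB False\<close>, so agreement on the domain is equality.\<close>
      case False
      then show ?thesis using f(1) g(1) mono_funsD(1) by metis
    qed
  qed
  then show ?case using f g by simp
qed auto

text \<open>The order is reversed for \<open>Nu\<close>, so that the greatest fixed point is the
  least one for \<open>le\<close> and one argument serves both kinds.\<close>

definition le :: "'v coding \<Rightarrow> fp \<Rightarrow> fty \<Rightarrow> 'v val \<Rightarrow> 'v val \<Rightarrow> bool" where
  "le C \<sigma> T x y = (case \<sigma> of Mu \<Rightarrow> leF C T x y | Nu \<Rightarrow> leF C T y x)"

lemma le_refl [simp]: "le C \<sigma> T x x"
  by (simp add: le_def split: fp.split)

lemma le_trans:
  "\<lbrakk>adequate C T; x \<in> domF C T; y \<in> domF C T; z \<in> domF C T; le C \<sigma> T x y; le C \<sigma> T y z\<rbrakk>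
    \<Longrightarrow> le C \<sigma> T x z"
  using leF_trans[of C T x y z] leF_trans[of C T z y x] by (auto simp: le_def split: fp.splits)

lemma le_antisym:
  "\<lbrakk>adequate C T; x \<in> domF C T; y \<in> domF C T; le C \<sigma> T x y; le C \<sigma> T y x\<rbrakk> \<Longrightarrow> x = y"
  using leF_antisym[of C T x y] by (auto simp: le_def split: fp.splits)

lemma le_Arr: "le C \<sigma> (Arr A T) f g \<longleftrightarrow> (\<forall>d\<in>domA C A. le C \<sigma> T (app C f d) (app C g d))"
  by (simp add: le_def split: fp.split)

fun dual :: "fp \<Rightarrow> fp" where
  "dual Mu = Nu"
| "dual Nu = Mu"

lemma le_dual [simp]: "le C (dual \<sigma>) T x y = le C \<sigma> T y x"
  by (cases \<sigma>) (auto simp: le_def)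

text \<open>The supremum of \<open>X\<close> for \<open>\<sigma> = Mu\<close> and the infimum for \<open>\<sigma> = Nu\<close>.\<close>

fun bound :: "'v coding \<Rightarrow> fp \<Rightarrow> fty \<Rightarrow> 'v val set \<Rightarrow> 'v val" where
  "bound C \<sigma> Omega X = VB (case \<sigma> of Mu \<Rightarrow> \<exists>x\<in>X. truth x | Nu \<Rightarrow> \<forall>x\<in>X. truth x)"
| "bound C \<sigma> (Arr A T) X = VF (enc C (restr (domA C A) (\<lambda>d. bound C \<sigma> T ((\<lambda>f. app C f d) ` X))))"

text \<open>All facts come from one induction on \<open>T\<close>: at a function type the pointwise
  bound lies in the domain only if it is monotone, and its monotonicity rests on the bound
  properties at the result type.\<close>

lemma bound:
  assumes "adequate C T" "X \<subseteq> domF C T"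
  shows bound_in: "bound C \<sigma> T X \<in> domF C T"
    and bound_upper: "x \<in> X \<Longrightarrow> le C \<sigma> T x (bound C \<sigma> T X)"
    and bound_least: "y \<in> domF C T \<Longrightarrow> (\<And>x. x \<in> X \<Longrightarrow> le C \<sigma> T x y) \<Longrightarrow> le C \<sigma> T (bound C \<sigma> T X) y"
    and app_bound: "T = Arr A U \<Longrightarrow> d \<in> domA C A \<Longrightarrow>
      app C (bound C \<sigma> T X) d = bound C \<sigma> U ((\<lambda>f. app C f d) ` X)"
proof -
  have "bound C \<sigma> T X \<in> domF C T \<and> (\<forall>x\<in>X. le C \<sigma> T x (bound C \<sigma> T X)) \<and>
    (\<forall>y\<in>domF C T. (\<forall>x\<in>X. le C \<sigma> T x y) \<longrightarrow> le C \<sigma> T (bound C \<sigma> T X) y) \<and>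
    (\<forall>A U d. T = Arr A U \<longrightarrow> d \<in> domA C A \<longrightarrow>
      app C (bound C \<sigma> T X) d = bound C \<sigma> U ((\<lambda>f. app C f d) ` X))"
    using assms
  proof (induction T arbitrary: X rule: fty_induct)
    case Omega
    then show ?case by (cases \<sigma>) (auto simp: le_def)
  next
    case (Arr A T)
    let ?Y = "\<lambda>d. (\<lambda>f. app C f d) ` X"
    let ?f = "restr (domA C A) (\<lambda>d. bound C \<sigma> T (?Y d))"
    have ad: "adequate C T" using Arr.prems(1) by simp
    have Y: "?Y d \<subseteq> domF C T" if "d \<in> domA C A" for d
      using app_in[OF Arr.prems(1) _ that] Arr.prems(2) by blast
    note IH = Arr.IH[OF ad Y]
    have in_Y: "bound C \<sigma> T (?Y d) \<in> domF C T" if "d \<in> domA C A" for d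
      using IH[OF that] by blast
    have upper: "le C \<sigma> T (app C f d) (bound C \<sigma> T (?Y d))" if "d \<in> domA C A" "f \<in> X" for d f
      using IH[OF that(1)] that(2) by blast
    have least: "le C \<sigma> T (bound C \<sigma> T (?Y d)) y"
      if "d \<in> domA C A" "y \<in> domF C T" "\<And>f. f \<in> X \<Longrightarrow> le C \<sigma> T (app C f d) y" for d y
      using IH[OF that(1)] that(2,3) by blast
    have mono: "le C \<sigma> T (bound C \<sigma> T (?Y d)) (bound C \<sigma> T (?Y d'))"
      if d: "d \<in> domA C A" "d' \<in> domA C A" "\<And>f. f \<in> X \<Longrightarrow> le C \<sigma> T (app C f d) (app C f d')" for d d'
    proof (rule least[OF d(1) in_Y[OF d(2)]])
      fix f assume f: "f \<in> X"
      show "le C \<sigma> T (app C f d) (bound C \<sigma> T (?Y d'))"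
        using f d(1,2) Y by (intro le_trans[OF ad _ _ in_Y[OF d(2)] d(3)[OF f] upper[OF d(2) f]]) blast+
    qed
    have F: "?f \<in> mfuns C A T"
    proof (rule mono_funsI)
      fix d d' assume d: "d \<in> domA C A" "d' \<in> domA C A" "leA C A d d'"
      have "leF C T (app C f d) (app C f d')" if "f \<in> X" for f
        using app_mono[OF Arr.prems(1) _ d] that Arr.prems(2) by blast
      \<comment> \<open>For \<open>Nu\<close> the monotonicity of bounds is used with the two
        arguments exchanged.\<close>
      then show "leF C T (?f d) (?f d')"
        using mono[of d d'] mono[of d' d] d by (cases \<sigma>) (auto simp: restr_def le_def)
    qed (auto simp: restr_def in_Y)
    have ap: "app C (bound C \<sigma> (Arr A T) X) d = bound C \<sigma> T (?Y d)" if "d \<in> domA C A" for d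
      using app_VF[OF Arr.prems(1) F] that by (simp add: restr_def)
    have "bound C \<sigma> (Arr A T) X \<in> domF C (Arr A T)" using F by auto
    moreover have "le C \<sigma> (Arr A T) f (bound C \<sigma> (Arr A T) X)" if "f \<in> X" for f
      unfolding le_Arr using upper that ap by simp
    moreover have "le C \<sigma> (Arr A T) (bound C \<sigma> (Arr A T) X) y"
      if y: "y \<in> domF C (Arr A T)" "\<forall>x\<in>X. le C \<sigma> (Arr A T) x y" for y
      unfolding le_Arr
    proof
      fix d assume d: "d \<in> domA C A"
      show "le C \<sigma> T (app C (bound C \<sigma> (Arr A T) X) d) (app C y d)"
        using least[OF d app_in[OF Arr.prems(1) y(1) d]] y(2) d unfolding ap[OF d] le_Arr by blast
    qed
    ultimately show ?case using ap by blast
  qed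
  then show "bound C \<sigma> T X \<in> domF C T"
    and "x \<in> X \<Longrightarrow> le C \<sigma> T x (bound C \<sigma> T X)"
    and "y \<in> domF C T \<Longrightarrow> (\<And>x. x \<in> X \<Longrightarrow> le C \<sigma> T x y) \<Longrightarrow> le C \<sigma> T (bound C \<sigma> T X) y"
    and "T = Arr A U \<Longrightarrow> d \<in> domA C A \<Longrightarrow>
      app C (bound C \<sigma> T X) d = bound C \<sigma> U ((\<lambda>f. app C f d) ` X)"
    by blast+
qed

subsection \<open>Argument lists\<close>

definition appsv :: "'v coding \<Rightarrow> 'v val \<Rightarrow> 'v val list \<Rightarrow> 'v val" where
  "appsv C v ds = foldl (app C) v ds"

lemma appsv_simps [simp]: "appsv C v [] = v" "appsv C v (d # ds) = appsv C (app C v d) ds"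
  by (auto simp: appsv_def)

text \<open>The full argument lists for type \<open>T\<close>, leading down to \<open>Omega\<close>,
  where truth can be read off.\<close>

fun spine :: "'v coding \<Rightarrow> fty \<Rightarrow> 'v val list \<Rightarrow> bool" where
  "spine C Omega ds \<longleftrightarrow> ds = []"
| "spine C (Arr A T) [] \<longleftrightarrow> False"
| "spine C (Arr A T) (d # ds) \<longleftrightarrow> d \<in> domA C A \<and> spine C T ds"

text \<open>Bounds pass through the arguments and end as a disjunction or conjunction at
  \<open>Omega\<close>. A supremum is true exactly if a member is, an infimum false exactly if a
  member is; the comparison with \<open>\<sigma> = Mu\<close> covers both. This selects the stage in
  an unfolding.\<close>

lemma truth_appsv_bound:
  "\<lbrakk>adequate C T; X \<subseteq> domF C T; spine C T ds\<rbrakk> \<Longrightarrow>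
    (truth (appsv C (bound C \<sigma> T X) ds) \<longleftrightarrow> \<sigma> = Mu) \<longleftrightarrow> (\<exists>x\<in>X. truth (appsv C x ds) \<longleftrightarrow> \<sigma> = Mu)"
proof (induction T arbitrary: X ds rule: fty_induct)
  case Omega
  then show ?case by (cases \<sigma>) auto
next
  case (Arr A T)
  then obtain d ds' where ds: "ds = d # ds'" "d \<in> domA C A" "spine C T ds'"
    by (cases ds) auto
  have "(\<lambda>f. app C f d) ` X \<subseteq> domF C T"
    using app_in[OF Arr.prems(1) _ ds(2)] Arr.prems(2) by blast
  then show ?case
    using Arr.IH[OF _ _ ds(3)] Arr.prems(1) app_bound[OF Arr.prems(1,2) _ ds(2)] ds by simp
qed

text \<open>A pointwise comparison fails at certain arguments; these become the values of the fresh
  variables of (Mono).\<close>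

lemma not_leF_spine:
  "\<lbrakk>adequate C T; \<not> leF C T u v\<rbrakk> \<Longrightarrow>
    \<exists>ds. spine C T ds \<and> truth (appsv C u ds) \<and> \<not> truth (appsv C v ds)"
proof (induction T arbitrary: u v rule: fty_induct)
  case Omega
  then show ?case by auto
next
  case (Arr A T)
  then obtain d where d: "d \<in> domA C A" "\<not> leF C T (app C u d) (app C v d)" by auto
  then obtain ds where "spine C T ds" "truth (appsv C (app C u d) ds)" "\<not> truth (appsv C (app C v d) ds)"
    using Arr.IH[OF _ d(2)] Arr.prems(1) by auto
  then show ?case using d by (intro exI[of _ "d # ds"]) auto
qed

section \<open>Knaster-Tarski fixed points and their transfinite iteration\<close>

section \<open>Fixed points and their approximants\<close>

text \<open>Bodies of fixed-point operators are evaluated as plain functions, neither encoded nor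
  normalised outside the domain; this is the counterpart of \<open>mfuns\<close> for them.\<close>

definition mfun :: "'v coding \<Rightarrow> fty \<Rightarrow> ('v val \<Rightarrow> 'v val) \<Rightarrow> bool" where
  "mfun C T f \<longleftrightarrow> (\<forall>x\<in>domF C T. f x \<in> domF C T) \<and>
     (\<forall>x\<in>domF C T. \<forall>y\<in>domF C T. leF C T x y \<longrightarrow> leF C T (f x) (f y))"

lemma mfun_in: "\<lbrakk>mfun C T f; x \<in> domF C T\<rbrakk> \<Longrightarrow> f x \<in> domF C T"
  by (simp add: mfun_def)

lemma mfun_le:
  "\<lbrakk>mfun C T f; x \<in> domF C T; y \<in> domF C T; le C \<sigma> T x y\<rbrakk> \<Longrightarrow> le C \<sigma> T (f x) (f y)"
  by (cases \<sigma>) (auto simp: mfun_def le_def)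

text \<open>The Knaster-Tarski argument in the order \<open>le C \<sigma>\<close>; antisymmetry
  makes the description in \<open>fixpoint_def\<close> definite.\<close>

lemma fixpoint:
  assumes ad: "adequate C T" and f: "mfun C T f"
  shows fixpoint_in: "fixpoint C \<sigma> T f \<in> domF C T"
    and fixpoint_eq: "f (fixpoint C \<sigma> T f) = fixpoint C \<sigma> T f"
    and fixpoint_least: "\<lbrakk>e \<in> domF C T; le C \<sigma> T (f e) e\<rbrakk> \<Longrightarrow> le C \<sigma> T (fixpoint C \<sigma> T f) e"
proof -
  define X where "X = {x \<in> domF C T. le C \<sigma> T (f x) x}"
  \<comment> \<open>A greatest lower bound with respect to \<open>le C \<sigma>\<close> is wanted,
    hence \<open>bound\<close> for the dual kind.\<close>
  define d where "d = bound C (dual \<sigma>) T X"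
  have X: "X \<subseteq> domF C T" by (auto simp: X_def)
  have d: "d \<in> domF C T" using bound_in[OF ad X] by (simp add: d_def)
  have lower: "le C \<sigma> T d x" if "x \<in> X" for x
    using bound_upper[OF ad X that, of "dual \<sigma>"] by (simp add: d_def)
  have greatest: "le C \<sigma> T y d" if "y \<in> domF C T" "\<And>x. x \<in> X \<Longrightarrow> le C \<sigma> T y x" for y
    using bound_least[OF ad X that(1), of "dual \<sigma>"] that(2) by (simp add: d_def)
  have fd: "f d \<in> domF C T" using mfun_in[OF f d] .
  have 1: "le C \<sigma> T (f d) d"
  proof (rule greatest[OF fd])
    fix x assume x: "x \<in> X"
    then have "x \<in> domF C T" "le C \<sigma> T (f x) x" by (auto simp: X_def)
    then show "le C \<sigma> T (f d) x"
      using le_trans[OF ad fd mfun_in[OF f, of x], of x] mfun_le[OF f d _ lower[OF x]] by blast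
  qed
  have "f d \<in> X" unfolding X_def using fd mfun_le[OF f fd d 1] by blast
  then have eq: "f d = d" using le_antisym[OF ad fd d 1 lower] by blast
  have least: "le C \<sigma> T d e" if "e \<in> domF C T" "le C \<sigma> T (f e) e" for e
    using that lower by (simp add: X_def)
  have "fixpoint C \<sigma> T f = d"
    unfolding fixpoint_def le_def[symmetric]
  proof (rule the_equality)
    show "d \<in> domF C T \<and> f d = d \<and> (\<forall>e\<in>domF C T. f e = e \<longrightarrow> le C \<sigma> T d e)"
      using d eq least by simp
  next
    fix d' assume "d' \<in> domF C T \<and> f d' = d' \<and> (\<forall>e\<in>domF C T. f e = e \<longrightarrow> le C \<sigma> T d' e)"
    then show "d' = d" using le_antisym[OF ad _ d, of d' \<sigma>] d eq least by simp
  qed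
  then show "fixpoint C \<sigma> T f \<in> domF C T" "f (fixpoint C \<sigma> T f) = fixpoint C \<sigma> T f"
    "\<lbrakk>e \<in> domF C T; le C \<sigma> T (f e) e\<rbrakk> \<Longrightarrow> le C \<sigma> T (fixpoint C \<sigma> T f) e"
    using d eq least by simp_all
qed

text \<open>
  Sets of values serve as ordinals: by Cantor's theorem a strictly monotone sequence of values cannot
  be indexed by all of them.
\<close>

type_synonym 'v ord = "'v val set"

definition ord_less :: "('v ord \<times> 'v ord) set" where
  "ord_less = (SOME r. Well_order r \<and> Field r = UNIV) - Id"

lemma ord_less:
  fixes a b :: "'v ord"
  shows wf_ord_less: "wf (ord_less :: 'v ord rel)"
    and ord_less_total: "a \<noteq> b \<Longrightarrow> (a, b) \<in> ord_less \<or> (b, a) \<in> ord_less"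
proof -
  define r :: "'v ord rel" where "r = (SOME r. Well_order r \<and> Field r = UNIV)"
  have "Well_order r \<and> Field r = UNIV" unfolding r_def by (rule someI_ex[OF well_ordering])
  then have r: "Well_order r" "Field r = UNIV" by blast+
  have o: "ord_less = r - Id" by (simp add: ord_less_def r_def)
  have lin: "total r" using r by (auto simp: well_order_on_def linear_order_on_def)
  show "wf (ord_less :: 'v ord rel)" using r by (simp add: o well_order_on_def)
  show "a \<noteq> b \<Longrightarrow> (a, b) \<in> ord_less \<or> (b, a) \<in> ord_less"
    using lin by (auto simp: o total_on_def r(2))
qed

text \<open>One clause covers zero, successors and limits, since each stage is the bound of
  \<open>f\<close> over all earlier ones; an unfolding thus passes to a strictly earlier stage in
  every case.\<close>

definition approx :: "'v coding \<Rightarrow> fp \<Rightarrow> fty \<Rightarrow> ('v val \<Rightarrow> 'v val) \<Rightarrow> 'v ord \<Rightarrow> 'v val" where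
  "approx C \<sigma> T f = wfrec ord_less (\<lambda>g a. bound C \<sigma> T ((\<lambda>b. f (g b)) ` {b. (b, a) \<in> ord_less}))"

lemma approx: "approx C \<sigma> T f a = bound C \<sigma> T ((\<lambda>b. f (approx C \<sigma> T f b)) ` {b. (b, a) \<in> ord_less})"
proof -
  let ?F = "\<lambda>g a. bound C \<sigma> T ((\<lambda>b. f (g b)) ` {b. (b, a) \<in> ord_less})"
  have "approx C \<sigma> T f a = ?F (cut (approx C \<sigma> T f) ord_less a) a"
    unfolding approx_def by (rule wfrec[OF wf_ord_less])
  also have "\<dots> = ?F (approx C \<sigma> T f) a"
    by (intro arg_cong[of _ _ "bound C \<sigma> T"] image_cong) (auto simp: cut_apply)
  finally show ?thesis .
qed

lemma approx_in:
  assumes "adequate C T" "mfun C T f" shows "approx C \<sigma> T f a \<in> domF C T"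
proof (induction a rule: wf_induct_rule[OF wf_ord_less])
  case (1 a)
  then have "(\<lambda>b. f (approx C \<sigma> T f b)) ` {b. (b, a) \<in> ord_less} \<subseteq> domF C T"
    using mfun_in[OF assms(2)] by blast
  then show ?case unfolding approx[of C \<sigma> T f a] by (rule bound_in[OF assms(1)])
qed

text \<open>An annotation \<open>None\<close> stands for the fixed point itself, \<open>Some a\<close> for its approximant at stage \<open>a\<close>.\<close>

definition fpv :: "'v coding \<Rightarrow> fp \<Rightarrow> fty \<Rightarrow> ('v val \<Rightarrow> 'v val) \<Rightarrow> 'v ord option \<Rightarrow> 'v val" where
  "fpv C \<sigma> T f p = (case p of None \<Rightarrow> fixpoint C \<sigma> T f | Some a \<Rightarrow> approx C \<sigma> T f a)"

text \<open>The stages open to an unfolding: \<open>None\<close> acts as a stage above all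
  others.\<close>

definition below :: "'v ord option \<Rightarrow> 'v ord set" where
  "below p = (case p of None \<Rightarrow> UNIV | Some a \<Rightarrow> {b. (b, a) \<in> ord_less})"

lemma fpv_in: "\<lbrakk>adequate C T; mfun C T f\<rbrakk> \<Longrightarrow> fpv C \<sigma> T f p \<in> domF C T"
  by (cases p) (auto simp: fpv_def approx_in fixpoint_in)

lemma approx_le_fixpoint:
  assumes ad: "adequate C T" and f: "mfun C T f"
  shows "le C \<sigma> T (approx C \<sigma> T f a) (fixpoint C \<sigma> T f)"
proof (induction a rule: wf_induct_rule[OF wf_ord_less])
  case (1 a)
  show ?case
    unfolding approx[of C \<sigma> T f a]
  proof (rule bound_least[OF ad])
    fix x assume "x \<in> (\<lambda>b. f (approx C \<sigma> T f b)) ` {b. (b, a) \<in> ord_less}"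
    then obtain b where b: "x = f (approx C \<sigma> T f b)" "(b, a) \<in> ord_less" by blast
    show "le C \<sigma> T x (fixpoint C \<sigma> T f)"
      using mfun_le[OF f approx_in[OF ad f] fixpoint_in[OF ad f] 1[OF b(2)]]
      by (simp add: b fixpoint_eq[OF ad f])
  qed (use ad f in \<open>auto intro: mfun_in approx_in fixpoint_in\<close>)
qed

text \<open>For a stage this is the recursion equation. For the fixed point itself the iteration
  must close off: were it injective, sets of values would embed into values. Where it repeats, it
  has reached the fixed point.\<close>

lemma fpv_unfold:
  assumes ad: "adequate C T" and f: "mfun C T f"
  shows "fpv C \<sigma> T f p = bound C \<sigma> T ((\<lambda>b. f (approx C \<sigma> T f b)) ` below p)"
proof (cases p)
  case (Some a)
  then show ?thesis using approx by (simp add: fpv_def below_def)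
next
  case None
  let ?X = "range (\<lambda>b. f (approx C \<sigma> T f b))"
  let ?d = "bound C \<sigma> T ?X"
  have X: "?X \<subseteq> domF C T" using approx_in[OF ad f] mfun_in[OF f] by blast
  have in_fd: "f (approx C \<sigma> T f b) \<in> domF C T" for b using X by blast
  have fx: "fixpoint C \<sigma> T f \<in> domF C T" by (rule fixpoint_in[OF ad f])
  have step: "le C \<sigma> T (f (approx C \<sigma> T f b)) (approx C \<sigma> T f a)" if "(b, a) \<in> ord_less" for a b
    unfolding approx[of C \<sigma> T f a] by (rule bound_upper[OF ad]) (use that in_fd in auto)
  have "\<not> inj (approx C \<sigma> T f)"
  proof
    assume "inj (approx C \<sigma> T f)"
    then have "surj (inv (approx C \<sigma> T f))" by (rule inj_imp_surj_inv)
    then show False using Cantors_theorem[of "UNIV :: 'a val set"] by (metis Pow_UNIV)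
  qed
  \<comment> \<open>Two different stages share a value; by totality the earlier one can be called
    \<open>b\<close>.\<close>
  then obtain a b where ab: "(b, a) \<in> ord_less" "approx C \<sigma> T f a = approx C \<sigma> T f b"
    using ord_less_total unfolding inj_def by metis
  \<comment> \<open>The repeated value is a prefixed point, so leastness of the fixed point applies
    to it.\<close>
  have "le C \<sigma> T (f (approx C \<sigma> T f b)) (approx C \<sigma> T f b)" using step[OF ab(1)] ab(2) by simp
  then have 1: "le C \<sigma> T (fixpoint C \<sigma> T f) (approx C \<sigma> T f b)"
    using fixpoint_least[OF ad f approx_in[OF ad f]] by blast
  then have eq: "approx C \<sigma> T f b = fixpoint C \<sigma> T f"
    using le_antisym[OF ad approx_in[OF ad f] fx approx_le_fixpoint[OF ad f]] by blast
  have "le C \<sigma> T (fixpoint C \<sigma> T f) ?d"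
    using bound_upper[OF ad X rangeI, of \<sigma> b] by (simp add: eq fixpoint_eq[OF ad f])
  moreover have "le C \<sigma> T ?d (fixpoint C \<sigma> T f)"
  proof (rule bound_least[OF ad X fx])
    fix x assume "x \<in> ?X"
    then obtain c where "x = f (approx C \<sigma> T f c)" by blast
    then show "le C \<sigma> T x (fixpoint C \<sigma> T f)"
      using mfun_le[OF f approx_in[OF ad f] fx approx_le_fixpoint[OF ad f]]
      by (simp add: fixpoint_eq[OF ad f])
  qed
  ultimately have "fixpoint C \<sigma> T f = ?d" using le_antisym[OF ad fx bound_in[OF ad X]] by blast
  then show ?thesis using None by (simp add: fpv_def below_def)
qed

text \<open>Exact least fixed points lie above their approximants, exact greatest ones below; the
  condition on \<open>p\<close> and \<open>q\<close> says no more. With \<open>p\<close> on the left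
  and \<open>q\<close> on the right of a sequent, polarity guarantees it.\<close>

lemma fpv_mono:
  assumes ad: "adequate C T" and f: "mfun C T f" and g: "mfun C T g"
    and fg: "\<And>x. x \<in> domF C T \<Longrightarrow> leF C T (f x) (g x)"
    and pq: "p = q \<or> \<sigma> = Mu \<and> q = None \<or> \<sigma> = Nu \<and> p = None"
  shows "leF C T (fpv C \<sigma> T f p) (fpv C \<sigma> T g q)"
proof -
  have fx: "leF C T (fixpoint C \<sigma> T f) (fixpoint C \<sigma> T g)"
  proof (cases \<sigma>)
    case Mu
    have "le C Mu T (f (fixpoint C Mu T g)) (fixpoint C Mu T g)"
      using fg[OF fixpoint_in[OF ad g, of Mu]] by (simp add: le_def fixpoint_eq[OF ad g])
    then show ?thesis
      using fixpoint_least[OF ad f fixpoint_in[OF ad g], of Mu Mu] Mu by (auto simp: le_def)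
  next
    case Nu
    have "le C Nu T (g (fixpoint C Nu T f)) (fixpoint C Nu T f)"
      using fg[OF fixpoint_in[OF ad f, of Nu]] by (simp add: le_def fixpoint_eq[OF ad f])
    then show ?thesis
      using fixpoint_least[OF ad g fixpoint_in[OF ad f], of Nu Nu] Nu by (auto simp: le_def)
  qed
  have ap: "leF C T (approx C \<sigma> T f a) (approx C \<sigma> T g a)" for a
  proof (induction a rule: wf_induct_rule[OF wf_ord_less])
    case (1 a)
    let ?X = "\<lambda>f. (\<lambda>b. f (approx C \<sigma> T f b)) ` {b. (b, a) \<in> ord_less}"
    have X: "?X f \<subseteq> domF C T" "?X g \<subseteq> domF C T"
      using approx_in[OF ad] mfun_in f g by blast+
    have stp: "leF C T (f (approx C \<sigma> T f b)) (g (approx C \<sigma> T g b))" if "(b, a) \<in> ord_less" for b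
    proof -
      have "leF C T (f (approx C \<sigma> T f b)) (f (approx C \<sigma> T g b))"
        using mfun_le[OF f approx_in[OF ad f] approx_in[OF ad g], of Mu] 1[OF that] by (auto simp: le_def)
      then show ?thesis
        using leF_trans[OF ad _ _ _ _ fg] approx_in[OF ad] mfun_in f g by blast
    qed
    show ?case
    proof (cases \<sigma>)
      case Mu
      have "le C \<sigma> T (bound C \<sigma> T (?X f)) (bound C \<sigma> T (?X g))"
      proof (rule bound_least[OF ad X(1) bound_in[OF ad X(2)]])
        fix x assume "x \<in> ?X f"
        then obtain b where b: "x = f (approx C \<sigma> T f b)" "(b, a) \<in> ord_less" by blast
        have "le C \<sigma> T (g (approx C \<sigma> T g b)) (bound C \<sigma> T (?X g))"
          using b by (intro bound_upper[OF ad X(2)]) blast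
        moreover have "le C \<sigma> T x (g (approx C \<sigma> T g b))" using stp[OF b(2)] by (simp add: b Mu le_def)
        ultimately show "le C \<sigma> T x (bound C \<sigma> T (?X g))"
          using le_trans[OF ad _ _ bound_in[OF ad X(2)]] b X by blast
      qed
      then show ?thesis unfolding approx[of C \<sigma> T f a] approx[of C \<sigma> T g a] by (simp add: le_def Mu)
    next
      case Nu
      have "le C \<sigma> T (bound C \<sigma> T (?X g)) (bound C \<sigma> T (?X f))"
      proof (rule bound_least[OF ad X(2) bound_in[OF ad X(1)]])
        fix x assume "x \<in> ?X g"
        then obtain b where b: "x = g (approx C \<sigma> T g b)" "(b, a) \<in> ord_less" by blast
        have "le C \<sigma> T (f (approx C \<sigma> T f b)) (bound C \<sigma> T (?X f))"
          using b by (intro bound_upper[OF ad X(1)]) blast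
        moreover have "le C \<sigma> T x (f (approx C \<sigma> T f b))" using stp[OF b(2)] by (simp add: b Nu le_def)
        ultimately show "le C \<sigma> T x (bound C \<sigma> T (?X f))"
          using le_trans[OF ad _ _ bound_in[OF ad X(1)]] b X by blast
      qed
      then show ?thesis unfolding approx[of C \<sigma> T f a] approx[of C \<sigma> T g a] by (simp add: le_def Nu)
    qed
  qed
  have afx: "leF C T (approx C \<sigma> T f a) (fixpoint C \<sigma> T g)" if "\<sigma> = Mu" for a
    using approx_le_fixpoint[OF ad g, of Mu a] ap[of a] that leF_trans[OF ad approx_in[OF ad f] approx_in[OF ad g] fixpoint_in[OF ad g]]
    by (auto simp: le_def)
  have fxa: "leF C T (fixpoint C \<sigma> T f) (approx C \<sigma> T g a)" if "\<sigma> = Nu" for a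
    using approx_le_fixpoint[OF ad f, of Nu a] ap[of a] that leF_trans[OF ad fixpoint_in[OF ad f] approx_in[OF ad f] approx_in[OF ad g]]
    by (auto simp: le_def)
  show ?thesis using pq fx ap afx fxa by (auto simp: fpv_def split: option.splits)
qed

\<comment> \<open>Typing that records the adequacy of the types involved\<close>
section \<open>Typing\<close>

inductive_simps wt_simps:
  "wt \<Theta> (Eq s t) T" "wt \<Theta> (Or \<phi> \<psi>) T" "wt \<Theta> (And \<phi> \<psi>) T" "wt \<Theta> (Bd i) T" "wt \<Theta> (Fr x U) T"
  "wt \<Theta> (Lam A \<phi>) T" "wt \<Theta> (App \<phi> \<psi>) T" "wt \<Theta> (AppT \<phi> t) T" "wt \<Theta> (Fix \<sigma> p U \<phi>) T"

lemma wt_unique: "wt \<Theta> \<phi> T \<Longrightarrow> wt \<Theta> \<phi> T' \<Longrightarrow> T = T'"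
proof (induction arbitrary: T' rule: wt.induct)
  case (wt_App \<Theta> \<phi> U T \<psi>)
  obtain V where "wt \<Theta> \<phi> (Arr (TyF V) T')" using wt_App.prems by (auto simp only: wt_simps)
  then show ?case using wt_App.IH(1) by blast
next
  case (wt_AppT \<Theta> \<phi> T t)
  have "wt \<Theta> \<phi> (Arr TyN T')" using wt_AppT.prems by (auto simp only: wt_simps)
  then show ?case using wt_AppT.IH by blast
next
  case (wt_Lam A \<Theta> \<phi> T)
  obtain V where "T' = Arr A V" "wt (A # \<Theta>) \<phi> V" using wt_Lam.prems by (auto simp only: wt_simps)
  then show ?case using wt_Lam.IH by blast
qed (simp_all only: wt_simps, simp)

lemma wt_tm_append: "wt_tm \<Theta> t \<Longrightarrow> wt_tm (\<Theta> @ \<Theta>') t"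
  by (induction t) (auto simp: nth_append)

lemma wt_append: "wt \<Theta> \<phi> T \<Longrightarrow> wt (\<Theta> @ \<Theta>') \<phi> T"
  by (induction rule: wt.induct) (auto simp: wt_simps wt_tm_append nth_append)

text \<open>A coding is adequate only for the types of the given proof. Adequacy is demanded where a
  type enters, at variables and abstractions; the other rules pass it on, see
  \<open>awt_adequate\<close>.\<close>

inductive awt :: "'v coding \<Rightarrow> aty list \<Rightarrow> 'a fm \<Rightarrow> fty \<Rightarrow> bool" for C where
  "wt_tm \<Theta> s \<Longrightarrow> wt_tm \<Theta> t \<Longrightarrow> awt C \<Theta> (Eq s t) Omega"
| "awt C \<Theta> \<phi> Omega \<Longrightarrow> awt C \<Theta> \<psi> Omega \<Longrightarrow> awt C \<Theta> (Or \<phi> \<psi>) Omega"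
| "awt C \<Theta> \<phi> Omega \<Longrightarrow> awt C \<Theta> \<psi> Omega \<Longrightarrow> awt C \<Theta> (And \<phi> \<psi>) Omega"
| "i < length \<Theta> \<Longrightarrow> \<Theta> ! i = TyF T \<Longrightarrow> adequate C T \<Longrightarrow> awt C \<Theta> (Bd i) T"
| "adequate C T \<Longrightarrow> awt C \<Theta> (Fr x T) T"
| "awt C (A # \<Theta>) \<phi> T \<Longrightarrow> adequate C (Arr A T) \<Longrightarrow> awt C \<Theta> (Lam A \<phi>) (Arr A T)"
| "awt C \<Theta> \<phi> (Arr (TyF U) T) \<Longrightarrow> awt C \<Theta> \<psi> U \<Longrightarrow> awt C \<Theta> (App \<phi> \<psi>) T"
| "awt C \<Theta> \<phi> (Arr TyN T) \<Longrightarrow> wt_tm \<Theta> t \<Longrightarrow> awt C \<Theta> (AppT \<phi> t) T"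
| "awt C (TyF T # \<Theta>) \<phi> T \<Longrightarrow> awt C \<Theta> (Fix \<sigma> p T \<phi>) T"

inductive_simps awt_simps:
  "awt C \<Theta> (Eq s t) T" "awt C \<Theta> (Or \<phi> \<psi>) T" "awt C \<Theta> (And \<phi> \<psi>) T" "awt C \<Theta> (Bd i) T"
  "awt C \<Theta> (Fr x U) T" "awt C \<Theta> (Lam A \<phi>) T" "awt C \<Theta> (App \<phi> \<psi>) T" "awt C \<Theta> (AppT \<phi> t) T"
  "awt C \<Theta> (Fix \<sigma> p U \<phi>) T"

lemma awt_adequate: "awt C \<Theta> \<phi> T \<Longrightarrow> adequate C T"
  by (induction rule: awt.induct) auto

lemma awt_wt: "awt C \<Theta> \<phi> T \<Longrightarrow> wt \<Theta> \<phi> T"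
  by (induction rule: awt.induct) (auto simp: wt_simps)

lemma awt_map_fm [simp]: "awt C \<Theta> (map_fm f \<phi>) T = awt C \<Theta> \<phi> T"
  by (induction \<phi> arbitrary: \<Theta> T) (auto simp: awt_simps)

lemma awt_erase [simp]: "awt C \<Theta> (erase \<phi>) T = awt C \<Theta> \<phi> T"
  by (simp add: erase_def)

lemma self_in_subforms: "(\<Theta>, \<phi>) \<in> subforms \<Theta> \<phi>"
  by (cases \<phi>) auto

lemma awt_of_wt:
  "\<lbrakk>wt \<Theta> \<phi> T; \<And>\<Theta>' \<psi> U. (\<Theta>', \<psi>) \<in> subforms \<Theta> \<phi> \<Longrightarrow> wt \<Theta>' \<psi> U \<Longrightarrow> adequate C U\<rbrakk> \<Longrightarrow> awt C \<Theta> \<phi> T"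
proof (induction rule: wt.induct)
  case (wt_Lam A \<Theta> \<phi> T)
  have "adequate C (Arr A T)" using wt_Lam.prems[OF self_in_subforms] wt.wt_Lam[OF wt_Lam.hyps] by blast
  moreover have "awt C (A # \<Theta>) \<phi> T" using wt_Lam.prems by (intro wt_Lam.IH) auto
  ultimately show ?case by (simp add: awt_simps)
next
  case (wt_App \<Theta> \<phi> U T \<psi>)
  have "awt C \<Theta> \<phi> (Arr (TyF U) T)" using wt_App.prems by (intro wt_App.IH) auto
  moreover have "awt C \<Theta> \<psi> U" using wt_App.prems by (intro wt_App.IH) auto
  ultimately show ?case by (auto simp: awt_simps)
qed (auto simp: awt_simps wt_simps)

lemma awt_append: "awt C \<Theta> \<phi> T \<Longrightarrow> awt C (\<Theta> @ \<Theta>') \<phi> T"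
  by (induction rule: awt.induct) (auto simp: awt_simps wt_tm_append nth_append)

text \<open>Copies of a closed formula stand under binders of the surrounding one. By uniqueness of
  types the longer context assigns the same types, so the adequacy found there holds in the shorter
  context.\<close>

lemma awt_strengthen: "wt \<Theta> \<phi> T \<Longrightarrow> awt C (\<Theta> @ \<Theta>') \<phi> U \<Longrightarrow> awt C \<Theta> \<phi> T"
proof (induction arbitrary: U rule: wt.induct)
  case (wt_Lam A \<Theta> \<phi> T)
  then obtain V where V: "awt C (A # \<Theta> @ \<Theta>') \<phi> V" "adequate C (Arr A V)" by (auto simp: awt_simps)
  have "V = T" using wt_unique[OF awt_wt[OF V(1)]] wt_append[OF wt_Lam.hyps] by simp
  then show ?case using V wt_Lam.IH[of V] by (simp add: awt_simps)
next
  case (wt_Fix T \<Theta> \<phi> \<sigma> p)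
  then show ?case by (auto simp: awt_simps)
next
  case (wt_App \<Theta> \<phi> V T \<psi>)
  obtain W where "awt C (\<Theta> @ \<Theta>') \<phi> (Arr (TyF W) U)" "awt C (\<Theta> @ \<Theta>') \<psi> W"
    using wt_App.prems by (auto simp only: awt_simps)
  then have "awt C \<Theta> \<phi> (Arr (TyF V) T)" "awt C \<Theta> \<psi> V" using wt_App.IH by blast+
  then show ?case by (auto simp only: awt_simps)
next
  case (wt_AppT \<Theta> \<phi> T t)
  have "awt C \<Theta> \<phi> (Arr TyN T)" using wt_AppT.prems wt_AppT.IH by (simp only: awt_simps) blast
  then show ?case using wt_AppT.hyps by (simp only: awt_simps)
next
  case (wt_Bd i \<Theta> T)
  then show ?case by (auto simp: awt_simps nth_append)
next
  case (wt_Fr \<Theta> x T)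
  then show ?case by (auto simp: awt_simps)
qed (auto simp: awt_simps)

lemma awt_msubst:
  "\<lbrakk>awt C \<Theta> \<phi> U; \<And>j. j < nocc x T \<phi> \<Longrightarrow> awt C [] (\<xi> j) T\<rbrakk> \<Longrightarrow> awt C \<Theta> (msubst x T \<xi> \<phi>) U"
proof (induction \<phi> arbitrary: \<Theta> U \<xi>)
  case (Fr y V)
  then show ?case using awt_append[of C "[]" "\<xi> 0" T \<Theta>] by (auto simp: awt_simps split: if_splits)
next
  case (App \<phi> \<psi>)
  then obtain V where "awt C \<Theta> \<phi> (Arr (TyF V) U)" "awt C \<Theta> \<psi> V"
    by (auto simp only: awt_simps)
  then have "awt C \<Theta> (msubst x T \<xi> \<phi>) (Arr (TyF V) U)"
    "awt C \<Theta> (msubst x T (\<lambda>j. \<xi> (nocc x T \<phi> + j)) \<psi>) V"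
    using App.IH(1)[of \<Theta> "Arr (TyF V) U" \<xi>] App.IH(2)[of \<Theta> V "\<lambda>j. \<xi> (nocc x T \<phi> + j)"] App.prems(2)
    by simp_all
  then show ?case by (auto simp: awt_simps)
qed (auto simp: awt_simps)

text \<open>The conclusion of a rule contains the substituted formula, which is where adequacy is
  known. It passes to \<open>\<phi>\<close>, since an occurrence of \<open>x\<close> has the type of
  its copy, and to \<open>\<psi>\<close> as soon as there is a copy.\<close>

lemma awt_msubst_inv:
  assumes "awt C \<Theta> (msubst x T (\<lambda>_. \<psi>) \<phi>) U" "wt \<Theta> \<phi> U" "wt [] \<psi> T"
  shows "awt C \<Theta> \<phi> U" "0 < nocc x T \<phi> \<Longrightarrow> awt C [] \<psi> T"
proof -
  have "awt C \<Theta> \<phi> U \<and> (0 < nocc x T \<phi> \<longrightarrow> awt C [] \<psi> T)"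
    using assms(1,2)
  proof (induction \<phi> arbitrary: \<Theta> U)
    case (Fr y V)
    show ?case
    proof (cases "y = x \<and> V = T")
      case True
      then have "awt C [] \<psi> T" using Fr awt_strengthen[OF assms(3), of C \<Theta> U] by simp
      then show ?thesis using True Fr awt_adequate by (auto simp: wt_simps awt_simps)
    next
      case False
      then show ?thesis using Fr by auto
    qed
  next
    case (App \<phi> \<chi>)
    from App.prems(2) obtain V where V: "wt \<Theta> \<phi> (Arr (TyF V) U)" "wt \<Theta> \<chi> V" by (auto simp: wt_simps)
    \<comment> \<open>The application rule hides the argument type; plain typing of the substituted
      argument shows that it is still \<open>V\<close>.\<close>
    have w: "wt \<Theta> (msubst x T (\<lambda>_. \<psi>) \<chi>) V" if "wt \<Theta> \<chi> V" for \<Theta> V \<chi>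
      using that
    proof (induction \<chi> arbitrary: \<Theta> V)
      case (Fr y W)
      then show ?case using wt_append[OF assms(3), of \<Theta>] by (auto simp: wt_simps)
    next
      case (App \<chi>1 \<chi>2)
      obtain W where "wt \<Theta> \<chi>1 (Arr (TyF W) V)" "wt \<Theta> \<chi>2 W"
        using App.prems by (auto simp only: wt_simps)
      then have "wt \<Theta> (msubst x T (\<lambda>_. \<psi>) \<chi>1) (Arr (TyF W) V)" "wt \<Theta> (msubst x T (\<lambda>_. \<psi>) \<chi>2) W"
        using App.IH by blast+
      then show ?case by (auto simp: wt_simps)
    qed (auto simp: wt_simps)
    from App.prems(1) obtain W where W: "awt C \<Theta> (msubst x T (\<lambda>_. \<psi>) \<phi>) (Arr (TyF W) U)"
      "awt C \<Theta> (msubst x T (\<lambda>_. \<psi>) \<chi>) W" by (auto simp: awt_simps)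
    have "V = W" using wt_unique[OF awt_wt[OF W(2)] w[OF V(2)]] by simp
    then show ?case using App.IH(1)[OF W(1)] App.IH(2)[OF W(2)] V by (auto simp: awt_simps)
  next
    case (AppT \<phi> t)
    then show ?case by (auto simp: awt_simps wt_simps)
  next
    case (Lam A \<phi>)
    then show ?case by (auto simp: awt_simps wt_simps)
  qed (auto simp: awt_simps wt_simps)
  then show "awt C \<Theta> \<phi> U" "0 < nocc x T \<phi> \<Longrightarrow> awt C [] \<psi> T" by auto
qed

section \<open>Values of formulas whose fixed points are cut off at stages\<close>

section \<open>Evaluation with approximants\<close>

primrec aeval :: "'v coding \<Rightarrow> (nat \<Rightarrow> aty \<Rightarrow> 'v val) \<Rightarrow> 'v val list \<Rightarrow> 'v ord option fm \<Rightarrow> 'v val"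
where
  "aeval C \<rho> ds (Eq s t) = VB (eval_tm \<rho> ds s = eval_tm \<rho> ds t)"
| "aeval C \<rho> ds (Or \<phi> \<psi>) = VB (truth (aeval C \<rho> ds \<phi>) \<or> truth (aeval C \<rho> ds \<psi>))"
| "aeval C \<rho> ds (And \<phi> \<psi>) = VB (truth (aeval C \<rho> ds \<phi>) \<and> truth (aeval C \<rho> ds \<psi>))"
| "aeval C \<rho> ds (Bd i) = ds ! i"
| "aeval C \<rho> ds (Fr x T) = \<rho> x (TyF T)"
| "aeval C \<rho> ds (Lam A \<phi>) = VF (enc C (restr (domA C A) (\<lambda>d. aeval C \<rho> (d # ds) \<phi>)))"
| "aeval C \<rho> ds (App \<phi> \<psi>) = app C (aeval C \<rho> ds \<phi>) (aeval C \<rho> ds \<psi>)"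
| "aeval C \<rho> ds (AppT \<phi> t) = app C (aeval C \<rho> ds \<phi>) (eval_tm \<rho> ds t)"
| "aeval C \<rho> ds (Fix \<sigma> p T \<phi>) = fpv C \<sigma> T (\<lambda>d. aeval C \<rho> (d # ds) \<phi>) p"

definition exact :: "'a fm \<Rightarrow> 'v ord option fm" where
  "exact \<phi> = map_fm (\<lambda>_. None) \<phi>"

lemma aeval_exact: "aeval C \<rho> ds (exact \<phi>) = eval C \<rho> ds \<phi>"
  unfolding exact_def by (induction \<phi> arbitrary: ds) (simp_all add: fpv_def)

lemma erase_exact [simp]: "erase (exact \<phi>) = erase \<phi>"
  by (simp add: exact_def erase_def fm.map_comp comp_def)

lemma erase_form [simp]: "erase (\<phi> :: form) = \<phi>"
  unfolding erase_def by (induction \<phi>) auto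

lemma awt_exact [simp]: "awt C \<Theta> (exact \<phi>) T = awt C \<Theta> \<phi> T"
  by (simp add: exact_def)

lemma anns_exact: "anns \<sigma> (exact \<phi>) \<subseteq> {None}"
  by (auto simp: exact_def)

text \<open>All variables are constrained, not just those of one sequent, since a premise may bring
  in new ones, as in (Cut). By \<open>domA_nonempty\<close> a valuation can be extended
  accordingly.\<close>

definition good :: "'v coding \<Rightarrow> (nat \<Rightarrow> aty \<Rightarrow> 'v val) \<Rightarrow> bool" where
  "good C \<rho> \<longleftrightarrow> (\<forall>x A. \<rho> x A \<in> domA C A)"

definition env :: "'v coding \<Rightarrow> aty list \<Rightarrow> 'v val list \<Rightarrow> bool" where
  "env C \<Theta> ds \<longleftrightarrow> list_all2 (\<lambda>A d. d \<in> domA C A) \<Theta> ds"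

definition le_env :: "'v coding \<Rightarrow> aty list \<Rightarrow> 'v val list \<Rightarrow> 'v val list \<Rightarrow> bool" where
  "le_env C \<Theta> ds ds' \<longleftrightarrow> (\<forall>i<length \<Theta>. leA C (\<Theta> ! i) (ds ! i) (ds' ! i))"

lemma env_simps [simp]: "env C [] []" "env C (A # \<Theta>) (d # ds) \<longleftrightarrow> d \<in> domA C A \<and> env C \<Theta> ds"
  by (auto simp: env_def)

lemma le_env_refl [simp]: "le_env C \<Theta> ds ds"
  by (simp add: le_env_def)

lemma le_env_Cons [simp]:
  "le_env C (A # \<Theta>) (d # ds) (d' # ds') \<longleftrightarrow> leA C A d d' \<and> le_env C \<Theta> ds ds'"
  unfolding le_env_def by (auto simp: less_Suc_eq_0_disj nth_Cons split: nat.splits)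

lemma env_nth: "\<lbrakk>env C \<Theta> ds; i < length \<Theta>\<rbrakk> \<Longrightarrow> ds ! i \<in> domA C (\<Theta> ! i)"
  by (auto simp: env_def list_all2_conv_all_nth)

lemma eval_tm_in: "\<lbrakk>wt_tm \<Theta> t; good C \<rho>; env C \<Theta> ds\<rbrakk> \<Longrightarrow> eval_tm \<rho> ds t \<in> range VN"
proof (induction t)
  case (TBd i)
  then show ?case using env_nth[of C \<Theta> ds i] by auto
next
  case (TFr x)
  have "\<rho> x TyN \<in> domA C TyN" using TFr by (simp only: good_def)
  then show ?case by simp
qed auto

lemma eval_tm_le_env: "\<lbrakk>wt_tm \<Theta> t; le_env C \<Theta> ds ds'\<rbrakk> \<Longrightarrow> eval_tm \<rho> ds t = eval_tm \<rho> ds' t"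
  by (induction t) (auto simp: le_env_def dest!: spec)

text \<open>Membership and monotonicity need each other: an abstraction denotes an element of its
  domain, and a fixed point exists, because the body is monotone.\<close>

lemma aeval_in_mono:
  assumes "good C \<rho>"
  shows "awt C \<Theta> \<phi> T \<Longrightarrow> env C \<Theta> ds \<Longrightarrow> env C \<Theta> ds' \<Longrightarrow> le_env C \<Theta> ds ds' \<Longrightarrow>
    aeval C \<rho> ds \<phi> \<in> domF C T \<and> leF C T (aeval C \<rho> ds \<phi>) (aeval C \<rho> ds' \<phi>)"
proof (induction arbitrary: ds ds' rule: awt.induct)
  case (1 \<Theta> s t)
  then show ?case using eval_tm_le_env[of \<Theta> _ C ds ds' \<rho>] by simp
next
  case (4 i \<Theta> T)
  then show ?case using env_nth[of C \<Theta> ds i] by (auto simp: le_env_def dest!: spec[of _ i])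
next
  case (5 T \<Theta> x)
  have "\<rho> x (TyF T) \<in> domA C (TyF T)" using assms by (simp only: good_def)
  then show ?case by simp
next
  case (6 A \<Theta> \<phi> T)
  have F: "restr (domA C A) (\<lambda>d. aeval C \<rho> (d # es) \<phi>) \<in> mfuns C A T" if "env C \<Theta> es" for es
  proof (rule mono_funsI)
    show "leF C T (restr (domA C A) (\<lambda>d. aeval C \<rho> (d # es) \<phi>) x)
      (restr (domA C A) (\<lambda>d. aeval C \<rho> (d # es) \<phi>) y)"
      if "x \<in> domA C A" "y \<in> domA C A" "leA C A x y" for x y
      using 6(3)[of "x # es" "y # es"] that \<open>env C \<Theta> es\<close> by (simp add: restr_def)
    show "restr (domA C A) (\<lambda>d. aeval C \<rho> (d # es) \<phi>) x \<in> domF C T" if "x \<in> domA C A" for x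
      using 6(3)[of "x # es" "x # es"] that \<open>env C \<Theta> es\<close> by (simp add: restr_def)
  qed (simp add: restr_def)
  have "leF C T (aeval C \<rho> (d # ds) \<phi>) (aeval C \<rho> (d # ds') \<phi>)" if "d \<in> domA C A" for d
    using 6(3)[of "d # ds" "d # ds'"] that 6 by simp
  then show ?case using F 6(4,5) app_VF[OF 6(2)] by (auto simp: restr_def)
next
  case (7 \<Theta> \<phi> U T \<psi>)
  have ad: "adequate C (Arr (TyF U) T)" "adequate C T" using awt_adequate[OF 7(1)] by auto
  note f = 7(3)[OF 7(5,6,7)] and a = 7(4)[OF 7(5,6,7)]
  note f' = 7(3)[OF 7(6,6) le_env_refl] and a' = 7(4)[OF 7(6,6) le_env_refl]
  have 1: "leF C T (app C (aeval C \<rho> ds \<phi>) (aeval C \<rho> ds \<psi>)) (app C (aeval C \<rho> ds \<phi>) (aeval C \<rho> ds' \<psi>))"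
    using app_mono[OF ad(1)] f a a' by simp
  have 2: "leF C T (app C (aeval C \<rho> ds \<phi>) (aeval C \<rho> ds' \<psi>)) (app C (aeval C \<rho> ds' \<phi>) (aeval C \<rho> ds' \<psi>))"
    using f a' by simp
  have i: "app C (aeval C \<rho> ds \<phi>) (aeval C \<rho> ds \<psi>) \<in> domF C T"
    "app C (aeval C \<rho> ds \<phi>) (aeval C \<rho> ds' \<psi>) \<in> domF C T"
    "app C (aeval C \<rho> ds' \<phi>) (aeval C \<rho> ds' \<psi>) \<in> domF C T"
    using app_in[OF ad(1)] f a f' a' by simp_all
  show ?case using leF_trans[OF ad(2) i 1 2] i by simp
next
  case (8 \<Theta> \<phi> T t)
  have ad: "adequate C (Arr TyN T)" using awt_adequate[OF 8(1)] by auto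
  have t: "eval_tm \<rho> ds t \<in> domA C TyN" using eval_tm_in[OF 8(2) assms 8(4)] by simp
  have t': "eval_tm \<rho> ds' t = eval_tm \<rho> ds t" using eval_tm_le_env[OF 8(2,6)] by simp
  show ?case using 8(3)[OF 8(4-6)] app_in[OF ad _ t] t by (auto simp: t')
next
  case (9 T \<Theta> \<phi> \<sigma> p)
  have ad: "adequate C T" using awt_adequate[OF 9(1)] .
  have F: "mfun C T (\<lambda>d. aeval C \<rho> (d # es) \<phi>)" if "env C \<Theta> es" for es
    unfolding mfun_def using 9(2)[of "_ # es" "_ # es"] that by auto
  have "leF C T (aeval C \<rho> (d # ds) \<phi>) (aeval C \<rho> (d # ds') \<phi>)" if "d \<in> domF C T" for d
    using 9(2)[of "d # ds" "d # ds'"] that 9 by simp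
  then show ?case using fpv_in[OF ad F] fpv_mono[OF ad F F, of ds ds' p p] 9 by simp
qed auto

lemma aeval_in: "\<lbrakk>good C \<rho>; awt C \<Theta> \<phi> T; env C \<Theta> ds\<rbrakk> \<Longrightarrow> aeval C \<rho> ds \<phi> \<in> domF C T"
  using aeval_in_mono[of C \<rho> \<Theta> \<phi> T ds ds] by simp

lemma aeval_mono:
  "\<lbrakk>good C \<rho>; awt C \<Theta> \<phi> T; env C \<Theta> ds; env C \<Theta> ds'; le_env C \<Theta> ds ds'\<rbrakk>
    \<Longrightarrow> leF C T (aeval C \<rho> ds \<phi>) (aeval C \<rho> ds' \<phi>)"
  using aeval_in_mono by blast

lemma mfun_aeval:
  assumes "good C \<rho>" "awt C (TyF T # \<Theta>) \<phi> T" "env C \<Theta> ds"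
  shows "mfun C T (\<lambda>d. aeval C \<rho> (d # ds) \<phi>)"
  unfolding mfun_def
  using aeval_in[OF assms(1,2), of "_ # ds"] aeval_mono[OF assms(1,2), of "_ # ds" "_ # ds"] assms(3)
  by auto

lemma app_aeval_Lam:
  assumes "good C \<rho>" "awt C \<Theta> (Lam A \<phi>) U" "env C \<Theta> ds" "d \<in> domA C A"
  shows "app C (aeval C \<rho> ds (Lam A \<phi>)) d = aeval C \<rho> (d # ds) \<phi>"
proof -
  obtain T where T: "awt C (A # \<Theta>) \<phi> T" "adequate C (Arr A T)" using assms(2) by (auto simp: awt_simps)
  have "restr (domA C A) (\<lambda>d. aeval C \<rho> (d # ds) \<phi>) \<in> mfuns C A T"
    using aeval_in[OF assms(1) T(1), of "_ # ds"] aeval_mono[OF assms(1) T(1), of "_ # ds" "_ # ds"] assms(3)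
    by (intro mono_funsI) (auto simp: restr_def)
  then show ?thesis using app_VF[OF T(2)] assms(4) by (simp add: restr_def)
qed

subsection \<open>Substitution\<close>

lemma eval_tm_append: "\<lbrakk>wt_tm \<Theta> t; length ds = length \<Theta>\<rbrakk> \<Longrightarrow> eval_tm \<rho> (ds @ ds') t = eval_tm \<rho> ds t"
  by (induction t) (auto simp: nth_append)

lemma aeval_append:
  "\<lbrakk>wt \<Theta> \<phi> T; length ds = length \<Theta>\<rbrakk> \<Longrightarrow> aeval C \<rho> (ds @ ds') \<phi> = aeval C \<rho> ds \<phi>"
proof (induction arbitrary: ds rule: wt.induct)
  case (wt_Lam A \<Theta> \<phi> T)
  have "aeval C \<rho> (d # ds @ ds') \<phi> = aeval C \<rho> (d # ds) \<phi>" for d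
    using wt_Lam.IH[of "d # ds"] wt_Lam.prems by simp
  then show ?case by simp
next
  case (wt_Fix T \<Theta> \<phi> \<sigma> p)
  have "aeval C \<rho> (d # ds @ ds') \<phi> = aeval C \<rho> (d # ds) \<phi>" for d
    using wt_Fix.IH[of "d # ds"] wt_Fix.prems by simp
  then show ?case by simp
qed (auto simp: eval_tm_append nth_append)

lemma aeval_closed: "wt [] \<phi> T \<Longrightarrow> aeval C \<rho> ds \<phi> = aeval C \<rho> [] \<phi>"
  using aeval_append[of "[]" \<phi> T "[]" C \<rho> ds] by simp

lemma eval_tm_closed: "wt_tm [] t \<Longrightarrow> eval_tm \<rho> ds t = eval_tm \<rho> [] t"
  using eval_tm_append[of "[]" t "[]" \<rho> ds] by simp

lemma eval_tm_cong: "(\<And>x. (x, TyN) \<in> fv_tm t \<Longrightarrow> \<rho> x TyN = \<rho>' x TyN) \<Longrightarrow> eval_tm \<rho> ds t = eval_tm \<rho>' ds t"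
  by (induction t) auto

lemma aeval_cong:
  "(\<And>x A. (x, A) \<in> fv \<phi> \<Longrightarrow> \<rho> x A = \<rho>' x A) \<Longrightarrow> aeval C \<rho> ds \<phi> = aeval C \<rho>' ds \<phi>"
proof (induction \<phi> arbitrary: ds)
  case (Eq s t)
  then show ?case using eval_tm_cong[of s \<rho> \<rho>'] eval_tm_cong[of t \<rho> \<rho>'] by simp
next
  case (AppT \<phi> t)
  then show ?case using eval_tm_cong[of t \<rho> \<rho>'] by simp
next
  case (Or \<phi> \<psi>)
  show ?case using Or.IH Or.prems by simp
next
  case (And \<phi> \<psi>)
  show ?case using And.IH And.prems by simp
next
  case (App \<phi> \<psi>)
  show ?case using App.IH App.prems by simp
next
  case (Lam A \<phi>)
  show ?case using Lam.IH Lam.prems by simp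
next
  case (Fix \<sigma> p T \<phi>)
  show ?case using Fix.IH Fix.prems by simp
qed auto

lemma eval_tm_open:
  "\<lbrakk>wt_tm (\<Theta> @ [A]) t; length ds = length \<Theta>; wt_tm [] u\<rbrakk> \<Longrightarrow>
    eval_tm \<rho> ds (open_tm (length \<Theta>) u t) = eval_tm \<rho> (ds @ [eval_tm \<rho> [] u]) t"
  by (induction t) (auto simp: nth_append eval_tm_closed[of u \<rho> ds])

text \<open>The opened index is the outermost one, hence the last entry of the value list; the
  closed term \<open>u\<close> has the same value under all binders.\<close>

lemma aeval_openT:
  "\<lbrakk>wt \<Theta>' \<phi> T; \<Theta>' = \<Theta> @ [TyN]; length ds = length \<Theta>; wt_tm [] u\<rbrakk> \<Longrightarrow>
    aeval C \<rho> ds (openT (length \<Theta>) u \<phi>) = aeval C \<rho> (ds @ [eval_tm \<rho> [] u]) \<phi>"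
proof (induction arbitrary: \<Theta> ds rule: wt.induct)
  case (wt_Lam A \<Theta>' \<phi> T)
  have "aeval C \<rho> (d # ds) (openT (Suc (length \<Theta>)) u \<phi>) = aeval C \<rho> (d # ds @ [eval_tm \<rho> [] u]) \<phi>" for d
    using wt_Lam.IH[of "A # \<Theta>" "d # ds"] wt_Lam.prems by simp
  then show ?case by simp
next
  case (wt_Fix T \<Theta>' \<phi> \<sigma> p)
  have "aeval C \<rho> (d # ds) (openT (Suc (length \<Theta>)) u \<phi>) = aeval C \<rho> (d # ds @ [eval_tm \<rho> [] u]) \<phi>" for d
    using wt_Fix.IH[of "TyF T # \<Theta>" "d # ds"] wt_Fix.prems by simp
  then show ?case by simp
next
  case (wt_Bd i \<Theta>' T)
  then show ?case by (auto simp: nth_append split: if_splits)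
qed (auto simp: eval_tm_open)

lemma eval_tm_openF:
  "\<lbrakk>wt_tm (\<Theta> @ [TyF U]) t; length ds = length \<Theta>\<rbrakk> \<Longrightarrow> eval_tm \<rho> (ds @ [v]) t = eval_tm \<rho> ds t"
  by (induction t) (auto simp: nth_append split: if_splits)

lemma aeval_openF:
  "\<lbrakk>wt \<Theta>' \<phi> T; \<Theta>' = \<Theta> @ [TyF U]; length ds = length \<Theta>; wt [] \<chi> U\<rbrakk> \<Longrightarrow>
    aeval C \<rho> ds (openF (length \<Theta>) \<chi> \<phi>) = aeval C \<rho> (ds @ [aeval C \<rho> [] \<chi>]) \<phi>"
proof (induction arbitrary: \<Theta> ds rule: wt.induct)
  case (wt_Lam A \<Theta>' \<phi> T)
  have "aeval C \<rho> (d # ds) (openF (Suc (length \<Theta>)) \<chi> \<phi>) = aeval C \<rho> (d # ds @ [aeval C \<rho> [] \<chi>]) \<phi>" for d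
    using wt_Lam.IH[of "A # \<Theta>" "d # ds"] wt_Lam.prems by simp
  then show ?case by simp
next
  case (wt_Fix T \<Theta>' \<phi> \<sigma> p)
  have "aeval C \<rho> (d # ds) (openF (Suc (length \<Theta>)) \<chi> \<phi>) = aeval C \<rho> (d # ds @ [aeval C \<rho> [] \<chi>]) \<phi>" for d
    using wt_Fix.IH[of "TyF T # \<Theta>" "d # ds"] wt_Fix.prems by simp
  then show ?case by simp
next
  case (wt_Bd i \<Theta>' T)
  then show ?case using aeval_closed[of \<chi> U C \<rho> ds] by (auto simp: nth_append split: if_splits)
qed (auto simp: eval_tm_openF)

lemma eval_tm_subst:
  "(\<And>x. wt_tm [] (\<theta> x)) \<Longrightarrow>
    eval_tm \<rho> ds (subst_tm \<theta> t) = eval_tm (\<lambda>x A. if A = TyN then eval_tm \<rho> [] (\<theta> x) else \<rho> x A) ds t"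
  by (induction t) (auto simp: eval_tm_closed[of _ \<rho> ds])

lemma aeval_substT:
  "(\<And>x. wt_tm [] (\<theta> x)) \<Longrightarrow>
    aeval C \<rho> ds (substT \<theta> \<phi>) = aeval C (\<lambda>x A. if A = TyN then eval_tm \<rho> [] (\<theta> x) else \<rho> x A) ds \<phi>"
  by (induction \<phi> arbitrary: ds) (auto simp: eval_tm_subst)

lemma eval_tm_upd [simp]: "eval_tm (\<rho>(x := (\<rho> x)(TyF T := v))) ds t = eval_tm \<rho> ds t"
  by (induction t) auto

text \<open>With one closed \<open>\<chi>\<close> in all places the substitution is a change of
  valuation; a family of differing copies has no such reading.\<close>

lemma aeval_msubst:
  assumes "wt [] \<chi> T"
  shows "aeval C \<rho> ds (msubst x T (\<lambda>_. \<chi>) \<phi>) = aeval C (\<rho>(x := (\<rho> x)(TyF T := aeval C \<rho> [] \<chi>))) ds \<phi>"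
proof (induction \<phi> arbitrary: ds)
  case (Fr y U)
  then show ?case using aeval_closed[OF assms, of C \<rho> ds] by auto
qed (auto simp del: fun_upd_apply)

subsection \<open>Comparison of annotations\<close>

text \<open>The pairs on \<open>\<gamma>\<close> are the annotations of the lower and the upper
  formula. One induction thus treats differing annotations and differing copies together, as (Mono)
  requires; (Axiom) uses it with the identity substitution, (Subst) with equal annotations.\<close>

lemma aeval_msubst_le:
  fixes \<gamma> :: "('v ord option \<times> 'v ord option) fm"
  assumes \<rho>: "good C \<rho>"
  shows "\<lbrakk>awt C \<Theta> \<gamma> U;
      \<And>j. j < nocc x T \<gamma> \<Longrightarrow> awt C [] (\<xi> j) T \<and> awt C [] (\<xi>' j) T \<and>
        leF C T (aeval C \<rho> [] (\<xi> j)) (aeval C \<rho> [] (\<xi>' j));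
      \<And>p q. (p, q) \<in> anns Mu \<gamma> \<Longrightarrow> p = q \<or> q = None;
      \<And>p q. (p, q) \<in> anns Nu \<gamma> \<Longrightarrow> p = q \<or> p = None; env C \<Theta> ds\<rbrakk> \<Longrightarrow>
    leF C U (aeval C \<rho> ds (msubst x T \<xi> (map_fm fst \<gamma>))) (aeval C \<rho> ds (msubst x T \<xi>' (map_fm snd \<gamma>)))"
proof (induction \<gamma> arbitrary: \<Theta> U \<xi> \<xi>' ds)
  case (Or \<phi> \<psi>)
  have w: "awt C \<Theta> \<phi> Omega" "awt C \<Theta> \<psi> Omega" "U = Omega" using Or.prems(1) by (auto simp: awt_simps)
  show ?case
    using Or.IH(1)[OF w(1), of \<xi> \<xi>' ds] Or.prems w(3)
      Or.IH(2)[OF w(2), of "\<lambda>j. \<xi> (nocc x T \<phi> + j)" "\<lambda>j. \<xi>' (nocc x T \<phi> + j)" ds]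
    by simp
next
  case (And \<phi> \<psi>)
  have w: "awt C \<Theta> \<phi> Omega" "awt C \<Theta> \<psi> Omega" "U = Omega" using And.prems(1) by (auto simp: awt_simps)
  show ?case
    using And.IH(1)[OF w(1), of \<xi> \<xi>' ds] And.prems w(3)
      And.IH(2)[OF w(2), of "\<lambda>j. \<xi> (nocc x T \<phi> + j)" "\<lambda>j. \<xi>' (nocc x T \<phi> + j)" ds]
    by simp
next
  case (Fr y V)
  show ?case
  proof (cases "y = x \<and> V = T")
    case True
    then have "U = T" using Fr.prems(1) by (simp add: awt_simps)
    moreover have "aeval C \<rho> ds (\<xi> 0) = aeval C \<rho> [] (\<xi> 0)" "aeval C \<rho> ds (\<xi>' 0) = aeval C \<rho> [] (\<xi>' 0)"
      using Fr.prems(2)[of 0] True by (auto intro!: aeval_closed awt_wt)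
    ultimately show ?thesis using Fr.prems(2)[of 0] True by simp
  next
    case False
    then show ?thesis by auto
  qed
next
  case (Lam A \<phi>)
  obtain V where V: "awt C (A # \<Theta>) \<phi> V" "U = Arr A V" "adequate C (Arr A V)"
    using Lam.prems(1) unfolding awt_simps by (metis adequate.simps(2))
  have w: "awt C \<Theta> (Lam A (msubst x T \<xi> (map_fm fst \<phi>))) (Arr A V)"
    "awt C \<Theta> (Lam A (msubst x T \<xi>' (map_fm snd \<phi>))) (Arr A V)"
    using Lam.prems(2) V unfolding awt_simps by (auto intro!: awt_msubst)
  have "leF C V (aeval C \<rho> (d # ds) (msubst x T \<xi> (map_fm fst \<phi>)))
     (aeval C \<rho> (d # ds) (msubst x T \<xi>' (map_fm snd \<phi>)))" if "d \<in> domA C A" for d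
    using Lam.IH[OF V(1), of \<xi> \<xi>' "d # ds"] Lam.prems that by simp
  then have "leF C V (app C (aeval C \<rho> ds (Lam A (msubst x T \<xi> (map_fm fst \<phi>)))) d)
     (app C (aeval C \<rho> ds (Lam A (msubst x T \<xi>' (map_fm snd \<phi>)))) d)" if "d \<in> domA C A" for d
    using app_aeval_Lam[OF \<rho> w(1) Lam.prems(5) that] app_aeval_Lam[OF \<rho> w(2) Lam.prems(5) that] that
    by simp
  then show ?case unfolding V(2) by simp
next
  case (App \<phi> \<psi>)
  let ?\<xi> = "\<lambda>j. \<xi> (nocc x T \<phi> + j)" and ?\<xi>' = "\<lambda>j. \<xi>' (nocc x T \<phi> + j)"
  obtain V where V: "awt C \<Theta> \<phi> (Arr (TyF V) U)" "awt C \<Theta> \<psi> V"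
    using App.prems(1) by (auto simp only: awt_simps)
  have ad: "adequate C (Arr (TyF V) U)" "adequate C U" using awt_adequate[OF V(1)] by auto
  let ?f = "aeval C \<rho> ds (msubst x T \<xi> (map_fm fst \<phi>))" and ?f' = "aeval C \<rho> ds (msubst x T \<xi>' (map_fm snd \<phi>))"
  let ?a = "aeval C \<rho> ds (msubst x T ?\<xi> (map_fm fst \<psi>))" and ?a' = "aeval C \<rho> ds (msubst x T ?\<xi>' (map_fm snd \<psi>))"
  have le: "leF C (Arr (TyF V) U) ?f ?f'" "leF C V ?a ?a'"
    using App.IH(1)[OF V(1), of \<xi> \<xi>' ds] App.IH(2)[OF V(2), of ?\<xi> ?\<xi>' ds] App.prems by simp_all
  have i: "?f \<in> domF C (Arr (TyF V) U)" "?f' \<in> domF C (Arr (TyF V) U)"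
    "?a \<in> domA C (TyF V)" "?a' \<in> domA C (TyF V)"
    unfolding domA.simps
    by (rule aeval_in[OF \<rho> awt_msubst App.prems(5)]; use V App.prems(2) in simp)+
  have "leF C U (app C ?f ?a) (app C ?f ?a')" using app_mono[OF ad(1) i(1,3,4)] le(2) by simp
  moreover have "leF C U (app C ?f ?a') (app C ?f' ?a')" using le(1) i(4) by simp
  ultimately have "leF C U (app C ?f ?a) (app C ?f' ?a')"
    using leF_trans[OF ad(2)] app_in[OF ad(1)] i by blast
  then show ?case by simp
next
  case (AppT \<phi> t)
  have V: "awt C \<Theta> \<phi> (Arr TyN U)" "wt_tm \<Theta> t" using AppT.prems(1) by (auto simp only: awt_simps)
  have "leF C (Arr TyN U) (aeval C \<rho> ds (msubst x T \<xi> (map_fm fst \<phi>))) (aeval C \<rho> ds (msubst x T \<xi>' (map_fm snd \<phi>)))"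
    using AppT.IH[OF V(1), of \<xi> \<xi>' ds] AppT.prems by simp
  then show ?case using eval_tm_in[OF V(2) \<rho> AppT.prems(5)] by auto
next
  case (Fix \<sigma> p V \<phi>)
  have w: "awt C (TyF U # \<Theta>) \<phi> U" "V = U" using Fix.prems(1) by (auto simp only: awt_simps)
  have ad: "adequate C U" using awt_adequate[OF w(1)] .
  have m: "mfun C U (\<lambda>d. aeval C \<rho> (d # ds) (msubst x T \<xi> (map_fm fst \<phi>)))"
    "mfun C U (\<lambda>d. aeval C \<rho> (d # ds) (msubst x T \<xi>' (map_fm snd \<phi>)))"
    by (rule mfun_aeval[OF \<rho> awt_msubst Fix.prems(5)]; use w(1) Fix.prems(2) in simp)+
  have "leF C U (aeval C \<rho> (d # ds) (msubst x T \<xi> (map_fm fst \<phi>)))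
     (aeval C \<rho> (d # ds) (msubst x T \<xi>' (map_fm snd \<phi>)))" if "d \<in> domF C U" for d
    using Fix.IH[OF w(1), of \<xi> \<xi>' "d # ds"] Fix.prems that by simp
  moreover have "fst p = snd p \<or> \<sigma> = Mu \<and> snd p = None \<or> \<sigma> = Nu \<and> fst p = None"
    using Fix.prems(3,4)[of "fst p" "snd p"] by (cases \<sigma>) auto
  ultimately have "leF C U (fpv C \<sigma> U (\<lambda>d. aeval C \<rho> (d # ds) (msubst x T \<xi> (map_fm fst \<phi>))) (fst p))
      (fpv C \<sigma> U (\<lambda>d. aeval C \<rho> (d # ds) (msubst x T \<xi>' (map_fm snd \<phi>))) (snd p))"
    by (rule fpv_mono[OF ad m])
  then show ?case using w by simp
qed (auto simp: awt_simps)

section \<open>Redexes and fixed points applied to argument lists\<close>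

subsection \<open>Applications\<close>

fun aval :: "'v coding \<Rightarrow> (nat \<Rightarrow> aty \<Rightarrow> 'v val) \<Rightarrow> 'v ord option arg \<Rightarrow> 'v val" where
  "aval C \<rho> (ArgF \<phi>) = aeval C \<rho> [] \<phi>"
| "aval C \<rho> (ArgT t) = eval_tm \<rho> [] t"

fun awt_arg :: "'v coding \<Rightarrow> aty \<Rightarrow> 'a arg \<Rightarrow> bool" where
  "awt_arg C (TyF T) (ArgF \<phi>) \<longleftrightarrow> awt C [] \<phi> T"
| "awt_arg C TyN (ArgT t) \<longleftrightarrow> wt_tm [] t"
| "awt_arg C _ _ \<longleftrightarrow> False"

lemma awt_app1: "awt C [] (app1 \<phi> e) T \<longleftrightarrow> (\<exists>A. awt C [] \<phi> (Arr A T) \<and> awt_arg C A e)"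
proof
  assume "awt C [] (app1 \<phi> e) T"
  then show "\<exists>A. awt C [] \<phi> (Arr A T) \<and> awt_arg C A e"
    by (cases e) (force simp: awt_simps)+
next
  assume "\<exists>A. awt C [] \<phi> (Arr A T) \<and> awt_arg C A e"
  then obtain A where "awt C [] \<phi> (Arr A T)" "awt_arg C A e" by blast
  then show "awt C [] (app1 \<phi> e) T"
    by (cases e; cases A) (auto simp: awt_simps)
qed

lemma aval_in: "\<lbrakk>good C \<rho>; awt_arg C A e\<rbrakk> \<Longrightarrow> aval C \<rho> e \<in> domA C A"
  using eval_tm_in[of "[]" _ C \<rho> "[]"] aeval_in[of C \<rho> "[]" _ _ "[]"]
  by (cases e; cases A) auto

lemma aeval_app1: "aeval C \<rho> [] (app1 \<phi> e) = app C (aeval C \<rho> [] \<phi>) (aval C \<rho> e)"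
  by (cases e) auto

lemma aeval_apps: "aeval C \<rho> [] (apps \<phi> es) = appsv C (aeval C \<rho> [] \<phi>) (map (aval C \<rho>) es)"
  by (induction es arbitrary: \<phi>) (auto simp: aeval_app1)

lemma awt_apps_spine:
  assumes "good C \<rho>"
  shows "awt C [] (apps \<phi> es) Omega \<Longrightarrow> \<exists>T. awt C [] \<phi> T \<and> spine C T (map (aval C \<rho>) es)"
proof (induction es arbitrary: \<phi>)
  case Nil
  then show ?case by (intro exI[of _ Omega]) auto
next
  case (Cons e es)
  then obtain T where T: "awt C [] (app1 \<phi> e) T" "spine C T (map (aval C \<rho>) es)" by auto
  then obtain A where "awt C [] \<phi> (Arr A T)" "awt_arg C A e" by (auto simp: awt_app1)
  then show ?case using T aval_in[OF assms] by (intro exI[of _ "Arr A T"]) auto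
qed

lemma aeval_opn:
  assumes "awt C [A] \<phi> T" "awt_arg C A e"
  shows "aeval C \<rho> [] (opn \<phi> e) = aeval C \<rho> [aval C \<rho> e] \<phi>"
proof (cases e)
  case (ArgF \<chi>)
  then obtain U where "A = TyF U" "awt C [] \<chi> U" using assms(2) by (cases A) auto
  then show ?thesis using ArgF aeval_openF[OF awt_wt[OF assms(1)], of "[]" U "[]" \<chi> C \<rho>] awt_wt by auto
next
  case (ArgT t)
  then have "A = TyN" "wt_tm [] t" using assms(2) by (cases A; simp)+
  then show ?thesis using ArgT aeval_openT[OF awt_wt[OF assms(1)], of "[]" "[]" t C \<rho>] by auto
qed

lemma aeval_Beta:
  assumes "good C \<rho>" "awt C [] (apps (Lam A \<phi>) (e # es)) Omega"
  shows "aeval C \<rho> [] (apps (Lam A \<phi>) (e # es)) = aeval C \<rho> [] (apps (opn \<phi> e) es)"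
proof -
  have "awt C [] (apps (app1 (Lam A \<phi>) e) es) Omega" using assms(2) by simp
  then obtain T where "awt C [] (app1 (Lam A \<phi>) e) T" using awt_apps_spine[OF assms(1)] by blast
  then have w: "awt C [] (Lam A \<phi>) (Arr A T)" "awt C [A] \<phi> T" "awt_arg C A e"
    by (auto simp: awt_app1 awt_simps)
  show ?thesis
    using app_aeval_Lam[OF assms(1) w(1), of "[]" "aval C \<rho> e"] aval_in[OF assms(1) w(3)]
      aeval_opn[OF w(2,3), of \<rho>]
    by (simp add: aeval_apps aeval_app1 del: aeval.simps(6))
qed

text \<open>By \<open>fpv_unfold\<close> the value is a bound over the stages in
  \<open>below p\<close>, and \<open>truth_appsv_bound\<close> picks one of them. This serves the
  kind approximated on the given side; the other kind is exact and unfolds by its fixed-point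
  equation.\<close>

lemma aeval_Fix:
  assumes \<rho>: "good C \<rho>" and w: "awt C [] (apps (Fix \<sigma> p T \<phi>) es) Omega"
  shows Fix_descend: "(truth (aeval C \<rho> [] (apps (Fix \<sigma> p T \<phi>) es)) \<longleftrightarrow> \<sigma> = Mu) \<Longrightarrow>
      \<exists>a\<in>below p. truth (aeval C \<rho> [] (apps (opn \<phi> (ArgF (Fix \<sigma> (Some a) T \<phi>))) es)) \<longleftrightarrow> \<sigma> = Mu"
    and Fix_unfold: "p = None \<Longrightarrow>
      aeval C \<rho> [] (apps (Fix \<sigma> p T \<phi>) es) = aeval C \<rho> [] (apps (opn \<phi> (ArgF (Fix \<sigma> None T \<phi>))) es)"
proof -
  let ?f = "\<lambda>d. aeval C \<rho> [d] \<phi>" and ?ds = "map (aval C \<rho>) es"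
  obtain U where "awt C [] (Fix \<sigma> p T \<phi>) U" "spine C U ?ds" using awt_apps_spine[OF \<rho> w] by blast
  then have T: "awt C [TyF T] \<phi> T" "spine C T ?ds" by (auto simp: awt_simps)
  have ad: "adequate C T" using awt_adequate[OF T(1)] .
  have f: "mfun C T ?f" using mfun_aeval[OF \<rho> T(1), of "[]"] by simp
  have "awt C [] (Fix \<sigma> q T \<phi>) T" for q using T(1) by (simp add: awt_simps)
  then have o: "aeval C \<rho> [] (opn \<phi> (ArgF (Fix \<sigma> q T \<phi>))) = ?f (fpv C \<sigma> T ?f q)" for q
    using aeval_opn[OF T(1), of "ArgF (Fix \<sigma> q T \<phi>)" \<rho>] by simp
  have s: "fpv C \<sigma> T ?f (Some a) = approx C \<sigma> T ?f a" for a by (simp add: fpv_def)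
  have X: "(\<lambda>b. ?f (approx C \<sigma> T ?f b)) ` below p \<subseteq> domF C T"
    using mfun_in[OF f approx_in[OF ad f]] by blast
  show "(truth (aeval C \<rho> [] (apps (Fix \<sigma> p T \<phi>) es)) \<longleftrightarrow> \<sigma> = Mu) \<Longrightarrow>
      \<exists>a\<in>below p. truth (aeval C \<rho> [] (apps (opn \<phi> (ArgF (Fix \<sigma> (Some a) T \<phi>))) es)) \<longleftrightarrow> \<sigma> = Mu"
    unfolding aeval_apps o s using fpv_unfold[OF ad f, of \<sigma> p] truth_appsv_bound[OF ad X T(2), of \<sigma>]
    by simp
  show "aeval C \<rho> [] (apps (Fix \<sigma> p T \<phi>) es) = aeval C \<rho> [] (apps (opn \<phi> (ArgF (Fix \<sigma> None T \<phi>))) es)"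
    if "p = None"
    unfolding aeval_apps o using that by (simp add: fpv_def fixpoint_eq[OF ad f])
qed

lemma aval_var_arg [simp]: "aval C \<rho> (var_arg y) = \<rho> (fst y) (snd y)"
  by (cases y rule: var_arg.cases) auto

text \<open>A premise of (Mono) has type \<open>Omega\<close>, so the types of \<open>ys\<close>
  spell out the type of \<open>\<psi>\<close>.\<close>

lemma wt_apps_var_arg:
  "wt [] (apps \<psi> (map var_arg ys)) Omega \<Longrightarrow> wt [] \<psi> (foldr Arr (map snd ys) Omega)"
proof (induction ys arbitrary: \<psi>)
  case (Cons y ys)
  then have "wt [] (app1 \<psi> (var_arg y)) (foldr Arr (map snd ys) Omega)" by simp
  then show ?case by (cases y rule: var_arg.cases) (auto simp: wt_simps)
qed simp

text \<open>Distinctness of \<open>ys\<close> lets a single valuation assign all the separating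
  arguments.\<close>

lemma not_leF_witness:
  assumes \<rho>: "good C \<rho>" and ys: "distinct ys" "T = foldr Arr (map snd ys) Omega"
    and uv: "adequate C T" "\<not> leF C T u v"
  shows "\<exists>\<rho>'. good C \<rho>' \<and> (\<forall>x A. (x, A) \<notin> set ys \<longrightarrow> \<rho>' x A = \<rho> x A) \<and>
    truth (appsv C u (map (\<lambda>y. \<rho>' (fst y) (snd y)) ys)) \<and>
    \<not> truth (appsv C v (map (\<lambda>y. \<rho>' (fst y) (snd y)) ys))"
proof -
  obtain ds where ds: "spine C T ds" "truth (appsv C u ds)" "\<not> truth (appsv C v ds)"
    using not_leF_spine[OF uv] by blast
  have l: "list_all2 (\<lambda>y d. d \<in> domA C (snd y)) ys ds"
    using ds(1) unfolding ys(2)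
  proof (induction ys arbitrary: ds)
    case (Cons y ys)
    then show ?case by (cases ds) auto
  qed simp
  define \<rho>' where "\<rho>' = (\<lambda>x A. case map_of (zip ys ds) (x, A) of Some d \<Rightarrow> d | None \<Rightarrow> \<rho> x A)"
  have len: "length ys = length ds" using l by (rule list_all2_lengthD)
  have "\<rho>' x A \<in> domA C A" for x A
  proof (cases "map_of (zip ys ds) (x, A)")
    case None
    then show ?thesis using \<rho> by (simp add: \<rho>'_def good_def)
  next
    case (Some d)
    then have "((x, A), d) \<in> set (zip ys ds)" by (rule map_of_SomeD)
    then show ?thesis using l Some by (auto simp: \<rho>'_def list_all2_iff)
  qed
  moreover have "\<rho>' x A = \<rho> x A" if "(x, A) \<notin> set ys" for x A
  proof -
    have "map_of (zip ys ds) (x, A) = None" using that len by (simp add: map_of_zip_is_None)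
    then show ?thesis by (simp add: \<rho>'_def)
  qed
  moreover have "map (\<lambda>y. \<rho>' (fst y) (snd y)) ys = ds"
    using len ys(1) by (intro nth_equalityI) (auto simp: \<rho>'_def map_of_zip_nth)
  ultimately show ?thesis using ds(2,3) by (intro exI[of _ \<rho>']) (simp add: good_def)
qed

subsection \<open>The predicate N\<close>

text \<open>Let \<open>F\<close> be the value of the predicate and \<open>G k\<close> that of the
  inner search for a predecessor of \<open>k\<close>, which counts upwards from 0. Their fixed-point
  equations carry an induction on the number.\<close>

lemma natP_holds:
  fixes C :: "'v coding"
  assumes \<rho>: "good C \<rho>" and ad: "adequate C (Arr TyN Omega)"
  shows "truth (app C (eval C \<rho> [] natP) (VN n))"
proof -
  let ?T = "Arr TyN Omega"
  define \<theta> :: "'v ord option fm" where "\<theta> = And (Eq (TBd 2) (Succ (TBd 0))) (AppT (Bd 3) (TBd 0))"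
  define E where "E = Lam TyN (Or \<theta> (AppT (Bd 1) (Succ (TBd 0))))"
  define B where "B = Lam TyN (Or (Eq (TBd 0) Zero) (AppT (Fix Mu None ?T E) Zero))"
  have nat: "exact natP = Fix Mu None ?T B"
    by (simp add: exact_def natP_def exN_def B_def E_def \<theta>_def)
  have E: "awt C (TyF ?T # TyN # TyF ?T # \<Theta>) E ?T" for \<Theta>
    using ad unfolding E_def \<theta>_def awt_simps by (auto simp add: numeral_eq_Suc)
  have B: "awt C [TyF ?T] B ?T"
    using ad E[of "[]"] unfolding B_def awt_simps by (simp add: numeral_eq_Suc)
  have unfold: "app C (aeval C \<rho> ds (Fix Mu None ?T (Lam TyN X))) (VN m)
      = aeval C \<rho> (VN m # aeval C \<rho> ds (Fix Mu None ?T (Lam TyN X)) # ds) X"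
    and fix_in: "aeval C \<rho> ds (Fix Mu None ?T (Lam TyN X)) \<in> domF C ?T"
    if X: "awt C (TyF ?T # \<Theta>) (Lam TyN X) ?T" "env C \<Theta> ds" for X \<Theta> ds m
  proof -
    let ?d = "aeval C \<rho> ds (Fix Mu None ?T (Lam TyN X))"
    have "awt C \<Theta> (Fix Mu None ?T (Lam TyN X)) ?T" using X(1) by (simp only: awt_simps)
    then show d: "?d \<in> domF C ?T" using aeval_in[OF \<rho> _ X(2)] by blast
    have "?d = aeval C \<rho> (?d # ds) (Lam TyN X)"
      using fixpoint_eq[OF ad mfun_aeval[OF \<rho> X], of Mu] by (simp add: fpv_def del: aeval.simps(6))
    then have "app C ?d (VN m) = app C (aeval C \<rho> (?d # ds) (Lam TyN X)) (VN m)"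
      by (rule arg_cong[where f = "\<lambda>v. app C v (VN m)"])
    also have "\<dots> = aeval C \<rho> (VN m # ?d # ds) X"
      using d X(2) by (intro app_aeval_Lam[OF \<rho> X(1)]) simp_all
    finally show "app C ?d (VN m) = aeval C \<rho> (VN m # ?d # ds) X" .
  qed
  define F where "F = aeval C \<rho> [] (Fix Mu None ?T B)"
  have F: "F \<in> domF C ?T" using fix_in[of "[]"] B by (simp only: F_def B_def env_simps)
  \<comment> \<open>The inner operator stands under the abstraction and the outer operator, whose
    variables have the values \<open>VN k\<close> and \<open>F\<close>.\<close>
  define G where "G k = aeval C \<rho> [VN k, F] (Fix Mu None ?T E)" for k
  have G: "truth (app C (G k) (VN m)) \<longleftrightarrow> k = Suc m \<and> truth (app C F (VN m)) \<or> truth (app C (G k) (VN (Suc m)))"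
    for k m
  proof -
    have "env C [TyN, TyF ?T] [VN k, F]" using F by simp
    then have "app C (G k) (VN m) = aeval C \<rho> [VN m, G k, VN k, F] (Or \<theta> (AppT (Bd 1) (Succ (TBd 0))))"
      using unfold[OF E[of "[]", unfolded E_def]] unfolding G_def E_def by blast
    then show ?thesis by (simp add: \<theta>_def numeral_eq_Suc)
  qed
  have FG: "truth (app C F (VN k)) \<longleftrightarrow> k = 0 \<or> truth (app C (G k) (VN 0))" for k
  proof -
    have "app C F (VN k) = aeval C \<rho> [VN k, F] (Or (Eq (TBd 0) Zero) (AppT (Fix Mu None ?T E) Zero))"
      using unfold[OF B[unfolded B_def], of "[]"] unfolding F_def B_def by simp
    then show ?thesis by (simp add: G_def)
  qed
  have "truth (app C F (VN k))" for k
  proof (induction k)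
    case 0
    then show ?case by (simp add: FG)
  next
    case (Suc k)
    \<comment> \<open>The search succeeds at \<open>k\<close>, hence from every earlier start;
      truncated subtraction lets \<open>k - i\<close> end at 0, where the search begins.\<close>
    have "truth (app C (G (Suc k)) (VN (k - i)))" for i
    proof (induction i)
      case 0
      then show ?case using Suc G[of "Suc k" k] by simp
    next
      case (Suc i)
      then show ?case using G[of "Suc k" "k - Suc i"] by (cases "i < k") (simp_all add: Suc_diff_Suc)
    qed
    from this[of k] show ?case by (simp add: FG[of "Suc k"])
  qed
  then show ?thesis unfolding aeval_exact[symmetric] nat F_def .
qed

section \<open>Transport of a refutation from a conclusion to one of its premises\<close>

section \<open>Refutations descend through the rules\<close>

text \<open>The kind of fixed point approximated on each side, which is also the kind that a
  progressing trace on that side follows.\<close>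

fun pol :: "side \<Rightarrow> fp" where
  "pol Lft = Mu"
| "pol Rgt = Nu"

definition refutes ::
  "'v coding \<Rightarrow> (nat \<Rightarrow> aty \<Rightarrow> 'v val) \<Rightarrow> side \<Rightarrow> form \<Rightarrow> 'v ord option fm \<Rightarrow> bool" where
  "refutes C \<rho> s \<phi> b \<longleftrightarrow>
     erase b = \<phi> \<and> anns (dual (pol s)) b \<subseteq> {None} \<and> (truth (aeval C \<rho> [] b) \<longleftrightarrow> s = Lft)"

text \<open>Phrased for sets of pairs of label and stage, since unfolding and reduction copy
  operators and drop them; inclusion absorbs both. The flag \<open>u\<close> marks the only steps
  that may create a label.\<close>

definition descends ::
  "fp \<Rightarrow> bool \<Rightarrow> nat \<Rightarrow> aform \<Rightarrow> 'v ord option fm \<Rightarrow> aform \<Rightarrow> 'v ord option fm \<Rightarrow> bool" where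
  "descends \<sigma> u k \<alpha> b \<alpha>' b' \<longleftrightarrow> zanns \<sigma> \<alpha>' b' \<subseteq> zanns \<sigma> \<alpha> b \<or>
     u \<and> (\<exists>q p a. (q, p) \<in> zanns \<sigma> \<alpha> b \<and> a \<in> below p \<and>
            zanns \<sigma> \<alpha>' b' \<subseteq> insert (q @ [k], Some a) (zanns \<sigma> \<alpha> b))"

fun is_FixR :: "core \<Rightarrow> bool" where
  "is_FixR (FixR s \<sigma> T \<phi> es) = True"
| "is_FixR c = False"

text \<open>The new stages \<open>b'\<close> are chosen before the quantifiers over
  \<open>\<alpha>\<close> and \<open>\<alpha>'\<close>: the refutation is continued while the trace
  is still unknown.\<close>

definition ctx_ok where
  "ctx_ok C \<rho> \<rho>' c s \<gamma> \<longleftrightarrow> (\<forall>b. refutes C \<rho> s (ctx_concl c \<gamma>) b \<longrightarrow>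
     (\<exists>b'. refutes C \<rho>' s (ctx_prem c \<gamma>) b' \<and> (\<forall>\<alpha> \<alpha>'. erase \<alpha> = erase b \<longrightarrow> ctx_inherit c \<gamma> \<alpha> \<alpha>' \<longrightarrow>
        zanns (pol s) \<alpha>' b' \<subseteq> zanns (pol s) \<alpha> b)))"

text \<open>\<open>ap s i\<close> is the annotated formula at position \<open>i\<close> among the
  principal formulas of side \<open>s\<close>. Where that side has none, as in (Cut) and (Nat), the
  condition on traces is empty.\<close>

definition act_ok where
  "act_ok C \<rho>' c ap j s i' \<longleftrightarrow> (\<exists>b'. refutes C \<rho>' s (on_side s (actives c ! j) ! i') b' \<and>
     (\<forall>i k \<alpha> \<alpha>'. i < length (on_side s (principals c)) \<longrightarrow> core_relevant c i i' \<longrightarrow>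
        erase \<alpha> = erase (ap s i) \<longrightarrow> core_inherit c s j i' k \<alpha> \<alpha>' \<longrightarrow>
        descends (pol s) (is_FixR c) k \<alpha> (ap s i) \<alpha>' b'))"

definition core_step where
  "core_step C \<rho> \<Gamma> \<Delta> c ap \<longleftrightarrow> (\<exists>j<length (actives c). \<exists>\<rho>'. good C \<rho>' \<and>
     (\<forall>\<gamma>\<in>set \<Gamma>. ctx_ok C \<rho> \<rho>' c Lft \<gamma>) \<and> (\<forall>\<gamma>\<in>set \<Delta>. ctx_ok C \<rho> \<rho>' c Rgt \<gamma>) \<and>
     (\<forall>s. \<forall>i'<length (on_side s (actives c ! j)). act_ok C \<rho>' c ap j s i'))"

text \<open>For the rules that leave contexts and valuation as they are: context formulas keep their
  stages.\<close>

lemma core_stepI: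
  assumes "\<And>\<gamma>. ctx_concl c \<gamma> = \<gamma>" "\<And>\<gamma>. ctx_prem c \<gamma> = \<gamma>" "\<And>\<gamma> \<alpha> \<alpha>'. ctx_inherit c \<gamma> \<alpha> \<alpha>' \<Longrightarrow> \<alpha>' = \<alpha>"
    and "good C \<rho>" "j < length (actives c)"
    and "\<And>s i'. i' < length (on_side s (actives c ! j)) \<Longrightarrow> act_ok C \<rho> c ap j s i'"
  shows "core_step C \<rho> \<Gamma> \<Delta> c ap"
proof -
  have "ctx_ok C \<rho> \<rho> c s \<gamma>" for s \<gamma>
    unfolding ctx_ok_def assms(1,2) using assms(3) by blast
  then show ?thesis unfolding core_step_def using assms(4-) by blast
qed

lemma act_okI:
  assumes "refutes C \<rho>' s (on_side s (actives c ! j) ! i') b'"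
    and "\<And>i k \<alpha> \<alpha>'. \<lbrakk>i < length (on_side s (principals c)); core_relevant c i i';
        erase \<alpha> = erase (ap s i); core_inherit c s j i' k \<alpha> \<alpha>'\<rbrakk> \<Longrightarrow> zanns (pol s) \<alpha>' b' \<subseteq> zanns (pol s) \<alpha> (ap s i)"
  shows "act_ok C \<rho>' c ap j s i'"
  unfolding act_ok_def descends_def using assms by blast

lemma refutes_exact: "(truth (eval C \<rho> [] \<phi>) \<longleftrightarrow> s = Lft) \<Longrightarrow> refutes C \<rho> s \<phi> (exact \<phi>)"
  using anns_exact by (auto simp: refutes_def aeval_exact)

lemma on_side_on: "on_side s' (on s \<Phi>) = (if s' = s then \<Phi> else [])"
  by (cases s; cases s') auto

lemma on_side_Nil [simp]: "on_side s ([], []) = []"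
  by (cases s) auto

lemma pol_eq [simp]: "pol s = Mu \<longleftrightarrow> s = Lft"
  by (cases s) auto

text \<open>The exact formula lies in between: approximating least fixed points in \<open>b\<close>
  lowers the value, approximating greatest ones in \<open>b'\<close> raises it.\<close>

lemma aeval_annotation_le:
  assumes "good C \<rho>" "awt C [] b U" "erase b = erase b'"
    and "anns Nu b \<subseteq> {None}" "anns Mu b' \<subseteq> {None}"
  shows "leF C U (aeval C \<rho> [] b) (aeval C \<rho> [] b')"
proof -
  obtain z where z: "map_fm fst z = b" "map_fm snd z = b'" using ex_zip_fm[OF assms(3)] by blast
  have "fst ` anns Nu z \<subseteq> {None}" "snd ` anns Mu z \<subseteq> {None}"
    using assms(4,5) unfolding z[symmetric] by simp_all
  then have 1: "(p, q) \<in> anns Mu z \<Longrightarrow> q = None" and 2: "(p, q) \<in> anns Nu z \<Longrightarrow> p = None" for p q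
    using imageI[of "(p, q)" "anns Mu z" snd] imageI[of "(p, q)" "anns Nu z" fst] by auto
  have "awt C [] z U" using assms(2) unfolding z(1)[symmetric] by simp
  \<comment> \<open>\<open>Fr 0 Omega\<close> replaced by itself is an identity substitution;
    \<open>Omega\<close> is adequate in every coding.\<close>
  then show ?thesis
    using aeval_msubst_le[OF assms(1), of "[]" z U 0 Omega "\<lambda>_. Fr 0 Omega" "\<lambda>_. Fr 0 Omega" "[]"] 1 2
    by (simp add: awt_simps z)
qed

subsection \<open>Pairs of annotations of composite formulas\<close>

lemma zanns_Or:
  assumes "erase (Or \<alpha>1 \<alpha>2) = erase (Or b1 b2)"
  shows "zanns \<sigma> (Or \<alpha>1 \<alpha>2) (Or b1 b2) = zanns \<sigma> \<alpha>1 b1 \<union> zanns \<sigma> \<alpha>2 b2"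
proof -
  obtain z1 z2 where z: "map_fm fst z1 = \<alpha>1" "map_fm snd z1 = b1" "map_fm fst z2 = \<alpha>2" "map_fm snd z2 = b2"
    using ex_zip_fm[of \<alpha>1 b1] ex_zip_fm[of \<alpha>2 b2] assms by (auto simp: erase_def)
  show ?thesis using zanns_map[of \<sigma> "Or z1 z2"] by (simp add: z[symmetric])
qed

lemma zanns_And:
  assumes "erase (And \<alpha>1 \<alpha>2) = erase (And b1 b2)"
  shows "zanns \<sigma> (And \<alpha>1 \<alpha>2) (And b1 b2) = zanns \<sigma> \<alpha>1 b1 \<union> zanns \<sigma> \<alpha>2 b2"
proof -
  obtain z1 z2 where z: "map_fm fst z1 = \<alpha>1" "map_fm snd z1 = b1" "map_fm fst z2 = \<alpha>2" "map_fm snd z2 = b2"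
    using ex_zip_fm[of \<alpha>1 b1] ex_zip_fm[of \<alpha>2 b2] assms by (auto simp: erase_def)
  show ?thesis using zanns_map[of \<sigma> "And z1 z2"] by (simp add: z[symmetric])
qed

lemma zanns_Eq [simp]: "zanns \<sigma> (Eq s t) b = {}"
proof -
  have "anns \<sigma> z = {}" if "map_fm fst z = Eq s t" for z :: "('a \<times> 'b) fm"
    using that by (cases z) auto
  then show ?thesis by (auto simp: zanns_def)
qed

lemma zanns_apps_var_arg:
  assumes "erase \<alpha> = erase b"
  shows "zanns \<sigma> (apps \<alpha> (map var_arg ys)) (apps b (map var_arg ys)) = zanns \<sigma> \<alpha> b"
proof -
  obtain z where z: "map_fm fst z = \<alpha>" "map_fm snd z = b" using ex_zip_fm[OF assms] by blast
  show ?thesis using zanns_map[of \<sigma> "apps z (map var_arg ys)"] by (simp add: z[symmetric])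
qed

text \<open>Heads that are not applications force the formula of pairs to split at the same place as
  both of its components.\<close>

lemma zip_apps:
  assumes "erase (apps \<alpha> ds) = erase (apps b ds')" "\<not> is_app \<alpha>" "\<not> is_app b"
  obtains z es where "map_fm fst z = \<alpha>" "map_fm snd z = b"
    "map (map_arg fst) es = ds" "map (map_arg snd) es = ds'"
proof -
  obtain u where u: "map_fm fst u = apps \<alpha> ds" "map_fm snd u = apps b ds'"
    using ex_zip_fm[OF assms(1)] by blast
  obtain z es where z: "u = apps z es" "map_fm snd z = b" "map (map_arg snd) es = ds'"
    using map_fm_eq_apps[OF u(2)] by blast
  have "\<not> is_app z" using z(2) assms(3) is_app_map_fm by metis
  then have "map_fm fst z = \<alpha> \<and> map (map_arg fst) es = ds"
    using u(1) assms(2) unfolding z(1) by (intro apps_inject) simp_all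
  then show thesis using that z by blast
qed

lemma zanns_Beta:
  assumes "erase (apps (Lam A \<beta>) (d # ds)) = erase (apps (Lam A \<beta>') (d' # ds'))"
  shows "zanns \<sigma> (apps (opn \<beta> d) ds) (apps (opn \<beta>' d') ds') \<subseteq>
    zanns \<sigma> (apps (Lam A \<beta>) (d # ds)) (apps (Lam A \<beta>') (d' # ds'))"
proof -
  obtain z0 es0 where 0: "map_fm fst z0 = Lam A \<beta>" "map_fm snd z0 = Lam A \<beta>'"
    "map (map_arg fst) es0 = d # ds" "map (map_arg snd) es0 = d' # ds'"
    using zip_apps[OF assms] by auto
  obtain z where z: "z0 = Lam A z" "map_fm fst z = \<beta>" "map_fm snd z = \<beta>'"
    using 0(1,2) by (cases z0) auto
  obtain e es where e: "es0 = e # es" "map_arg fst e = d" "map_arg snd e = d'"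
    "map (map_arg fst) es = ds" "map (map_arg snd) es = ds'"
    using 0(3,4) by (cases es0) auto
  have "zanns \<sigma> (apps (opn \<beta> d) ds) (apps (opn \<beta>' d') ds') = anns \<sigma> (apps (opn z e) es)"
    using zanns_map[of \<sigma> "apps (opn z e) es"] z e by simp
  also have "\<dots> \<subseteq> anns \<sigma> (apps (Lam A z) (e # es))" using anns_opn[of \<sigma> z e] by auto
  also have "\<dots> = zanns \<sigma> (apps (Lam A \<beta>) (d # ds)) (apps (Lam A \<beta>') (d' # ds'))"
    using zanns_map[of \<sigma> "apps (Lam A z) (e # es)"] z e by simp
  finally show ?thesis .
qed

text \<open>The copies of the unfolded operator receive the new pair; everything else in the
  unfolding is inherited.\<close>

lemma zanns_Fix:
  assumes "erase (apps (Fix \<sigma> q T \<beta>) ds) = erase (apps (Fix \<sigma> p T \<beta>') ds')"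
  defines "Z \<tau> \<equiv> zanns \<tau> (apps (Fix \<sigma> q T \<beta>) ds) (apps (Fix \<sigma> p T \<beta>') ds')"
  shows "(q, p) \<in> Z \<sigma>"
    and "zanns \<tau> (apps (opn \<beta> (ArgF (Fix \<sigma> q' T \<beta>))) ds) (apps (opn \<beta>' (ArgF (Fix \<sigma> p' T \<beta>'))) ds') \<subseteq>
      (if \<tau> = \<sigma> then insert (q', p') (Z \<tau>) else Z \<tau>)"
proof -
  obtain z0 es where 0: "map_fm fst z0 = Fix \<sigma> q T \<beta>" "map_fm snd z0 = Fix \<sigma> p T \<beta>'"
    and e: "map (map_arg fst) es = ds" "map (map_arg snd) es = ds'"
    using zip_apps[OF assms(1)] by auto
  obtain z where z: "z0 = Fix \<sigma> (q, p) T z" "map_fm fst z = \<beta>" "map_fm snd z = \<beta>'"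
    using 0 by (cases z0) auto
  have Z: "Z \<tau> = anns \<tau> (apps (Fix \<sigma> (q, p) T z) es)" for \<tau>
    using zanns_map[of \<tau> "apps (Fix \<sigma> (q, p) T z) es"] z e by (simp add: Z_def)
  show "(q, p) \<in> Z \<sigma>" by (simp add: Z)
  let ?w = "apps (opn z (ArgF (Fix \<sigma> (q', p') T z))) es"
  have "zanns \<tau> (apps (opn \<beta> (ArgF (Fix \<sigma> q' T \<beta>))) ds) (apps (opn \<beta>' (ArgF (Fix \<sigma> p' T \<beta>'))) ds') =
      anns \<tau> ?w"
    using zanns_map[of \<tau> ?w] z e by simp
  also have "\<dots> \<subseteq> (if \<tau> = \<sigma> then insert (q', p') (Z \<tau>) else Z \<tau>)"
    using anns_opn[of \<tau> z "ArgF (Fix \<sigma> (q', p') T z)"] by (auto simp: Z split: if_splits)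
  finally show "zanns \<tau> (apps (opn \<beta> (ArgF (Fix \<sigma> q' T \<beta>))) ds) (apps (opn \<beta>' (ArgF (Fix \<sigma> p' T \<beta>'))) ds') \<subseteq>
      (if \<tau> = \<sigma> then insert (q', p') (Z \<tau>) else Z \<tau>)" .
qed

subsection \<open>Propositional, equality and structural rules\<close>

lemma erase_simps:
  "erase b = Or \<phi> \<psi> \<longleftrightarrow> (\<exists>b1 b2. b = Or b1 b2 \<and> erase b1 = \<phi> \<and> erase b2 = \<psi>)"
  "erase b = And \<phi> \<psi> \<longleftrightarrow> (\<exists>b1 b2. b = And b1 b2 \<and> erase b1 = \<phi> \<and> erase b2 = \<psi>)"
  "erase b = Eq u v \<longleftrightarrow> b = Eq u v"
  by (cases b; auto simp: erase_def)+

text \<open>There is no premise to move to, so the assumptions must clash: the left copy lies below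
  the right one, yet is true while the other is false.\<close>

lemma core_step_Axiom:
  assumes "good C \<rho>" "awt C [] \<phi> Omega" "refutes C \<rho> Lft \<phi> (ap Lft 0)" "refutes C \<rho> Rgt \<phi> (ap Rgt 0)"
  shows "core_step C \<rho> \<Gamma> \<Delta> (Axiom \<phi>) ap"
proof -
  have "awt C [] (ap Lft 0) Omega" using assms(2,3) awt_erase[of C "[]" "ap Lft 0"] by (simp add: refutes_def)
  then have "leF C Omega (aeval C \<rho> [] (ap Lft 0)) (aeval C \<rho> [] (ap Rgt 0))"
    using assms by (intro aeval_annotation_le) (auto simp: refutes_def)
  then show ?thesis using assms by (simp add: refutes_def)
qed

lemma core_step_Cut:
  assumes "good C \<rho>"
  shows "core_step C \<rho> \<Gamma> \<Delta> (Cut \<phi>) ap"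
proof -
  \<comment> \<open>Premise 1 has the cut formula on the left, premise 0 on the right. It enters
    with exact fixed points.\<close>
  let ?j = "if truth (eval C \<rho> [] \<phi>) then 1 else 0"
  show ?thesis
  proof (rule core_stepI[where j = ?j])
    fix s i' assume "i' < length (on_side s (actives (Cut \<phi>) ! ?j))"
    then show "act_ok C \<rho> (Cut \<phi>) ap ?j s i'"
      by (intro act_okI[where b' = "exact \<phi>"]; cases s)
        (auto intro!: refutes_exact split: if_splits)
  qed (use assms in auto)
qed

lemma core_step_Wk: "good C \<rho> \<Longrightarrow> core_step C \<rho> \<Gamma> \<Delta> (Wk s \<phi>) ap"
  by (rule core_stepI[where j = 0]) (auto simp: on_side_on)

lemma core_step_Ctr:
  assumes "good C \<rho>" "refutes C \<rho> s \<phi> (ap s 0)"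
  shows "core_step C \<rho> \<Gamma> \<Delta> (Ctr s \<phi>) ap"
proof (rule core_stepI[where j = 0])
  fix s' i' assume "i' < length (on_side s' (actives (Ctr s \<phi>) ! 0))"
  then have *: "s' = s" "i' = 0 \<or> i' = 1" by (auto simp: on_side_on split: if_splits)
  then have "on_side s' (actives (Ctr s \<phi>) ! 0) ! i' = \<phi>" by (auto simp: on_side_on)
  then show "act_ok C \<rho> (Ctr s \<phi>) ap 0 s' i'"
    using assms * by (intro act_okI[where b' = "ap s 0"]) (auto simp: on_side_on)
qed (use assms in auto)

lemma swap_at_swap_at [simp]: "swap_at n (swap_at n i) = i"
  by (auto simp: swap_at_def)

lemma core_step_ExL:
  assumes "good C \<rho>"
    and "\<And>i. i < Suc (Suc (length \<Gamma>')) \<Longrightarrow> refutes C \<rho> Lft ((\<psi> # \<phi> # \<Gamma>') ! i) (ap Lft i)"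
  shows "core_step C \<rho> \<Gamma> \<Delta> (ExL \<phi> \<psi> \<Gamma>') ap"
proof (rule core_stepI[where j = 0])
  fix s i' assume i': "i' < length (on_side s (actives (ExL \<phi> \<psi> \<Gamma>') ! 0))"
  then have s: "s = Lft" "i' < Suc (Suc (length \<Gamma>'))" by (cases s; simp)+
  have "(\<phi> # \<psi> # \<Gamma>') ! i' = (\<psi> # \<phi> # \<Gamma>') ! swap_at 0 i'"
    by (auto simp: swap_at_def nth_Cons split: nat.split)
  moreover have "swap_at 0 i' < Suc (Suc (length \<Gamma>'))" using s by (auto simp: swap_at_def)
  ultimately show "act_ok C \<rho> (ExL \<phi> \<psi> \<Gamma>') ap 0 s i'"
    using assms(2)[of "swap_at 0 i'"] s by (intro act_okI[where b' = "ap Lft (swap_at 0 i')"]) auto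
qed (use assms in auto)

lemma core_step_ExR:
  assumes "good C \<rho>"
    and "\<And>i. i < Suc (Suc (length \<Delta>')) \<Longrightarrow> refutes C \<rho> Rgt ((\<Delta>' @ [\<psi>, \<phi>]) ! i) (ap Rgt i)"
  shows "core_step C \<rho> \<Gamma> \<Delta> (ExR \<Delta>' \<phi> \<psi>) ap"
proof (rule core_stepI[where j = 0])
  let ?n = "length \<Delta>'"
  fix s i' assume i': "i' < length (on_side s (actives (ExR \<Delta>' \<phi> \<psi>) ! 0))"
  then have s: "s = Rgt" "i' < Suc (Suc ?n)" by (cases s; simp)+
  have "(\<Delta>' @ [\<phi>, \<psi>]) ! i' = (\<Delta>' @ [\<psi>, \<phi>]) ! swap_at ?n i'"
    using s(2) by (auto simp: swap_at_def nth_append less_Suc_eq)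
  moreover have "swap_at ?n i' < Suc (Suc ?n)" using s by (auto simp: swap_at_def)
  ultimately show "act_ok C \<rho> (ExR \<Delta>' \<phi> \<psi>) ap 0 s i'"
    using assms(2)[of "swap_at ?n i'"] s by (intro act_okI[where b' = "ap Rgt (swap_at ?n i')"]) auto
qed (use assms in auto)

lemma core_step_OrL:
  assumes "good C \<rho>" "refutes C \<rho> Lft (Or \<phi> \<psi>) (ap Lft 0)"
  shows "core_step C \<rho> \<Gamma> \<Delta> (OrL \<phi> \<psi>) ap"
proof -
  obtain b1 b2 where b: "ap Lft 0 = Or b1 b2" "erase b1 = \<phi>" "erase b2 = \<psi>"
    using assms(2) by (auto simp: refutes_def erase_simps)
  let ?j = "if truth (aeval C \<rho> [] b1) then 0 else 1"
  show ?thesis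
  proof (rule core_stepI[where j = ?j])
    fix s i' assume "i' < length (on_side s (actives (OrL \<phi> \<psi>) ! ?j))"
    then have s: "s = Lft" "i' = 0" by (cases s; simp split: if_splits)+
    show "act_ok C \<rho> (OrL \<phi> \<psi>) ap ?j s i'"
      using assms(2) unfolding s
      by (intro act_okI[where b' = "if truth (aeval C \<rho> [] b1) then b1 else b2"])
        (auto simp: b refutes_def zanns_Or)
  qed (use assms in auto)
qed

lemma core_step_OrR:
  assumes "good C \<rho>" "refutes C \<rho> Rgt (Or \<phi> \<psi>) (ap Rgt 0)"
  shows "core_step C \<rho> \<Gamma> \<Delta> (OrR \<phi> \<psi>) ap"
proof -
  obtain b1 b2 where b: "ap Rgt 0 = Or b1 b2" "erase b1 = \<phi>" "erase b2 = \<psi>"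
    using assms(2) by (auto simp: refutes_def erase_simps)
  show ?thesis
  proof (rule core_stepI[where j = 0])
    fix s i' assume "i' < length (on_side s (actives (OrR \<phi> \<psi>) ! 0))"
    then have s: "s = Rgt" "i' = 0 \<or> i' = 1" by (cases s; auto)+
    show "act_ok C \<rho> (OrR \<phi> \<psi>) ap 0 s i'"
      using assms(2) s
      by (intro act_okI[where b' = "if i' = 0 then b1 else b2"]) (auto simp: b refutes_def zanns_Or)
  qed (use assms in auto)
qed

lemma core_step_AndL:
  assumes "good C \<rho>" "refutes C \<rho> Lft (And \<phi> \<psi>) (ap Lft 0)"
  shows "core_step C \<rho> \<Gamma> \<Delta> (AndL \<phi> \<psi>) ap"
proof -
  obtain b1 b2 where b: "ap Lft 0 = And b1 b2" "erase b1 = \<phi>" "erase b2 = \<psi>"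
    using assms(2) by (auto simp: refutes_def erase_simps)
  show ?thesis
  proof (rule core_stepI[where j = 0])
    fix s i' assume "i' < length (on_side s (actives (AndL \<phi> \<psi>) ! 0))"
    then have s: "s = Lft" "i' = 0 \<or> i' = 1" by (cases s; auto)+
    show "act_ok C \<rho> (AndL \<phi> \<psi>) ap 0 s i'"
      using assms(2) s
      by (intro act_okI[where b' = "if i' = 0 then b1 else b2"]) (auto simp: b refutes_def zanns_And)
  qed (use assms in auto)
qed

lemma core_step_AndR:
  assumes "good C \<rho>" "refutes C \<rho> Rgt (And \<phi> \<psi>) (ap Rgt 0)"
  shows "core_step C \<rho> \<Gamma> \<Delta> (AndR \<phi> \<psi>) ap"
proof -
  obtain b1 b2 where b: "ap Rgt 0 = And b1 b2" "erase b1 = \<phi>" "erase b2 = \<psi>"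
    using assms(2) by (auto simp: refutes_def erase_simps)
  let ?j = "if truth (aeval C \<rho> [] b1) then 1 else 0"
  show ?thesis
  proof (rule core_stepI[where j = ?j])
    fix s i' assume "i' < length (on_side s (actives (AndR \<phi> \<psi>) ! ?j))"
    then have s: "s = Rgt" "i' = 0" by (cases s; simp split: if_splits)+
    show "act_ok C \<rho> (AndR \<phi> \<psi>) ap ?j s i'"
      using assms(2) unfolding s
      by (intro act_okI[where b' = "if truth (aeval C \<rho> [] b1) then b2 else b1"])
        (auto simp: b refutes_def zanns_And)
  qed (use assms in auto)
qed

lemma core_step_P2:
  assumes "good C \<rho>" "wt_tm [] u" "wt_tm [] v" "refutes C \<rho> Lft (Eq (Succ u) (Succ v)) (ap Lft 0)"
  shows "core_step C \<rho> \<Gamma> \<Delta> (P2 u v) ap"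
proof -
  \<comment> \<open>\<open>the_nat\<close> is injective on values \<open>VN n\<close> only, so both
    sides must be known to be numbers.\<close>
  have "eval_tm \<rho> [] u \<in> range VN" "eval_tm \<rho> [] v \<in> range VN"
    using eval_tm_in[OF _ assms(1)] assms(2,3) by auto
  then have r: "refutes C \<rho> Lft (Eq u v) (Eq u v)"
    using assms(4) by (auto simp: refutes_def erase_simps)
  show ?thesis
  proof (rule core_stepI[where j = 0])
    fix s i' assume "i' < length (on_side s (actives (P2 u v) ! 0))"
    then have s: "s = Lft" "i' = 0" by (cases s; simp)+
    show "act_ok C \<rho> (P2 u v) ap 0 s i'"
      using r unfolding s by (intro act_okI[where b' = "Eq u v"]) auto
  qed (use assms in auto)
qed

lemma core_step_Nat:
  assumes "good C \<rho>" "awt C [] (AppT natP (TFr x)) Omega"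
  shows "core_step C \<rho> \<Gamma> \<Delta> (Nat x) ap"
proof -
  have ad: "adequate C (Arr TyN Omega)" using assms(2) awt_adequate by (auto simp only: awt_simps)
  have "\<rho> x TyN \<in> domA C TyN" using assms(1) by (simp only: good_def)
  then have r: "refutes C \<rho> Lft (AppT natP (TFr x)) (exact (AppT natP (TFr x)))"
    using natP_holds[OF assms(1) ad] by (intro refutes_exact) auto
  show ?thesis
  proof (rule core_stepI[where j = 0])
    fix s i' assume "i' < length (on_side s (actives (Nat x) ! 0))"
    then have s: "s = Lft" "i' = 0" by (cases s; simp)+
    show "act_ok C \<rho> (Nat x) ap 0 s i'"
      using r unfolding s by (intro act_okI[where b' = "exact (AppT natP (TFr x))"]) auto
  qed (use assms in auto)
qed

subsection \<open>Reduction and unfolding\<close>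

text \<open>Reduction preserves the value of the formula with its stages. Arguments may be copied or
  lost, which leaves the set of pairs included in the old one.\<close>

lemma core_step_Beta:
  assumes \<rho>: "good C \<rho>" and w: "awt C [] (apps (Lam A \<phi>) (e # es)) Omega"
    and r: "refutes C \<rho> s (apps (Lam A \<phi>) (e # es)) (ap s 0)"
  shows "core_step C \<rho> \<Gamma> \<Delta> (Beta s A \<phi> e es) ap"
proof -
  have "map_fm (\<lambda>_. ()) (ap s 0) = apps (Lam A \<phi>) (e # es)" using r by (simp add: refutes_def erase_def)
  from map_fm_eq_apps[OF this] obtain b0 es0 where 0: "ap s 0 = apps b0 es0"
    "map_fm (\<lambda>_. ()) b0 = Lam A \<phi>" "map (map_arg (\<lambda>_. ())) es0 = e # es"
    by (elim exE conjE)
  obtain \<beta> where \<beta>: "b0 = Lam A \<beta>" "erase \<beta> = \<phi>" using 0(2) by (cases b0) (auto simp: erase_def)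
  obtain d ds where d: "es0 = d # ds" "map_arg (\<lambda>_. ()) d = e" "map (map_arg (\<lambda>_. ())) ds = es"
    using 0(3) by (cases es0) auto
  have b: "ap s 0 = apps (Lam A \<beta>) (d # ds)" using 0(1) \<beta>(1) d(1) by simp
  have "awt C [] (erase (ap s 0)) Omega" using w r by (simp only: refutes_def)
  then have wb: "awt C [] (apps (Lam A \<beta>) (d # ds)) Omega" unfolding b awt_erase .
  have er: "erase (apps (opn \<beta> d) ds) = apps (opn \<phi> e) es" using \<beta>(2) d by (simp add: erase_def)
  have an: "anns \<sigma> (apps (opn \<beta> d) ds) \<subseteq> anns \<sigma> (ap s 0)" for \<sigma>
    using anns_opn[of \<sigma> \<beta> d] by (auto simp: b)
  have ev: "aeval C \<rho> [] (ap s 0) = aeval C \<rho> [] (apps (opn \<beta> d) ds)"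
    unfolding b by (rule aeval_Beta[OF \<rho> wb])
  have r': "refutes C \<rho> s (apps (opn \<phi> e) es) (apps (opn \<beta> d) ds)"
    using subset_trans[OF an, of "dual (pol s)" "{None}"] r er ev by (simp only: refutes_def)
  show ?thesis
  proof (rule core_stepI[where j = 0])
    fix s' i' assume "i' < length (on_side s' (actives (Beta s A \<phi> e es) ! 0))"
    then have s: "s' = s" "i' = 0" by (auto simp: on_side_on split: if_splits)
    show "act_ok C \<rho> (Beta s A \<phi> e es) ap 0 s' i'"
      unfolding s
    proof (rule act_okI[where b' = "apps (opn \<beta> d) ds"])
      fix i k \<alpha> \<alpha>'
      assume "i < length (on_side s (principals (Beta s A \<phi> e es)))" "erase \<alpha> = erase (ap s i)"
        "core_inherit (Beta s A \<phi> e es) s 0 0 k \<alpha> \<alpha>'"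
      then show "zanns (pol s) \<alpha>' (apps (opn \<beta> d) ds) \<subseteq> zanns (pol s) \<alpha> (ap s i)"
        using zanns_Beta[of A _ _ _ \<beta> d ds "pol s"] by (auto simp: on_side_on b simp del: apps_simps)
    qed (use r' in \<open>simp add: on_side_on\<close>)
  qed (use \<rho> in auto)
qed

text \<open>The kind approximated on side \<open>s\<close> moves to a stage in
  \<open>below p\<close>, which pays for the new label of the trace. The other kind carries
  \<open>None\<close>, unfolds exactly, and is not counted by \<open>zanns (pol s)\<close>.\<close>

lemma core_step_FixR:
  assumes \<rho>: "good C \<rho>" and w: "awt C [] (apps (Fix \<sigma> () T \<phi>) es) Omega"
    and r: "refutes C \<rho> s (apps (Fix \<sigma> () T \<phi>) es) (ap s 0)"
  shows "core_step C \<rho> \<Gamma> \<Delta> (FixR s \<sigma> T \<phi> es) ap"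
proof -
  have "map_fm (\<lambda>_. ()) (ap s 0) = apps (Fix \<sigma> () T \<phi>) es" using r by (simp add: refutes_def erase_def)
  then obtain b0 ds where 0: "ap s 0 = apps b0 ds" "map_fm (\<lambda>_. ()) b0 = Fix \<sigma> () T \<phi>"
    and d: "map (map_arg (\<lambda>_. ())) ds = es" using map_fm_eq_apps[of _ "ap s 0"] by blast
  obtain p \<beta> where \<beta>: "b0 = Fix \<sigma> p T \<beta>" "erase \<beta> = \<phi>" using 0(2) by (cases b0) (auto simp: erase_def)
  have b: "ap s 0 = apps (Fix \<sigma> p T \<beta>) ds" using 0(1) \<beta>(1) by simp
  have "awt C [] (erase (ap s 0)) Omega" using w r by (simp only: refutes_def)
  then have wb: "awt C [] (apps (Fix \<sigma> p T \<beta>) ds) Omega" unfolding b awt_erase .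
  define b' where "b' p' = apps (opn \<beta> (ArgF (Fix \<sigma> p' T \<beta>))) ds" for p'
  have e: "erase (b' p') = apps (opn \<phi> (ArgF (Fix \<sigma> () T \<phi>))) es" for p'
    using \<beta>(2) d by (simp add: erase_def b'_def)
  have an: "anns \<tau> (b' p') \<subseteq> (if \<tau> = \<sigma> then insert p' (anns \<tau> (ap s 0)) else anns \<tau> (ap s 0))" for p' \<tau>
    using anns_opn[of \<tau> \<beta> "ArgF (Fix \<sigma> p' T \<beta>)"] by (auto simp: b b'_def split: if_splits)
  have Z: "(q, p) \<in> zanns \<sigma> (apps (Fix \<sigma> q T \<beta>1) ds1) (ap s 0)"
    "zanns \<tau> (apps (opn \<beta>1 (ArgF (Fix \<sigma> q' T \<beta>1))) ds1) (b' p') \<subseteq>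
      (if \<tau> = \<sigma> then insert (q', p') (zanns \<tau> (apps (Fix \<sigma> q T \<beta>1) ds1) (ap s 0))
       else zanns \<tau> (apps (Fix \<sigma> q T \<beta>1) ds1) (ap s 0))"
    if "erase (apps (Fix \<sigma> q T \<beta>1) ds1) = erase (ap s 0)" for q q' \<beta>1 ds1 \<tau> p'
    using zanns_Fix[of \<sigma> q T \<beta>1 ds1 p \<beta> ds] that unfolding b b'_def by blast+
  have "\<exists>p'. refutes C \<rho> s (apps (opn \<phi> (ArgF (Fix \<sigma> () T \<phi>))) es) (b' p') \<and>
    (pol s = \<sigma> \<longrightarrow> (\<exists>a\<in>below p. p' = Some a))"
  proof (cases "\<sigma> = pol s")
    case True
    have "truth (aeval C \<rho> [] (apps (Fix \<sigma> p T \<beta>) ds)) \<longleftrightarrow> \<sigma> = Mu"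
      using r by (simp add: refutes_def b True)
    then obtain a where a: "a \<in> below p" "truth (aeval C \<rho> [] (b' (Some a))) \<longleftrightarrow> \<sigma> = Mu"
      using Fix_descend[OF \<rho> wb] unfolding b'_def by blast
    have "dual (pol s) \<noteq> \<sigma>" using True by (cases s) auto
    then have "refutes C \<rho> s (apps (opn \<phi> (ArgF (Fix \<sigma> () T \<phi>))) es) (b' (Some a))"
      using a(2) an[of "dual (pol s)" "Some a"] e r True by (auto simp: refutes_def)
    then show ?thesis using a(1) by blast
  next
    case False
    then have du: "dual (pol s) = \<sigma>" by (cases s; cases \<sigma>) auto
    have "p \<in> anns \<sigma> (ap s 0)" by (simp add: b)
    then have p: "p = None" using r du by (auto simp: refutes_def)
    have "truth (aeval C \<rho> [] (b' None)) \<longleftrightarrow> s = Lft"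
      using r Fix_unfold[OF \<rho> wb p] by (simp add: refutes_def b b'_def)
    then have "refutes C \<rho> s (apps (opn \<phi> (ArgF (Fix \<sigma> () T \<phi>))) es) (b' None)"
      using an[of "dual (pol s)" None] e r unfolding refutes_def du by auto
    then show ?thesis using False by blast
  qed
  then obtain p' where p': "refutes C \<rho> s (apps (opn \<phi> (ArgF (Fix \<sigma> () T \<phi>))) es) (b' p')"
    "pol s = \<sigma> \<Longrightarrow> \<exists>a\<in>below p. p' = Some a" by blast
  show ?thesis
  proof (rule core_stepI[where j = 0])
    fix s' i' assume "i' < length (on_side s' (actives (FixR s \<sigma> T \<phi> es) ! 0))"
    then have s: "s' = s" "i' = 0" by (auto simp: on_side_on split: if_splits)
    have "descends (pol s) True k \<alpha> (ap s i) \<alpha>' (b' p')"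
      if h: "i < length (on_side s (principals (FixR s \<sigma> T \<phi> es)))" "erase \<alpha> = erase (ap s i)"
        "core_inherit (FixR s \<sigma> T \<phi> es) s 0 0 k \<alpha> \<alpha>'" for i k \<alpha> \<alpha>'
    proof -
      have i: "i = 0" using h(1) by (simp add: on_side_on)
      obtain q \<beta>1 ds1 where \<alpha>: "\<alpha> = apps (Fix \<sigma> q T \<beta>1) ds1"
        "\<alpha>' = apps (opn \<beta>1 (ArgF (Fix \<sigma> (q @ [k]) T \<beta>1))) ds1" using h(3) by auto
      note Z = Z[OF h(2)[unfolded \<alpha> i]]
      show ?thesis
      proof (cases "pol s = \<sigma>")
        case True
        then obtain a where "a \<in> below p" "p' = Some a" using p'(2) by blast
        then show ?thesis
          using Z(1) Z(2)[of "pol s" "q @ [k]" p'] True unfolding descends_def \<alpha> i by auto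
      next
        case False
        then show ?thesis
          using Z(2)[of "pol s" "q @ [k]" p'] unfolding descends_def \<alpha> i by simp
      qed
    qed
    then show "act_ok C \<rho> (FixR s \<sigma> T \<phi> es) ap 0 s' i'"
      unfolding s act_ok_def using p'(1) by (intro exI[of _ "b' p'"]) (simp add: on_side_on)
  qed (use \<rho> in auto)
qed

section \<open>Rules that transform the contexts or change the valuation\<close>

subsection \<open>Substitution and monotonicity\<close>

lemma fv_erase [simp]: "fv (erase \<phi>) = fv \<phi>"
  by (simp add: erase_def)

lemma nocc_erase [simp]: "nocc x T (erase \<phi>) = nocc x T \<phi>"
  by (simp add: erase_def)

lemma refutes_cong:
  assumes "refutes C \<rho> s \<phi> b" "\<And>x A. (x, A) \<in> fv \<phi> \<Longrightarrow> \<rho>' x A = \<rho> x A"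
  shows "refutes C \<rho>' s \<phi> b"
proof -
  have "fv \<phi> = fv b" using assms(1) fv_erase[of b] by (simp add: refutes_def)
  then have "aeval C \<rho>' [] b = aeval C \<rho> [] b" using assms(2) by (intro aeval_cong) simp
  then show ?thesis using assms(1) by (simp add: refutes_def)
qed

lemma erase_eq_substT: "erase b = substT \<theta> \<gamma> \<Longrightarrow> \<exists>\<beta>. b = substT \<theta> \<beta> \<and> erase \<beta> = \<gamma>"
  using map_fm_eq_substT unfolding erase_def by blast

lemma erase_eq_msubst:
  "erase b = msubst x T (\<lambda>_. \<psi>) \<gamma> \<Longrightarrow>
    \<exists>\<beta> \<zeta>. b = msubst x T \<zeta> \<beta> \<and> erase \<beta> = \<gamma> \<and> (\<forall>j<nocc x T \<gamma>. erase (\<zeta> j) = \<psi>)"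
  unfolding erase_def by (rule map_fm_eq_msubst)

text \<open>The premise is refuted where \<open>x\<close> has the value of \<open>t\<close>. Terms
  carry no annotations, so each operator keeps its stage.\<close>

lemma core_step_SubstN:
  assumes \<rho>: "good C \<rho>" and t: "wt_tm [] t"
  shows "core_step C \<rho> \<Gamma> \<Delta> (SubstN x t) ap"
proof -
  define \<rho>' where "\<rho>' = (\<lambda>y A. if A = TyN then eval_tm \<rho> [] ((TFr(x := t)) y) else \<rho> y A)"
  have w: "wt_tm [] ((TFr(x := t)) y)" for y using t by simp
  have "\<rho>' y A \<in> domA C A" for y A
    using \<rho> eval_tm_in[OF w \<rho>, of "[]" y] by (auto simp: \<rho>'_def good_def)
  then have g: "good C \<rho>'" by (simp add: good_def)
  have "ctx_ok C \<rho> \<rho>' (SubstN x t) s \<gamma>" for s \<gamma>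
    unfolding ctx_ok_def
  proof (intro allI impI)
    fix b assume r: "refutes C \<rho> s (ctx_concl (SubstN x t) \<gamma>) b"
    then have "erase b = substT (TFr(x := t)) \<gamma>" by (simp add: refutes_def)
    from erase_eq_substT[OF this] obtain \<beta> where b: "b = substT (TFr(x := t)) \<beta>" "erase \<beta> = \<gamma>"
      by (elim exE conjE)
    have "refutes C \<rho>' s \<gamma> \<beta>" using r aeval_substT[of "TFr(x := t)" C \<rho> "[]" \<beta>, OF w] b by (simp add: refutes_def \<rho>'_def)
    moreover have "zanns (pol s) \<alpha>' \<beta> \<subseteq> zanns (pol s) \<alpha> b" if "ctx_inherit (SubstN x t) \<gamma> \<alpha> \<alpha>'" for \<alpha> \<alpha>'
      using that b by (simp add: zanns_substT)
    ultimately show "\<exists>b'. refutes C \<rho>' s (ctx_prem (SubstN x t) \<gamma>) b' \<and>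
      (\<forall>\<alpha> \<alpha>'. erase \<alpha> = erase b \<longrightarrow> ctx_inherit (SubstN x t) \<gamma> \<alpha> \<alpha>' \<longrightarrow>
        zanns (pol s) \<alpha>' b' \<subseteq> zanns (pol s) \<alpha> b)" by (intro exI[of _ \<beta>]) simp
  qed
  then show ?thesis unfolding core_step_def using g by (intro exI[of _ 0]) (auto intro!: exI[of _ \<rho>'])
qed

text \<open>The refuted equation is true, so exchanging its sides changes neither values nor
  stages.\<close>

lemma core_step_EqL:
  assumes \<rho>: "good C \<rho>" and t: "wt_tm [] t" "wt_tm [] u" and r: "refutes C \<rho> Lft (Eq t u) (ap Lft 0)"
  shows "core_step C \<rho> \<Gamma> \<Delta> (EqL x y t u) ap"
proof -
  let ?\<theta> = "TFr(x := t, y := u)" and ?\<theta>' = "TFr(x := u, y := t)"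
  have eq: "eval_tm \<rho> [] t = eval_tm \<rho> [] u" using r by (auto simp: refutes_def erase_simps)
  have w: "wt_tm [] (?\<theta> z)" "wt_tm [] (?\<theta>' z)" for z using t by auto
  have eq': "eval_tm \<rho> [] (?\<theta> z) = eval_tm \<rho> [] (?\<theta>' z)" for z using eq by simp
  have ev: "aeval C \<rho> [] (substT ?\<theta> \<beta>) = aeval C \<rho> [] (substT ?\<theta>' \<beta>)" for \<beta>
    unfolding aeval_substT[OF w(1)] aeval_substT[OF w(2)] eq' ..
  have "ctx_ok C \<rho> \<rho> (EqL x y t u) s \<gamma>" for s \<gamma>
    unfolding ctx_ok_def
  proof (intro allI impI)
    fix b assume r: "refutes C \<rho> s (ctx_concl (EqL x y t u) \<gamma>) b"
    then have "erase b = substT ?\<theta> \<gamma>" by (simp add: refutes_def)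
    from erase_eq_substT[OF this] obtain \<beta> where b: "b = substT ?\<theta> \<beta>" "erase \<beta> = \<gamma>"
      by (elim exE conjE)
    have "erase (substT ?\<theta>' \<beta>) = substT ?\<theta>' \<gamma>" using b(2) by (simp add: erase_def)
    then have "refutes C \<rho> s (substT ?\<theta>' \<gamma>) (substT ?\<theta>' \<beta>)"
      using r ev[of \<beta>] by (simp add: refutes_def b(1) del: fun_upd_apply)
    moreover have "zanns (pol s) \<alpha>' (substT ?\<theta>' \<beta>) \<subseteq> zanns (pol s) \<alpha> b"
      if "ctx_inherit (EqL x y t u) \<gamma> \<alpha> \<alpha>'" for \<alpha> \<alpha>'
      using that b by (auto simp: zanns_substT)
    ultimately show "\<exists>b'. refutes C \<rho> s (ctx_prem (EqL x y t u) \<gamma>) b' \<and>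
      (\<forall>\<alpha> \<alpha>'. erase \<alpha> = erase b \<longrightarrow> ctx_inherit (EqL x y t u) \<gamma> \<alpha> \<alpha>' \<longrightarrow>
        zanns (pol s) \<alpha>' b' \<subseteq> zanns (pol s) \<alpha> b)" by (intro exI[of _ "substT ?\<theta>' \<beta>"]) simp
  qed
  then show ?thesis unfolding core_step_def using \<rho> by (intro exI[of _ 0]) (auto intro!: exI[of _ \<rho>])
qed

lemma map_fm_diag [simp]:
  "map_fm fst (map_fm (\<lambda>p. (p, p)) \<beta>) = \<beta>" "map_fm snd (map_fm (\<lambda>p. (p, p)) \<beta>) = \<beta>"
  by (simp_all add: fm.map_comp comp_def fm.map_ident)

lemma erase_awt: "\<lbrakk>erase b = \<phi>; awt C \<Theta> \<phi> T\<rbrakk> \<Longrightarrow> awt C \<Theta> b T"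
  using awt_erase by blast

text \<open>
  The copies of \<open>\<psi>\<close> carry different approximants, whereas the premise knows just one value for \<open>x\<close>.
  The exact value of \<open>\<psi>\<close> is on the safe side for each of them.
\<close>

lemma msubst_exact_le:
  assumes \<rho>: "good C \<rho>" and w: "awt C [] \<beta> U" "awt C [] \<psi> T"
    and e: "\<And>j. j < nocc x T \<beta> \<Longrightarrow> erase (\<zeta> j) = (\<psi> :: form)"
    and a: "anns (dual (pol s)) (msubst x T \<zeta> \<beta>) \<subseteq> {None}"
  defines "\<rho>' \<equiv> \<rho>(x := (\<rho> x)(TyF T := eval C \<rho> [] \<psi>))"
  shows "le C (pol s) U (aeval C \<rho> [] (msubst x T \<zeta> \<beta>)) (aeval C \<rho>' [] \<beta>)"
proof -
  have ex: "aeval C \<rho> [] (msubst x T (\<lambda>_. exact \<psi>) \<beta>) = aeval C \<rho>' [] \<beta>"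
    using aeval_msubst[of "exact \<psi>" T C \<rho> "[]" x \<beta>] awt_wt[of C "[]" "exact \<psi>" T] w(2)
    by (simp add: aeval_exact \<rho>'_def del: fun_upd_apply)
  have j: "awt C [] (\<zeta> j) T" "anns (dual (pol s)) (\<zeta> j) \<subseteq> {None}" if "j < nocc x T \<beta>" for j
  proof -
    show "awt C [] (\<zeta> j) T" by (rule erase_awt[OF e[OF that] w(2)])
    show "anns (dual (pol s)) (\<zeta> j) \<subseteq> {None}" using a that by (auto simp: anns_msubst)
  qed
  \<comment> \<open>Pairing \<open>\<beta>\<close> with itself leaves only the copies of
    \<open>\<psi>\<close> to be compared.\<close>
  have w': "awt C [] (map_fm (\<lambda>p. (p, p)) \<beta>) U" using w(1) by simp
  show ?thesis
  proof (cases s)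
    case Lft
    have "leF C T (aeval C \<rho> [] (\<zeta> j)) (aeval C \<rho> [] (exact \<psi>))" if "j < nocc x T \<beta>" for j
      using j[OF that] e[OF that] Lft anns_exact[of Mu \<psi>] by (intro aeval_annotation_le[OF \<rho>]) simp_all
    then have "leF C U (aeval C \<rho> [] (msubst x T \<zeta> \<beta>)) (aeval C \<rho> [] (msubst x T (\<lambda>_. exact \<psi>) \<beta>))"
      using aeval_msubst_le[OF \<rho> w', of x T \<zeta> "\<lambda>_. exact \<psi>" "[]"] j w(2) by auto
    then show ?thesis using Lft by (simp add: ex le_def)
  next
    case Rgt
    have "leF C T (aeval C \<rho> [] (exact \<psi>)) (aeval C \<rho> [] (\<zeta> j))" if "j < nocc x T \<beta>" for j
      using j[OF that] e[OF that] Rgt anns_exact[of Nu \<psi>] w(2) by (intro aeval_annotation_le[OF \<rho>]) simp_all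
    then have "leF C U (aeval C \<rho> [] (msubst x T (\<lambda>_. exact \<psi>) \<beta>)) (aeval C \<rho> [] (msubst x T \<zeta> \<beta>))"
      using aeval_msubst_le[OF \<rho> w', of x T "\<lambda>_. exact \<psi>" \<zeta> "[]"] j w(2) by auto
    then show ?thesis using Rgt by (simp add: ex le_def)
  qed
qed

lemma core_step_SubstF:
  assumes \<rho>: "good C \<rho>" and \<psi>: "wt [] \<psi> T"
    and w: "\<And>\<gamma>. \<gamma> \<in> set \<Gamma> \<union> set \<Delta> \<Longrightarrow> awt C [] (subst x T \<psi> \<gamma>) Omega \<and> wt [] \<gamma> Omega"
  shows "core_step C \<rho> \<Gamma> \<Delta> (SubstF x T \<psi>) ap"
proof -
  \<comment> \<open>If adequacy fails for \<open>\<psi>\<close>, then \<open>x\<close> occurs in no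
    context formula and the valuation can stay.\<close>
  define \<rho>' where "\<rho>' = (if awt C [] \<psi> T then \<rho>(x := (\<rho> x)(TyF T := eval C \<rho> [] \<psi>)) else \<rho>)"
  have "eval C \<rho> [] \<psi> \<in> domF C T" if "awt C [] \<psi> T"
    unfolding aeval_exact[symmetric] using that by (intro aeval_in[OF \<rho>, of "[]"]) simp_all
  then have g: "good C \<rho>'" using \<rho> by (auto simp: good_def \<rho>'_def)
  have "ctx_ok C \<rho> \<rho>' (SubstF x T \<psi>) s \<gamma>" if "\<gamma> \<in> set \<Gamma> \<union> set \<Delta>" for s \<gamma>
    unfolding ctx_ok_def
  proof (intro allI impI)
    fix b assume r: "refutes C \<rho> s (ctx_concl (SubstF x T \<psi>) \<gamma>) b"
    then have "erase b = msubst x T (\<lambda>_. \<psi>) \<gamma>" by (simp add: refutes_def subst_def)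
    from erase_eq_msubst[OF this] obtain \<beta> \<zeta> where b: "b = msubst x T \<zeta> \<beta>" "erase \<beta> = \<gamma>"
      and "\<forall>j<nocc x T \<gamma>. erase (\<zeta> j) = \<psi>" by (elim exE conjE)
    note \<zeta> = this(3)[rule_format]
    have nc: "nocc x T \<beta> = nocc x T \<gamma>" using b(2) nocc_erase by metis
    have \<gamma>: "awt C [] \<gamma> Omega" "0 < nocc x T \<gamma> \<Longrightarrow> awt C [] \<psi> T"
      using awt_msubst_inv[of C "[]" x T \<psi> \<gamma> Omega] w[OF that] \<psi> by (simp_all add: subst_def)
    have \<beta>: "awt C [] \<beta> Omega" by (rule erase_awt[OF b(2) \<gamma>(1)])
    \<comment> \<open>Passing from the copies to the exact value can only raise left formulas and
      lower right ones, so the refutation survives.\<close>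
    have "le C (pol s) Omega (aeval C \<rho> [] b) (aeval C \<rho>' [] \<beta>)"
    proof (cases "awt C [] \<psi> T")
      case True
      then show ?thesis
        using msubst_exact_le[OF \<rho> \<beta> True, of x \<zeta> s] \<zeta> nc r b(1) by (simp add: \<rho>'_def refutes_def)
    next
      case False
      then have "\<not> 0 < nocc x T \<beta>" using \<gamma>(2) nc by auto
      then have "b = msubst x T (\<lambda>_. Fr x T) \<beta>" unfolding b(1) by (intro msubst_cong) simp
      then show ?thesis using False by (simp add: \<rho>'_def)
    qed
    moreover have "anns (dual (pol s)) \<beta> \<subseteq> {None}" using r by (simp add: refutes_def b(1) anns_msubst)
    ultimately have "refutes C \<rho>' s \<gamma> \<beta>" using r b(2) by (cases s) (auto simp: refutes_def le_def)
    moreover have "zanns (pol s) \<alpha>' \<beta> \<subseteq> zanns (pol s) \<alpha> b"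
      if inh: "ctx_inherit (SubstF x T \<psi>) \<gamma> \<alpha> \<alpha>'" for \<alpha> \<alpha>'
    proof -
      obtain \<xi> where \<xi>: "erase \<alpha>' = \<gamma>" "\<forall>n. erase (\<xi> n) = \<psi>" "\<alpha> = msubst x T \<xi> \<alpha>'" using inh by auto
      have "nocc x T \<alpha>' = nocc x T \<gamma>" using \<xi>(1) nocc_erase by metis
      then show ?thesis
        using zanns_msubst[of \<alpha>' \<beta> x T \<xi> \<zeta> "pol s"] \<xi> b \<zeta> by simp
    qed
    ultimately show "\<exists>b'. refutes C \<rho>' s (ctx_prem (SubstF x T \<psi>) \<gamma>) b' \<and>
      (\<forall>\<alpha> \<alpha>'. erase \<alpha> = erase b \<longrightarrow> ctx_inherit (SubstF x T \<psi>) \<gamma> \<alpha> \<alpha>' \<longrightarrow>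
        zanns (pol s) \<alpha>' b' \<subseteq> zanns (pol s) \<alpha> b)" by (intro exI[of _ \<beta>]) simp
  qed
  then show ?thesis unfolding core_step_def using g by (intro exI[of _ 0]) (auto intro!: exI[of _ \<rho>'])
qed

text \<open>The two sides may annotate \<open>\<phi>\<close> itself differently, but polarity only
  favours the left lying below the right, so a copy must be at fault. Its separating arguments
  become the values of \<open>ys\<close>, whose freshness keeps the contexts refuted.\<close>

lemma core_step_Mono:
  assumes \<rho>: "good C \<rho>"
    and sc: "side_condition (\<Gamma>, \<Delta>, Mono x T \<phi> \<psi> \<chi> ys)"
    and wL: "awt C [] (subst x T \<psi> \<phi>) Omega" and wR: "awt C [] (subst x T \<chi> \<phi>) Omega"
    and wp: "0 < nocc x T \<phi> \<Longrightarrow> wt [] (apps \<psi> (map var_arg ys)) Omega"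
    and rL: "refutes C \<rho> Lft (subst x T \<psi> \<phi>) (ap Lft 0)" and rR: "refutes C \<rho> Rgt (subst x T \<chi> \<phi>) (ap Rgt 0)"
  shows "core_step C \<rho> \<Gamma> \<Delta> (Mono x T \<phi> \<psi> \<chi> ys) ap"
proof -
  let ?c = "Mono x T \<phi> \<psi> \<chi> ys"
  have sc': "wt [] \<phi> Omega" "wt [] \<psi> T" "wt [] \<chi> T" "distinct ys"
    "set ys \<inter> fv_sequent (concl (\<Gamma>, \<Delta>, ?c)) = {}"
    using sc by (simp_all only: side_condition.simps)
  have "erase (ap Lft 0) = msubst x T (\<lambda>_. \<psi>) \<phi>" using rL by (simp add: refutes_def subst_def)
  from erase_eq_msubst[OF this] obtain \<beta>L \<zeta>L where bL: "ap Lft 0 = msubst x T \<zeta>L \<beta>L" "erase \<beta>L = \<phi>"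
    and "\<forall>j<nocc x T \<phi>. erase (\<zeta>L j) = \<psi>" by (elim exE conjE)
  note \<zeta>L = this(3)[rule_format]
  have "erase (ap Rgt 0) = msubst x T (\<lambda>_. \<chi>) \<phi>" using rR by (simp add: refutes_def subst_def)
  from erase_eq_msubst[OF this] obtain \<beta>R \<zeta>R where bR: "ap Rgt 0 = msubst x T \<zeta>R \<beta>R" "erase \<beta>R = \<phi>"
    and "\<forall>j<nocc x T \<phi>. erase (\<zeta>R j) = \<chi>" by (elim exE conjE)
  note \<zeta>R = this(3)[rule_format]
  have nL: "nocc x T \<beta>L = nocc x T \<phi>" and nR: "nocc x T \<beta>R = nocc x T \<phi>"
    using bL(2) bR(2) nocc_erase by metis+
  have \<phi>: "awt C [] \<phi> Omega" using awt_msubst_inv(1)[OF wL[unfolded subst_def] sc'(1,2)] .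
  have w\<zeta>: "awt C [] (\<zeta>L j) T" "awt C [] (\<zeta>R j) T" if "j < nocc x T \<phi>" for j
  proof -
    have "0 < nocc x T \<phi>" using that by simp
    then have "awt C [] \<psi> T" "awt C [] \<chi> T"
      using awt_msubst_inv(2)[OF wL[unfolded subst_def] sc'(1,2)]
        awt_msubst_inv(2)[OF wR[unfolded subst_def] sc'(1,3)] by blast+
    then show "awt C [] (\<zeta>L j) T" "awt C [] (\<zeta>R j) T"
      using erase_awt[OF \<zeta>L[OF that]] erase_awt[OF \<zeta>R[OF that]] by blast+
  qed
  obtain z where z: "map_fm fst z = \<beta>L" "map_fm snd z = \<beta>R"
    using ex_zip_fm[of \<beta>L \<beta>R] bL(2) bR(2) by auto
  have "anns Nu \<beta>L \<subseteq> {None}" "anns Mu \<beta>R \<subseteq> {None}"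
    using rL rR by (simp_all add: refutes_def bL(1) bR(1) anns_msubst)
  then have "fst ` anns Nu z \<subseteq> {None}" "snd ` anns Mu z \<subseteq> {None}"
    unfolding z[symmetric] by simp_all
  then have 1: "(p, q) \<in> anns Mu z \<Longrightarrow> q = None" and 2: "(p, q) \<in> anns Nu z \<Longrightarrow> p = None" for p q
    using imageI[of "(p, q)" "anns Mu z" snd] imageI[of "(p, q)" "anns Nu z" fst] by auto
  have wz: "awt C [] z Omega"
  proof -
    have "erase z = \<phi>" using bL(2) z(1) erase_zip(1)[of z] by simp
    then show ?thesis using \<phi> by (rule erase_awt)
  qed
  have nz: "nocc x T z = nocc x T \<phi>" using nL unfolding z(1)[symmetric] by simp
  have "\<exists>j<nocc x T \<phi>. \<not> leF C T (aeval C \<rho> [] (\<zeta>L j)) (aeval C \<rho> [] (\<zeta>R j))"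
  proof (rule ccontr)
    assume "\<not> ?thesis"
    then have "leF C Omega (aeval C \<rho> [] (ap Lft 0)) (aeval C \<rho> [] (ap Rgt 0))"
      using aeval_msubst_le[OF \<rho> wz, of x T \<zeta>L \<zeta>R "[]"] 1 2 w\<zeta> by (simp add: nz z bL(1) bR(1))
    then show False using rL rR by (simp add: refutes_def)
  qed
  then obtain j where j: "j < nocc x T \<phi>" "\<not> leF C T (aeval C \<rho> [] (\<zeta>L j)) (aeval C \<rho> [] (\<zeta>R j))"
    by blast
  \<comment> \<open>The premise is well typed, and it exists because \<open>x\<close>
    occurs.\<close>
  have "T = foldr Arr (map snd ys) Omega" using wt_unique[OF sc'(2) wt_apps_var_arg[OF wp]] j(1) by simp
  then obtain \<rho>' where \<rho>': "good C \<rho>'" "\<And>x A. (x, A) \<notin> set ys \<Longrightarrow> \<rho>' x A = \<rho> x A"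
    "truth (appsv C (aeval C \<rho> [] (\<zeta>L j)) (map (\<lambda>y. \<rho>' (fst y) (snd y)) ys))"
    "\<not> truth (appsv C (aeval C \<rho> [] (\<zeta>R j)) (map (\<lambda>y. \<rho>' (fst y) (snd y)) ys))"
    using not_leF_witness[OF \<rho> sc'(4) _ awt_adequate[OF w\<zeta>(1)[OF j(1)]] j(2)] by blast
  have fresh: "\<rho>' y A = \<rho> y A" if "\<theta> \<in> seq_forms (concl (\<Gamma>, \<Delta>, ?c))" "(y, A) \<in> fv \<theta>" for \<theta> y A
    using \<rho>'(2) sc'(5) that by (auto simp: fv_sequent_def simp del: concl.simps)
  have forms: "set \<Gamma> \<union> set \<Delta> \<union> {subst x T \<psi> \<phi>, subst x T \<chi> \<phi>} = seq_forms (concl (\<Gamma>, \<Delta>, ?c))"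
    by (auto simp: seq_forms_def)
  have "ctx_ok C \<rho> \<rho>' ?c s \<gamma>" if "\<gamma> \<in> set \<Gamma> \<union> set \<Delta>" for s \<gamma>
  proof -
    have m: "\<gamma> \<in> seq_forms (concl (\<Gamma>, \<Delta>, ?c))" unfolding forms[symmetric] using that by blast
    have "refutes C \<rho>' s \<gamma> b" if "refutes C \<rho> s \<gamma> b" for b
      by (rule refutes_cong[OF that]) (rule fresh[OF m])
    then show ?thesis unfolding ctx_ok_def by auto
  qed
  moreover have "act_ok C \<rho>' ?c ap j s i'" if i': "i' < length (on_side s (actives ?c ! j))" for s i'
  proof -
    define \<zeta> where "\<zeta> = (case s of Lft \<Rightarrow> \<zeta>L j | Rgt \<Rightarrow> \<zeta>R j)"
    define \<omega> where "\<omega> = (case s of Lft \<Rightarrow> \<psi> | Rgt \<Rightarrow> \<chi>)"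
    have i: "i' = 0" "on_side s (actives ?c ! j) ! i' = apps \<omega> (map var_arg ys)"
      using i' j(1) by (cases s; simp add: \<omega>_def)+
    have e: "erase \<zeta> = \<omega>" using \<zeta>L[OF j(1)] \<zeta>R[OF j(1)] by (cases s) (auto simp: \<zeta>_def \<omega>_def)
    have an: "anns (dual (pol s)) \<zeta> \<subseteq> {None}"
      using rL rR j(1) nL nR by (cases s) (auto simp: \<zeta>_def refutes_def bL(1) bR(1) anns_msubst)
    \<comment> \<open>A copy of \<open>\<omega>\<close> stands in the conclusion, so its value does
      not depend on the values given to \<open>ys\<close>.\<close>
    have "subst x T \<omega> \<phi> \<in> seq_forms (concl (\<Gamma>, \<Delta>, ?c))"
      unfolding forms[symmetric] by (cases s) (auto simp: \<omega>_def)
    moreover have "fv \<omega> \<subseteq> fv (subst x T \<omega> \<phi>)" using fv_msubst[of x T \<phi> \<omega>] j(1) by (simp add: subst_def)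
    moreover have "fv \<zeta> = fv \<omega>" using e fv_erase by metis
    ultimately have "aeval C \<rho>' [] \<zeta> = aeval C \<rho> [] \<zeta>" using fresh by (intro aeval_cong) blast
    then have "truth (aeval C \<rho>' [] (apps \<zeta> (map var_arg ys))) \<longleftrightarrow> s = Lft"
      using \<rho>'(3,4) by (cases s) (simp_all add: aeval_apps \<zeta>_def comp_def)
    moreover have "erase (apps \<zeta> (map var_arg ys)) = apps \<omega> (map var_arg ys)"
      using e by (simp add: erase_def)
    ultimately have r: "refutes C \<rho>' s (apps \<omega> (map var_arg ys)) (apps \<zeta> (map var_arg ys))"
      using an by (simp add: refutes_def)
    show ?thesis
    proof (rule act_okI[where b' = "apps \<zeta> (map var_arg ys)"])
      fix i k \<alpha> \<alpha>'
      assume h: "i < length (on_side s (principals ?c))" "core_inherit ?c s j i' k \<alpha> \<alpha>'"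
      have "i = 0" using h(1) by (cases s) simp_all
      obtain \<beta> \<xi> where \<alpha>: "erase \<beta> = \<phi>" "\<forall>n. erase (\<xi> n) = \<omega>" "\<alpha> = msubst x T \<xi> \<beta>"
        "\<alpha>' = apps (\<xi> j) (map var_arg ys)"
        using h(2) by (auto simp: \<omega>_def)
      have n: "nocc x T \<beta> = nocc x T \<phi>" using \<alpha>(1) nocc_erase by metis
      have "zanns (pol s) \<alpha>' (apps \<zeta> (map var_arg ys)) = zanns (pol s) (\<xi> j) \<zeta>"
        unfolding \<alpha>(4) using \<alpha>(2) e by (intro zanns_apps_var_arg) simp
      also have "\<dots> \<subseteq> zanns (pol s) \<alpha> (ap s 0)"
      proof (cases s)
        case Lft
        then show ?thesis
          using zanns_msubst[of \<beta> \<beta>L x T \<xi> \<zeta>L "pol s"] \<alpha> bL \<zeta>L j(1) n by (auto simp: \<zeta>_def \<omega>_def)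
      next
        case Rgt
        then show ?thesis
          using zanns_msubst[of \<beta> \<beta>R x T \<xi> \<zeta>R "pol s"] \<alpha> bR \<zeta>R j(1) n by (auto simp: \<zeta>_def \<omega>_def)
      qed
      finally show "zanns (pol s) \<alpha>' (apps \<zeta> (map var_arg ys)) \<subseteq> zanns (pol s) \<alpha> (ap s i)"
        using \<open>i = 0\<close> by simp
    qed (use r i in simp)
  qed
  ultimately show ?thesis unfolding core_step_def using \<rho>'(1) j(1)
    by (intro exI[of _ j]) (auto intro!: exI[of _ \<rho>'])
qed

lemma map_ctx_prem [simp]:
  "map (ctx_prem (SubstF x T \<psi>)) \<Gamma> = \<Gamma>" "map (ctx_prem (Mono x T \<phi> \<psi> \<chi> ys)) \<Gamma> = \<Gamma>"
  "map (ctx_prem (Nat y)) \<Gamma> = \<Gamma>"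
  by (simp_all add: map_idI)

lemma core_step:
  assumes \<rho>: "good C \<rho>" and sc: "side_condition (\<Gamma>, \<Delta>, c)"
    and w: "\<And>\<phi>. \<phi> \<in> seq_forms (concl (\<Gamma>, \<Delta>, c)) \<Longrightarrow> awt C [] \<phi> Omega"
    and wp: "\<And>S \<phi>. S \<in> set (prems (\<Gamma>, \<Delta>, c)) \<Longrightarrow> \<phi> \<in> seq_forms S \<Longrightarrow> awt C [] \<phi> Omega"
    and r: "\<And>s i. i < length (on_side s (principals c)) \<Longrightarrow>
      refutes C \<rho> s (on_side s (principals c) ! i) (ap s i)"
  shows "core_step C \<rho> \<Gamma> \<Delta> c ap"
proof -
  note L = r[of _ Lft] and R = r[of _ Rgt]
  show ?thesis
  proof (cases c)
    case (Axiom \<phi>)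
    then show ?thesis using core_step_Axiom[OF \<rho>, of \<phi>] w L[of 0] R[of 0] by (simp add: seq_forms_def)
  next
    case (Cut \<phi>)
    then show ?thesis using core_step_Cut[OF \<rho>] by simp
  next
    case (Wk s \<phi>)
    then show ?thesis using core_step_Wk[OF \<rho>] by simp
  next
    case (Ctr s \<phi>)
    then show ?thesis using core_step_Ctr[OF \<rho>] r[of 0 s] by (simp add: on_side_on)
  next
    case (ExL \<phi> \<psi> \<Gamma>')
    then show ?thesis using core_step_ExL[OF \<rho>, of \<Gamma>' \<psi> \<phi> ap] L by simp
  next
    case (ExR \<Delta>' \<phi> \<psi>)
    then show ?thesis using core_step_ExR[OF \<rho>, of \<Delta>' \<psi> \<phi> ap] R by simp
  next
    case (SubstN x t)
    then show ?thesis using core_step_SubstN[OF \<rho>] sc by simp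
  next
    case (SubstF x T \<psi>)
    have "awt C [] (subst x T \<psi> \<gamma>) Omega \<and> wt [] \<gamma> Omega" if "\<gamma> \<in> set \<Gamma> \<union> set \<Delta>" for \<gamma>
      using w[of "subst x T \<psi> \<gamma>"] wp[of "(\<Gamma>, \<Delta>)" \<gamma>] that SubstF
      by (auto simp: seq_forms_def intro: awt_wt)
    then show ?thesis using core_step_SubstF[OF \<rho>, of \<psi> T \<Gamma> \<Delta> x ap] SubstF sc by simp
  next
    case (Mono x T \<phi> \<psi> \<chi> ys)
    have "wt [] (apps \<psi> (map var_arg ys)) Omega" if "0 < nocc x T \<phi>"
      using wp[of "(\<Gamma> @ [apps \<psi> (map var_arg ys)], [apps \<chi> (map var_arg ys)] @ \<Delta>)" "apps \<psi> (map var_arg ys)"]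
        that Mono by (auto simp: seq_forms_def intro: awt_wt)
    then show ?thesis
      using core_step_Mono[OF \<rho>, of \<Gamma> \<Delta> x T \<phi> \<psi> \<chi> ys ap] sc w L[of 0] R[of 0] unfolding Mono
      by (simp add: seq_forms_def)
  next
    case (EqL x y t u)
    then have "wt_tm [] t" "wt_tm [] u" using w[of "Eq t u"] by (simp_all add: seq_forms_def awt_simps)
    then show ?thesis using core_step_EqL[OF \<rho>] EqL L[of 0] by simp
  next
    case (EqR t)
    then show ?thesis using R[of 0] by (auto simp: refutes_def erase_simps)
  next
    case (OrL \<phi> \<psi>)
    then show ?thesis using core_step_OrL[OF \<rho>] L[of 0] by simp
  next
    case (OrR \<phi> \<psi>)
    then show ?thesis using core_step_OrR[OF \<rho>] R[of 0] by simp
  next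
    case (AndL \<phi> \<psi>)
    then show ?thesis using core_step_AndL[OF \<rho>] L[of 0] by simp
  next
    case (AndR \<phi> \<psi>)
    then show ?thesis using core_step_AndR[OF \<rho>] R[of 0] by simp
  next
    case (Beta s A \<phi> e es)
    then have "awt C [] (apps (Lam A \<phi>) (e # es)) Omega"
      using w[of "apps (Lam A \<phi>) (e # es)"] by (cases s) (simp_all add: seq_forms_def)
    then show ?thesis using core_step_Beta[OF \<rho>] r[of 0 s] Beta by (simp add: on_side_on del: apps_simps)
  next
    case (FixR s \<sigma> T \<phi> es)
    then have "awt C [] (apps (Fix \<sigma> () T \<phi>) es) Omega"
      using w[of "apps (Fix \<sigma> () T \<phi>) es"] by (cases s) (simp_all add: seq_forms_def)
    then show ?thesis using core_step_FixR[OF \<rho>] r[of 0 s] FixR by (simp add: on_side_on)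
  next
    case (Nat x)
    then show ?thesis using core_step_Nat[OF \<rho>] wp[of "(\<Gamma> @ [AppT natP (TFr x)], \<Delta>)" "AppT natP (TFr x)"]
      by (simp add: seq_forms_def)
  next
    case (P1 t)
    then show ?thesis using L[of 0] by (auto simp: refutes_def erase_simps)
  next
    case (P2 t u)
    then have "wt_tm [] t" "wt_tm [] u"
      using w[of "Eq (Succ t) (Succ u)"] by (simp_all add: seq_forms_def awt_simps)
    then show ?thesis using core_step_P2[OF \<rho>] P2 L[of 0] by simp
  qed
qed

subsection \<open>Rule instances\<close>

definition unfolds_at :: "rule \<Rightarrow> occ \<Rightarrow> bool" where
  "unfolds_at r q \<longleftrightarrow> is_FixR (snd (snd r)) \<and> principal r q"

text \<open>Carries \<open>core_step\<close> over to positions in whole sequents: principal and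
  active formulas follow \<open>\<Gamma>\<close> on the left and precede \<open>\<Delta>\<close> on
  the right.\<close>

lemma rule_step:
  fixes a :: "occ \<Rightarrow> 'v ord option fm"
  assumes \<rho>: "good C \<rho>" and sc: "side_condition r"
    and w: "\<And>\<phi>. \<phi> \<in> seq_forms (concl r) \<Longrightarrow> awt C [] \<phi> Omega"
    and wp: "\<And>S \<phi>. S \<in> set (prems r) \<Longrightarrow> \<phi> \<in> seq_forms S \<Longrightarrow> awt C [] \<phi> Omega"
    and a: "\<And>q. is_occ (concl r) q \<Longrightarrow> refutes C \<rho> (fst q) (form_at (concl r) q) (a q)"
  shows "\<exists>j<length (prems r). \<exists>\<rho>' a'. good C \<rho>' \<and>
    (\<forall>q'. is_occ (prems r ! j) q' \<longrightarrow> refutes C \<rho>' (fst q') (form_at (prems r ! j) q') (a' q') \<and>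
      (\<forall>q k \<alpha> \<alpha>'. is_occ (concl r) q \<longrightarrow> relevant r j q q' \<longrightarrow> erase \<alpha> = erase (a q) \<longrightarrow>
        inherit r j q q' k \<alpha> \<alpha>' \<longrightarrow> descends (pol (fst q)) (unfolds_at r q) k \<alpha> (a q) \<alpha>' (a' q')))"
proof -
  obtain \<Gamma> \<Delta> c where r: "r = (\<Gamma>, \<Delta>, c)" by (cases r) auto
  let ?n = "length \<Gamma>" and ?m = "length (snd (principals c))"
  define ap where "ap s i = (case s of Lft \<Rightarrow> a (Lft, ?n + i) | Rgt \<Rightarrow> a (Rgt, i))" for s i
  have ap: "refutes C \<rho> s (on_side s (principals c) ! i) (ap s i)"
    if "i < length (on_side s (principals c))" for s i
  proof (cases s)
    case Lft
    then show ?thesis using a[of "(Lft, ?n + i)"] that by (simp add: r ap_def nth_append)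
  next
    case Rgt
    then show ?thesis using a[of "(Rgt, i)"] that by (simp add: r ap_def nth_append)
  qed
  have "core_step C \<rho> \<Gamma> \<Delta> c ap" by (rule core_step) (use \<rho> sc w wp ap r in blast)+
  then obtain j \<rho>' where j: "j < length (actives c)" and \<rho>': "good C \<rho>'"
    and ctxL: "\<And>\<gamma>. \<gamma> \<in> set \<Gamma> \<Longrightarrow> ctx_ok C \<rho> \<rho>' c Lft \<gamma>"
    and ctxR: "\<And>\<gamma>. \<gamma> \<in> set \<Delta> \<Longrightarrow> ctx_ok C \<rho> \<rho>' c Rgt \<gamma>"
    and act: "\<And>s i'. i' < length (on_side s (actives c ! j)) \<Longrightarrow> act_ok C \<rho>' c ap j s i'"
    unfolding core_step_def by blast
  obtain \<Phi> \<Psi> where \<Phi>\<Psi>: "actives c ! j = (\<Phi>, \<Psi>)" by (cases "actives c ! j")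
  have pj: "prems r ! j = (map (ctx_prem c) \<Gamma> @ \<Phi>, \<Psi> @ map (ctx_prem c) \<Delta>)"
    using j \<Phi>\<Psi> by (simp add: r)
  \<comment> \<open>Each occurrence of the premise is treated on its own; choice then assembles the
    function \<open>a'\<close>.\<close>
  define P where "P q' b' \<longleftrightarrow> refutes C \<rho>' (fst q') (form_at (prems r ! j) q') b' \<and>
      (\<forall>q k \<alpha> \<alpha>'. is_occ (concl r) q \<longrightarrow> relevant r j q q' \<longrightarrow> erase \<alpha> = erase (a q) \<longrightarrow>
        inherit r j q q' k \<alpha> \<alpha>' \<longrightarrow> descends (pol (fst q)) (unfolds_at r q) k \<alpha> (a q) \<alpha>' b')" for q' b'
  have "\<exists>b'. P q' b'" if q': "is_occ (prems r ! j) q'" for q'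
  proof (cases q')
    case (Pair s i')
    show ?thesis
    proof (cases s)
      case Lft
      show ?thesis
      proof (cases "i' < ?n")
        case True
        have "refutes C \<rho> Lft (ctx_concl c (\<Gamma> ! i')) (a (Lft, i'))"
          using a[of "(Lft, i')"] True by (simp add: r nth_append)
        then obtain b' where b': "refutes C \<rho>' Lft (ctx_prem c (\<Gamma> ! i')) b'"
          "\<And>\<alpha> \<alpha>'. \<lbrakk>erase \<alpha> = erase (a (Lft, i')); ctx_inherit c (\<Gamma> ! i') \<alpha> \<alpha>'\<rbrakk> \<Longrightarrow>
            zanns Mu \<alpha>' b' \<subseteq> zanns Mu \<alpha> (a (Lft, i'))"
          using ctxL[OF nth_mem[OF True]] unfolding ctx_ok_def by auto
        have "descends (pol (fst q)) (unfolds_at r q) k \<alpha> (a q) \<alpha>' b'"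
          if h: "relevant r j q q'" "erase \<alpha> = erase (a q)" "inherit r j q q' k \<alpha> \<alpha>'" for q k \<alpha> \<alpha>'
        proof -
          obtain t i where q: "q = (t, i)" by (cases q)
          have t: "t = Lft" "i < ?n" "i = i'"
            using h(1) True by (cases t; simp add: q Pair Lft r split: if_splits)+
          then show ?thesis using b'(2)[of \<alpha> \<alpha>'] h(2,3) by (simp add: q Pair Lft r descends_def)
        qed
        then have "P q' b'" using b'(1) True by (simp add: P_def pj Pair Lft nth_append)
        then show ?thesis ..
      next
        case False
        then have i: "i' - ?n < length \<Phi>" using q' by (simp add: pj Pair Lft)
        then obtain b' where b': "refutes C \<rho>' Lft (\<Phi> ! (i' - ?n)) b'"
          "\<And>i k \<alpha> \<alpha>'. \<lbrakk>i < length (fst (principals c)); core_relevant c i (i' - ?n);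
            erase \<alpha> = erase (ap Lft i); core_inherit c Lft j (i' - ?n) k \<alpha> \<alpha>'\<rbrakk> \<Longrightarrow>
            descends Mu (is_FixR c) k \<alpha> (ap Lft i) \<alpha>' b'"
          using act[of "i' - ?n" Lft] unfolding act_ok_def by (auto simp: \<Phi>\<Psi>)
        have "descends (pol (fst q)) (unfolds_at r q) k \<alpha> (a q) \<alpha>' b'"
          if h: "relevant r j q q'" "erase \<alpha> = erase (a q)" "inherit r j q q' k \<alpha> \<alpha>'" for q k \<alpha> \<alpha>'
        proof -
          obtain t i where q: "q = (t, i)" by (cases q)
          have t: "t = Lft" "\<not> i < ?n" "i < ?n + length (fst (principals c))"
            "core_relevant c (i - ?n) (i' - ?n)"
            using h(1) False by (cases t; simp add: q Pair Lft r split: if_splits)+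
          moreover have "ap Lft (i - ?n) = a q" using t by (simp add: ap_def q)
          ultimately show ?thesis using b'(2)[of "i - ?n" \<alpha> k \<alpha>'] h(2,3)
            by (simp add: q Pair Lft r unfolds_at_def)
        qed
        then have "P q' b'" using b'(1) False by (simp add: P_def pj Pair Lft nth_append)
        then show ?thesis ..
      qed
    next
      case Rgt
      show ?thesis
      proof (cases "i' < length \<Psi>")
        case True
        then obtain b' where b': "refutes C \<rho>' Rgt (\<Psi> ! i') b'"
          "\<And>i k \<alpha> \<alpha>'. \<lbrakk>i < ?m; core_relevant c i i';
            erase \<alpha> = erase (ap Rgt i); core_inherit c Rgt j i' k \<alpha> \<alpha>'\<rbrakk> \<Longrightarrow>
            descends Nu (is_FixR c) k \<alpha> (ap Rgt i) \<alpha>' b'"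
          using act[of i' Rgt] unfolding act_ok_def by (auto simp: \<Phi>\<Psi>)
        have "descends (pol (fst q)) (unfolds_at r q) k \<alpha> (a q) \<alpha>' b'"
          if h: "relevant r j q q'" "erase \<alpha> = erase (a q)" "inherit r j q q' k \<alpha> \<alpha>'" for q k \<alpha> \<alpha>'
        proof -
          obtain t i where q: "q = (t, i)" by (cases q)
          have t: "t = Rgt" "i < ?m" "core_relevant c i i'"
            using h(1) True by (cases t; simp add: q Pair Rgt r \<Phi>\<Psi> split: if_splits)+
          then show ?thesis using b'(2)[of i \<alpha> k \<alpha>'] h(2,3)
            by (simp add: q Pair Rgt r unfolds_at_def ap_def)
        qed
        then have "P q' b'" using b'(1) True by (simp add: P_def pj Pair Rgt nth_append)
        then show ?thesis ..
      next
        case False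
        let ?i = "i' - length \<Psi>"
        have i: "?i < length \<Delta>" using q' False by (simp add: pj Pair Rgt)
        have "refutes C \<rho> Rgt (ctx_concl c (\<Delta> ! ?i)) (a (Rgt, ?m + ?i))"
          using a[of "(Rgt, ?m + ?i)"] i by (simp add: r nth_append)
        then obtain b' where b': "refutes C \<rho>' Rgt (ctx_prem c (\<Delta> ! ?i)) b'"
          "\<And>\<alpha> \<alpha>'. \<lbrakk>erase \<alpha> = erase (a (Rgt, ?m + ?i)); ctx_inherit c (\<Delta> ! ?i) \<alpha> \<alpha>'\<rbrakk> \<Longrightarrow>
            zanns Nu \<alpha>' b' \<subseteq> zanns Nu \<alpha> (a (Rgt, ?m + ?i))"
          using ctxR[OF nth_mem[OF i]] unfolding ctx_ok_def by auto
        have "descends (pol (fst q)) (unfolds_at r q) k \<alpha> (a q) \<alpha>' b'"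
          if h: "relevant r j q q'" "erase \<alpha> = erase (a q)" "inherit r j q q' k \<alpha> \<alpha>'" for q k \<alpha> \<alpha>'
        proof -
          obtain t l where q: "q = (t, l)" by (cases q)
          have t: "t = Rgt" "\<not> l < ?m" "l = ?m + ?i"
            using h(1) False by (cases t; simp add: q Pair Rgt r \<Phi>\<Psi> split: if_splits)+
          then show ?thesis using b'(2)[of \<alpha> \<alpha>'] h(2,3) by (simp add: q Pair Rgt r descends_def)
        qed
        then have "P q' b'" using b'(1) False by (simp add: P_def pj Pair Rgt nth_append i)
        then show ?thesis ..
      qed
    qed
  qed
  then obtain a' where a': "\<And>q'. is_occ (prems r ! j) q' \<Longrightarrow> P q' (a' q')" by metis
  have "j < length (prems r)" using j by (simp add: r)
  then show ?thesis using \<rho>' a' unfolding P_def by blast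
qed

section \<open>Infinite falsified paths and the descent of stages\<close>

section \<open>Paths through a cyclic proof\<close>

lemma wf_subtree: "\<lbrakk>wf_tree D; subtree D p = Some t\<rbrakk> \<Longrightarrow> wf_tree t"
  by (induction D p rule: subtree.induct) (auto split: if_splits)

lemma subtree_child:
  "\<lbrakk>subtree D p = Some (Infer r ts); j < length ts\<rbrakk> \<Longrightarrow> subtree D (p @ [j]) = Some (ts ! j)"
  by (induction D p rule: subtree.induct) (auto split: if_splits)

lemma wf_tree_root: "wf_tree t \<Longrightarrow> wf_sequent (root t)"
  by (cases t) auto

text \<open>\<open>proof_types\<close> collects the types of all subformulas in all sequents of the
  tree, which is what \<open>awt_of_wt\<close> asks for.\<close>

lemma awt_node:
  assumes "wf_tree D" "\<forall>T \<in> proof_types D. adequate C T" "subtree D p = Some t" "\<phi> \<in> seq_forms (root t)"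
  shows "awt C [] \<phi> Omega"
proof (rule awt_of_wt)
  show "wt [] \<phi> Omega"
    using wf_tree_root[OF wf_subtree[OF assms(1,3)]] assms(4) by (simp add: wf_sequent_def)
  fix \<Theta> \<psi> U assume "(\<Theta>, \<psi>) \<in> subforms [] \<phi>" "wt \<Theta> \<psi> U"
  then have "U \<in> fm_types \<phi>" by (auto simp: fm_types_def)
  then have "U \<in> proof_types D" using assms(3,4) by (auto simp: proof_types_def)
  then show "adequate C U" using assms(2) by blast
qed

type_synonym 'v state = "nat list \<times> (nat \<Rightarrow> aty \<Rightarrow> 'v val) \<times> (occ \<Rightarrow> 'v ord option fm)"

fun falsified :: "'v coding \<Rightarrow> tree \<Rightarrow> 'v state \<Rightarrow> bool" where
  "falsified C D (p, \<rho>, a) \<longleftrightarrow> good C \<rho> \<and> (\<exists>t. subtree D p = Some t \<and>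
     (\<forall>q. is_occ (root t) q \<longrightarrow> refutes C \<rho> (fst q) (form_at (root t) q) (a q)))"

text \<open>Valuations are left open here, since traces compare stages only. At an open leaf the
  stages persist because the target of \<open>R\<close> has the same sequent.\<close>

fun moves :: "tree \<Rightarrow> (nat list \<Rightarrow> nat list) \<Rightarrow> 'v state \<Rightarrow> 'v state \<Rightarrow> bool" where
  "moves D R (p, \<rho>, a) (p', \<rho>', a') \<longleftrightarrow> (case the (subtree D p) of
      Open S \<Rightarrow> p' = R p \<and> a' = a
    | Infer r ts \<Rightarrow> \<exists>j<length ts. p' = p @ [j] \<and>
        (\<forall>q q' k \<alpha> \<alpha>'. is_occ (concl r) q \<longrightarrow> is_occ (root (ts ! j)) q' \<longrightarrow> relevant r j q q' \<longrightarrow>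
           erase \<alpha> = erase (a q) \<longrightarrow> inherit r j q q' k \<alpha> \<alpha>' \<longrightarrow>
           descends (pol (fst q)) (unfolds_at r q) k \<alpha> (a q) \<alpha>' (a' q')))"

lemma falsified_step:
  assumes pp: "pre_proof D R" and ad: "\<forall>T \<in> proof_types D. adequate C T" and x: "falsified C D x"
  shows "\<exists>y. falsified C D y \<and> moves D R x y"
proof -
  obtain p \<rho> a where x': "x = (p, \<rho>, a)" by (cases x)
  have wf: "wf_tree D" using pp by (simp add: pre_proof_def)
  obtain t where t: "subtree D p = Some t" and \<rho>: "good C \<rho>"
    and a: "\<And>q. is_occ (root t) q \<Longrightarrow> refutes C \<rho> (fst q) (form_at (root t) q) (a q)"
    using x by (auto simp: x')
  show ?thesis
  proof (cases t)
    case (Open S)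
    obtain r ts where "subtree D (R p) = Some (Infer r ts)" "concl r = S"
      using pp t Open unfolding pre_proof_def by blast
    then have "falsified C D (R p, \<rho>, a)" using \<rho> a Open by auto
    moreover have "moves D R x (R p, \<rho>, a)" using t Open by (simp add: x')
    ultimately show ?thesis by blast
  next
    case (Infer r ts)
    have wt: "side_condition r" "map root ts = prems r"
      using wf_subtree[OF wf t] by (simp_all add: Infer)
    have w: "awt C [] \<phi> Omega" if "\<phi> \<in> seq_forms (concl r)" for \<phi>
      using awt_node[OF wf ad t] that by (simp add: Infer)
    have wp: "awt C [] \<phi> Omega" if "S \<in> set (prems r)" "\<phi> \<in> seq_forms S" for S \<phi>
    proof -
      obtain j where j: "j < length ts" "S = root (ts ! j)"
        using \<open>S \<in> set (prems r)\<close> unfolding wt(2)[symmetric] by (auto simp: in_set_conv_nth)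
      show ?thesis
        using awt_node[OF wf ad subtree_child[OF t[unfolded Infer] j(1)]] that(2) j(2) by simp
    qed
    have "\<exists>j<length (prems r). \<exists>\<rho>' a'. good C \<rho>' \<and>
      (\<forall>q'. is_occ (prems r ! j) q' \<longrightarrow> refutes C \<rho>' (fst q') (form_at (prems r ! j) q') (a' q') \<and>
        (\<forall>q k \<alpha> \<alpha>'. is_occ (concl r) q \<longrightarrow> relevant r j q q' \<longrightarrow> erase \<alpha> = erase (a q) \<longrightarrow>
          inherit r j q q' k \<alpha> \<alpha>' \<longrightarrow> descends (pol (fst q)) (unfolds_at r q) k \<alpha> (a q) \<alpha>' (a' q')))"
      by (rule rule_step[OF \<rho> wt(1) w wp]) (use a in \<open>simp_all add: Infer\<close>)
    then obtain j \<rho>' a' where j: "j < length (prems r)" and \<rho>': "good C \<rho>'"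
      and a': "\<And>q'. is_occ (prems r ! j) q' \<Longrightarrow> refutes C \<rho>' (fst q') (form_at (prems r ! j) q') (a' q')"
      and d: "\<And>q q' k \<alpha> \<alpha>'. \<lbrakk>is_occ (prems r ! j) q'; is_occ (concl r) q; relevant r j q q';
        erase \<alpha> = erase (a q); inherit r j q q' k \<alpha> \<alpha>'\<rbrakk> \<Longrightarrow>
        descends (pol (fst q)) (unfolds_at r q) k \<alpha> (a q) \<alpha>' (a' q')"
      by blast
    have l: "j < length ts" using j unfolding wt(2)[symmetric] by simp
    have pj: "prems r ! j = root (ts ! j)" using l unfolding wt(2)[symmetric] by simp
    have "falsified C D (p @ [j], \<rho>', a')"
      unfolding falsified.simps using subtree_child[OF t[unfolded Infer] l] \<rho>' a' unfolding pj by blast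
    moreover have "moves D R x (p @ [j], \<rho>', a')"
      unfolding x' moves.simps t option.sel Infer tree.case using l d unfolding pj by blast
    ultimately show ?thesis by blast
  qed
qed

text \<open>
  A nonempty annotation \<open>q @ [\<kappa> i]\<close> is created at step \<open>i\<close> only and thus comes with a single stage.
  Along the prefixes of \<open>p\<close> these stages decrease.
\<close>

lemma no_infinite_descent:
  fixes Z :: "nat \<Rightarrow> (nat list \<times> 'v ord option) set"
  assumes init: "fst ` Z 0 \<subseteq> {[]}"
    and step: "\<And>i. Z (Suc i) \<subseteq> Z i \<or> i \<in> U \<and> (\<exists>q p a. (q, p) \<in> Z i \<and> a \<in> below p \<and>
      Z (Suc i) \<subseteq> insert (q @ [\<kappa> i], Some a) (Z i))"
    and inj: "inj_on \<kappa> U"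
    and pre: "\<And>n. \<exists>i. map f [0..<n] \<in> fst ` Z i"
  shows False
proof -
  define V where "V i q p a \<longleftrightarrow> i \<in> U \<and> (q, p) \<in> Z i \<and> a \<in> below p \<and>
    Z (Suc i) \<subseteq> insert (q @ [\<kappa> i], Some a) (Z i)" for i q p a
  have "\<exists>q p a. Z (Suc i) \<subseteq> Z i \<or> V i q p a" for i using step[of i] unfolding V_def by blast
  then obtain Q P A where QPA: "\<And>i. Z (Suc i) \<subseteq> Z i \<or> V i (Q i) (P i) (A i)" by metis
  define W where "W = {i. V i (Q i) (P i) (A i)}"
  \<comment> \<open>Initially all labels are empty, so a pair with a nonempty label stems from a
    step in \<open>W\<close>.\<close>
  have created: "\<exists>i'\<in>W. q = Q i' @ [\<kappa> i'] \<and> p = Some (A i')" if "(q, p) \<in> Z i" "q \<noteq> []" for q p i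
    using that
  proof (induction i)
    case 0
    then have "q \<in> fst ` Z 0" by force
    then show ?case using init 0 by blast
  next
    case (Suc i)
    show ?case
    proof (cases "(q, p) \<in> Z i")
      case True
      then show ?thesis using Suc by blast
    next
      case False
      then have "V i (Q i) (P i) (A i)" using QPA[of i] Suc.prems(1) by blast
      then show ?thesis using Suc.prems(1) False by (intro bexI[of _ i]) (auto simp: V_def W_def)
    qed
  qed
  \<comment> \<open>The prefix of length \<open>n + 1\<close> arose by appending \<open>f n\<close>
    to that of length \<open>n\<close>.\<close>
  have "\<exists>i\<in>W. Q i = map f [0..<n] \<and> \<kappa> i = f n" for n
  proof -
    obtain i p where "(map f [0..<Suc n], p) \<in> Z i" using pre[of "Suc n"] by force
    then obtain i' where "i' \<in> W" "map f [0..<Suc n] = Q i' @ [\<kappa> i']" using created by fastforce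
    then show ?thesis by auto
  qed
  then obtain I where I: "\<And>n. I n \<in> W" "\<And>n. Q (I n) = map f [0..<n]" "\<And>n. \<kappa> (I n) = f n" by metis
  \<comment> \<open>The pair used at \<open>I (Suc n)\<close> has a label ending in
    \<open>f n\<close>. Injectivity of \<open>\<kappa>\<close> identifies \<open>I n\<close> as its
    creating step, and so \<open>A (I n)\<close> as its stage.\<close>
  have "(A (I (Suc n)), A (I n)) \<in> ord_less" for n
  proof -
    have v: "V (I (Suc n)) (Q (I (Suc n))) (P (I (Suc n))) (A (I (Suc n)))"
      using I(1)[of "Suc n"] by (simp add: W_def)
    then have "(map f [0..<Suc n], P (I (Suc n))) \<in> Z (I (Suc n))" by (simp add: V_def I(2))
    from created[OF this] obtain i' where i': "i' \<in> W" "map f [0..<Suc n] = Q i' @ [\<kappa> i']"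
      "P (I (Suc n)) = Some (A i')" by auto
    have "\<kappa> i' = \<kappa> (I n)" using i'(2) I(3) by simp
    moreover have "i' \<in> U" "I n \<in> U" using i'(1) I(1)[of n] by (auto simp: W_def V_def)
    ultimately have "i' = I n" using inj by (auto dest: inj_onD)
    then have "A (I (Suc n)) \<in> below (Some (A (I n)))" using v i'(3) by (simp add: V_def)
    then show ?thesis by (simp add: below_def)
  qed
  then have "\<exists>g. \<forall>n. (g (Suc n), g n) \<in> (ord_less :: 'v ord rel)"
    by (intro exI[of _ "\<lambda>n. A (I n)"]) blast
  then show False using wf_ord_less unfolding wf_iff_no_infinite_down_chain by blast
qed

lemma relevant_side: "relevant r j q q' \<Longrightarrow> fst q' = fst q"
  by (cases "(r, j, q, q')" rule: relevant.cases) auto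

lemma no_falsified_trace:
  fixes C :: "'v coding" and x :: "nat \<Rightarrow> 'v state"
  assumes x: "\<And>i. falsified C D (x i)" "\<And>i. moves D R (x i) (x (Suc i))"
    and tr: "fp_trace \<sigma> D (\<lambda>i. fst (x i)) \<tau>" and s: "\<sigma> = pol (fst (\<tau> 0))"
  shows False
proof -
  define \<pi> where "\<pi> = (\<lambda>i. fst (x i))"
  define a where "a i = snd (snd (x i))" for i
  obtain \<kappa> \<alpha> f where an: "annotation D \<pi> \<tau> \<kappa> \<alpha>" and f: "\<And>n. \<exists>i. map f [0..<n] \<in> anns \<sigma> (\<alpha> i)"
    using tr unfolding fp_trace_def \<pi>_def by blast
  have occ: "is_occ (node_seq D (\<pi> i)) (\<tau> i)" for i
    using tr by (simp add: fp_trace_def trace_def \<pi>_def)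
  have rel: "case the (subtree D (\<pi> i)) of Open S \<Rightarrow> \<tau> (Suc i) = \<tau> i
       | Infer r ts \<Rightarrow> relevant r (last (\<pi> (Suc i))) (\<tau> i) (\<tau> (Suc i))" for i
    using tr unfolding fp_trace_def trace_def \<pi>_def by blast
  have node: "\<exists>t. subtree D (\<pi> i) = Some t \<and>
    (\<forall>q. is_occ (root t) q \<longrightarrow> erase (a i q) = form_at (root t) q)" for i
    using x(1)[of i] by (cases "x i") (auto simp: \<pi>_def a_def refutes_def)
  have er: "erase (\<alpha> i) = erase (a i (\<tau> i))" for i
  proof -
    obtain t where t: "subtree D (\<pi> i) = Some t"
      "\<forall>q. is_occ (root t) q \<longrightarrow> erase (a i q) = form_at (root t) q"
      using node[of i] by blast
    have n: "node_seq D (\<pi> i) = root t" by (simp add: node_seq_def t(1))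
    have "erase (\<alpha> i) = form_at (root t) (\<tau> i)"
      using an unfolding annotation_def n[symmetric] by blast
    also have "\<dots> = erase (a i (\<tau> i))" using t(2)[rule_format, OF occ[of i, unfolded n]] by (rule sym)
    finally show ?thesis .
  qed
  \<comment> \<open>Relevance never changes sides, so the kind followed by the trace remains the
    approximated one.\<close>
  have side: "fst (\<tau> i) = fst (\<tau> 0)" for i
  proof (induction i)
    case (Suc i)
    then show ?case using rel[of i] relevant_side by (auto split: tree.splits)
  qed simp
  define Z where "Z i = zanns \<sigma> (\<alpha> i) (a i (\<tau> i))" for i
  have fZ: "fst ` Z i = anns \<sigma> (\<alpha> i)" for i unfolding Z_def by (rule fst_zanns[OF er])
  have "fst ` Z 0 \<subseteq> {[]}" using an by (auto simp: fZ annotation_def)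
  moreover have "Z (Suc i) \<subseteq> Z i \<or> i \<in> {i. unfolds D \<pi> \<tau> i} \<and> (\<exists>q p b. (q, p) \<in> Z i \<and> b \<in> below p \<and>
      Z (Suc i) \<subseteq> insert (q @ [\<kappa> i], Some b) (Z i))" for i
  proof -
    obtain t where t: "subtree D (\<pi> i) = Some t" using node by blast
    have m: "moves D R (\<pi> i, fst (snd (x i)), a i) (\<pi> (Suc i), fst (snd (x (Suc i))), a (Suc i))"
      using x(2)[of i] by (simp add: \<pi>_def a_def)
    have inh: "case the (subtree D (\<pi> i)) of Open S \<Rightarrow> \<alpha> (Suc i) = \<alpha> i
       | Infer r ts \<Rightarrow> inherit r (last (\<pi> (Suc i))) (\<tau> i) (\<tau> (Suc i)) (\<kappa> i) (\<alpha> i) (\<alpha> (Suc i))"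
      using an by (simp add: annotation_def)
    show ?thesis
    proof (cases t)
      case (Open S)
      then have "Z (Suc i) = Z i" using m inh rel[of i] t by (simp add: Z_def)
      then show ?thesis by simp
    next
      case (Infer r ts)
      obtain j where j: "j < length ts" "\<pi> (Suc i) = \<pi> i @ [j]"
        and d: "\<And>q q' k \<beta> \<beta>'. \<lbrakk>is_occ (concl r) q; is_occ (root (ts ! j)) q'; relevant r j q q';
           erase \<beta> = erase (a i q); inherit r j q q' k \<beta> \<beta>'\<rbrakk> \<Longrightarrow>
           descends (pol (fst q)) (unfolds_at r q) k \<beta> (a i q) \<beta>' (a (Suc i) q')"
        using m t Infer by auto
      have "descends (pol (fst (\<tau> i))) (unfolds_at r (\<tau> i)) (\<kappa> i) (\<alpha> i) (a i (\<tau> i)) (\<alpha> (Suc i)) (a (Suc i) (\<tau> (Suc i)))"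
      proof (rule d)
        show "is_occ (concl r) (\<tau> i)" using occ[of i] by (simp add: node_seq_def t Infer)
        show "is_occ (root (ts ! j)) (\<tau> (Suc i))"
          using occ[of "Suc i"] subtree_child[OF t[unfolded Infer] j(1)] by (simp add: node_seq_def j(2))
      qed (use rel[of i] inh er t Infer j in simp_all)
      then have "descends \<sigma> (unfolds_at r (\<tau> i)) (\<kappa> i) (\<alpha> i) (a i (\<tau> i)) (\<alpha> (Suc i)) (a (Suc i) (\<tau> (Suc i)))"
        by (simp only: s side[of i])
      moreover have "unfolds D \<pi> \<tau> i" if "unfolds_at r (\<tau> i)"
      proof -
        obtain \<Gamma> \<Delta> c where r: "r = (\<Gamma>, \<Delta>, c)" by (cases r) auto
        have "is_FixR c" "principal (\<Gamma>, \<Delta>, c) (\<tau> i)" using that by (simp_all add: unfolds_at_def r)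
        then show ?thesis using t Infer r by (cases c) (auto simp: unfolds_def)
      qed
      ultimately show ?thesis unfolding descends_def Z_def by blast
    qed
  qed
  moreover have "inj_on \<kappa> {i. unfolds D \<pi> \<tau> i}" using an by (simp add: annotation_def)
  moreover have "\<exists>i. map f [0..<n] \<in> fst ` Z i" for n using f[of n] by (simp add: fZ)
  ultimately show False by (rule no_infinite_descent)
qed

text \<open>Constant functions are monotone. This supplies values for the variables that a given
  valuation leaves open.\<close>

lemma domA_nonempty: "domA C A \<noteq> {}"
proof -
  have F: "domF C T \<noteq> {}" for T
  proof (induction T rule: fty_induct)
    case (Arr A T)
    then obtain e where "e \<in> domF C T" by blast
    then have "restr (domA C A) (\<lambda>_. e) \<in> mfuns C A T" by (intro mono_funsI) (auto simp: restr_def)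
    then show ?case by auto
  qed auto
  then show ?thesis by (cases A) auto
qed

lemma falsified_root:
  assumes wf: "wf_tree D" and ad: "\<forall>T \<in> proof_types D. adequate C T" and nv: "\<not> valid C (root D)"
  shows "\<exists>\<rho> a. falsified C D ([], \<rho>, a)"
proof -
  let ?S = "root D"
  obtain \<rho>0 where \<rho>0: "\<And>x A. (x, A) \<in> fv_sequent ?S \<Longrightarrow> \<rho>0 x A \<in> domA C A"
    "\<And>\<phi>. \<phi> \<in> set (fst ?S) \<Longrightarrow> eval C \<rho>0 [] \<phi> \<noteq> VB False"
    "\<And>\<psi>. \<psi> \<in> set (snd ?S) \<Longrightarrow> eval C \<rho>0 [] \<psi> \<noteq> VB True"
    using nv unfolding valid_def by blast
  define \<rho> where "\<rho> x A = (if (x, A) \<in> fv_sequent ?S then \<rho>0 x A else (SOME d. d \<in> domA C A))" for x A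
  have \<rho>: "good C \<rho>"
    using \<rho>0(1) domA_nonempty[of C] by (auto simp: good_def \<rho>_def some_in_eq)
  \<comment> \<open>Membership in \<open>range VB\<close> turns a value other than
    \<open>VB False\<close> into a true one.\<close>
  have ev: "eval C \<rho> [] \<phi> = eval C \<rho>0 [] \<phi>" "eval C \<rho> [] \<phi> \<in> range VB" if "\<phi> \<in> seq_forms ?S" for \<phi>
  proof -
    have "fv (exact \<phi>) \<subseteq> fv_sequent ?S" using that by (auto simp: fv_sequent_def exact_def)
    then show "eval C \<rho> [] \<phi> = eval C \<rho>0 [] \<phi>"
      unfolding aeval_exact[symmetric] by (intro aeval_cong) (auto simp: \<rho>_def)
    have "awt C [] (exact \<phi>) Omega" using awt_node[OF wf ad, of "[]"] that by simp
    then show "eval C \<rho> [] \<phi> \<in> range VB"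
      unfolding aeval_exact[symmetric] using aeval_in[OF \<rho>, of "[]" "exact \<phi>" Omega "[]"] by simp
  qed
  have "refutes C \<rho> (fst q) (form_at ?S q) (exact (form_at ?S q))"
    if "is_occ ?S q" for q
  proof (cases q)
    case (Pair s i)
    show ?thesis
    proof (rule refutes_exact)
      show "truth (eval C \<rho> [] (form_at ?S q)) \<longleftrightarrow> fst q = Lft"
      proof (cases s)
        case Lft
        then have "fst ?S ! i \<in> set (fst ?S)" using that Pair by simp
        then show ?thesis using ev[of "fst ?S ! i"] \<rho>0(2)[of "fst ?S ! i"] Pair Lft by (auto simp: seq_forms_def)
      next
        case Rgt
        then have "snd ?S ! i \<in> set (snd ?S)" using that Pair by simp
        then show ?thesis using ev[of "snd ?S ! i"] \<rho>0(3)[of "snd ?S ! i"] Pair Rgt by (auto simp: seq_forms_def)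
      qed
    qed
  qed
  then have "falsified C D ([], \<rho>, \<lambda>q. exact (form_at ?S q))"
    unfolding falsified.simps subtree.simps using \<rho> by blast
  then show ?thesis by blast
qed

theorem theorem20:
  fixes C :: "'v coding" and D :: tree and R :: "nat list \<Rightarrow> nat list"
    and \<Gamma> \<Delta> :: "form list"
  assumes "cyclic_proof D R" and "root D = (\<Gamma>, \<Delta>)"
    and "\<forall>T \<in> proof_types D. adequate C T"
  shows "valid C (\<Gamma>, \<Delta>)"
proof (rule ccontr)
  assume "\<not> valid C (\<Gamma>, \<Delta>)"
  have pp: "pre_proof D R" using assms(1) by (simp add: cyclic_proof_def)
  then have wf: "wf_tree D" by (simp add: pre_proof_def)
  obtain x0 where x0: "falsified C D x0"
    using falsified_root[OF wf assms(3), unfolded assms(2)] \<open>\<not> valid C (\<Gamma>, \<Delta>)\<close> by blast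
  \<comment> \<open>Dependent choice, since each state is found from the valuation and the stages of
    the previous one.\<close>
  obtain x where x: "\<And>i. falsified C D (x i)" "\<And>i. moves D R (x i) (x (Suc i))"
    using dependent_nat_choice[of "\<lambda>_. falsified C D" "\<lambda>_. moves D R"] x0 falsified_step[OF pp assms(3)]
    by blast
  have "inf_path D R (\<lambda>i. fst (x i))"
    unfolding inf_path_def
  proof
    fix i
    obtain p \<rho> a p' \<rho>' a' where e: "x i = (p, \<rho>, a)" "x (Suc i) = (p', \<rho>', a')"
      by (cases "x i"; cases "x (Suc i)")
    obtain t where "subtree D p = Some t" using x(1)[of i] by (auto simp: e)
    then show "case subtree D (fst (x i)) of None \<Rightarrow> False
      | Some (Open S) \<Rightarrow> fst (x (Suc i)) = R (fst (x i))
      | Some (Infer r ts) \<Rightarrow> \<exists>j<length ts. fst (x (Suc i)) = fst (x i) @ [j]"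
      using x(2)[of i] by (cases t) (auto simp: e)
  qed
  then have "\<exists>m \<tau>. fp_trace Mu D (\<lambda>i. fst (x (m + i))) \<tau> \<and> fst (\<tau> 0) = Lft \<or>
      fp_trace Nu D (\<lambda>i. fst (x (m + i))) \<tau> \<and> fst (\<tau> 0) = Rgt"
    using assms(1) unfolding cyclic_proof_def by blast
  then obtain m \<tau> where "fp_trace Mu D (\<lambda>i. fst (x (m + i))) \<tau> \<and> fst (\<tau> 0) = Lft \<or>
      fp_trace Nu D (\<lambda>i. fst (x (m + i))) \<tau> \<and> fst (\<tau> 0) = Rgt" by blast
  \<comment> \<open>The trace starts at state \<open>m\<close>, whose formulas may already carry
    stages; its own labels start afresh as \<open>[]\<close>, as the descent requires.\<close>
  then have "fp_trace (pol (fst (\<tau> 0))) D (\<lambda>i. fst (x (m + i))) \<tau>" by auto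
  then show False using no_falsified_trace[of C D "\<lambda>i. x (m + i)" R _ \<tau>] x by simp
qed

end
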